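(* Let $\theta=[a_1,a_2,\dots]\in(3/5,2/3)$ be irrational of unbounded type, and let $N_1<N_2<\dots$ be the indices $N$ such that $a_N>a_i$ for all $i<N$. Suppose there is $\tau>0$ such that $N_{k+1}-N_k>2^{(5+\tau)a_{N_{k+1}}}$ for all sufficiently large $k$. If the quadratic polynomial $f(x)=x^2+c$ is $\theta$-recurrent, then the closure $\overline{\mathcal O}$ of its critical orbit $\mathcal O=\{f^k(0)\}_{k\ge0}$ has Hausdorff dimension $0$.
   Context: A real quadratic polynomial $x^2+c$ with bounded critical orbit is regarded as a unimodal map after restricting it to its invariant interval $[-\beta,\beta]$ ($\beta$ the largest real fixed point) and rescaling affinely to $I=[-1,1]$; a unimodal map is a continuous $f:I\to I$ strictly decreasing on $[-1,0]$, strictly increasing on $[0,1]$, $f(\pm1)=1$. For $x\neq0$ let $x'$ be the other point with $f(x')=f(x)$, $0':=0$, $I_x$ the closed interval with endpoints $x,x'$. $\theta=[a_1,a_2,\dots]=1/(a_1+1/(a_2+\cdots))$; unbounded type means $\sup a_i=\infty$; $q_n$ is the denominator of $[a_1,\dots,a_n]$. For $x\in I$ with orbit $x_k=f^k(x)$, $k\ge1$ is a time of closest recurrence of $x$ to $I_x$ if $f(x_k)<f(x_j)$ for all $0<j<k$. For $\theta_N=[a_1,\dots,a_N]$, $x$ has $\theta_N$-recurrence if: (i) $x_k\notin I_x$ for $k=1,\dots,q_N$; (ii) the times of closest recurrence of $x$ to $I_x$ in $\{1,\dots,q_N\}$ are exactly $q_1,\dots,q_N$; (iii) for $m=0,\dots,a_N-1$,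 $x_{mq_{N-1}}$ has $[a_1,\dots,a_{N-1}]$-recurrence (void for $N=1$). $f$ is $\theta$-recurrent if $0$ has $[a_1,\dots,a_n]$-recurrence for every $n$. *)

theory Defs
  imports "HOL-Analysis.Analysis"
begin

definition hausdorff_pre :: "real \<Rightarrow> real \<Rightarrow> real set \<Rightarrow> ennreal" where
  "hausdorff_pre s \<delta> A =
     (INF U \<in> {U :: nat \<Rightarrow> real set. A \<subseteq> (\<Union>i. U i) \<and>
                 (\<forall>i. bounded (U i) \<and> diameter (U i) \<le> \<delta>)}.
        (\<Sum>i. ennreal (diameter (U i) powr s)))"

definition hausdorff_measure :: "real \<Rightarrow> real set \<Rightarrow> ennreal" where
  "hausdorff_measure s A = (SUP \<delta> \<in> {0<..}. hausdorff_pre s \<delta> A)"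

definition hausdorff_dim :: "real set \<Rightarrow> real" where
  "hausdorff_dim A = Inf {s. 0 \<le> s \<and> hausdorff_measure s A = 0}"

fun cf_list :: "nat list \<Rightarrow> rat" where
  "cf_list [] = 0"
| "cf_list (x # xs) = 1 / (of_nat x + cf_list xs)"

definition cf_q :: "(nat \<Rightarrow> nat) \<Rightarrow> nat \<Rightarrow> nat" where
  "cf_q a n = nat (snd (quotient_of (cf_list (map a [1..<Suc n]))))"

definition is_cf_expansion :: "real \<Rightarrow> (nat \<Rightarrow> nat) \<Rightarrow> bool" where
  "is_cf_expansion \<theta> a \<longleftrightarrow> (\<forall>i\<ge>1. a i \<ge> 1) \<and>
     (\<lambda>n. real_of_rat (cf_list (map a [1..<Suc n]))) \<longlonglongrightarrow> \<theta>"

definition unbounded_type :: "(nat \<Rightarrow> nat) \<Rightarrow> bool" where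
  "unbounded_type a \<longleftrightarrow> \<not> bdd_above (a ` {1..})"

text \<open>The record indices N_1 < N_2 < ...: N with a_N > a_i for all 1 <= i < N.
  record_index a k = N_{k+1} (0-based enumeration).\<close>
definition record_set :: "(nat \<Rightarrow> nat) \<Rightarrow> nat set" where
  "record_set a = {N. 1 \<le> N \<and> (\<forall>i\<in>{1..<N}. a i < a N)}"

definition record_index :: "(nat \<Rightarrow> nat) \<Rightarrow> nat \<Rightarrow> nat" where
  "record_index a k = enumerate (record_set a) k"

definition unimodal :: "(real \<Rightarrow> real) \<Rightarrow> bool" where
  "unimodal g \<longleftrightarrow> continuous_on {-1..1} g \<and> g ` {-1..1} \<subseteq> {-1..1} \<and>
     strict_antimono_on {-1..0} g \<and> strict_mono_on {0..1} g \<and> g (-1) = 1 \<and> g 1 = 1"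

definition uprime :: "(real \<Rightarrow> real) \<Rightarrow> real \<Rightarrow> real" where
  "uprime g x = (if x = 0 then 0 else (THE y. y \<in> {-1..1} \<and> y \<noteq> x \<and> g y = g x))"

definition Ival :: "(real \<Rightarrow> real) \<Rightarrow> real \<Rightarrow> real set" where
  "Ival g x = {min x (uprime g x) .. max x (uprime g x)}"

definition closest_rec :: "(real \<Rightarrow> real) \<Rightarrow> real \<Rightarrow> nat \<Rightarrow> bool" where
  "closest_rec g x k \<longleftrightarrow> 1 \<le> k \<and>
     (\<forall>j. 0 < j \<and> j < k \<longrightarrow> g ((g ^^ k) x) < g ((g ^^ j) x))"

fun has_cf_rec :: "(real \<Rightarrow> real) \<Rightarrow> (nat \<Rightarrow> nat) \<Rightarrow> nat \<Rightarrow> real \<Rightarrow> bool" where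
  "has_cf_rec g a 0 x = True"
| "has_cf_rec g a (Suc n) x \<longleftrightarrow>
     (\<forall>k\<in>{1..cf_q a (Suc n)}. (g ^^ k) x \<notin> Ival g x) \<and>
     {k\<in>{1..cf_q a (Suc n)}. closest_rec g x k} = cf_q a ` {1..Suc n} \<and>
     (\<forall>m<a (Suc n). has_cf_rec g a n ((g ^^ (m * cf_q a n)) x))"

definition theta_recurrent :: "(real \<Rightarrow> real) \<Rightarrow> (nat \<Rightarrow> nat) \<Rightarrow> bool" where
  "theta_recurrent g a \<longleftrightarrow> (\<forall>n\<ge>1. has_cf_rec g a n 0)"

definition quad :: "real \<Rightarrow> real \<Rightarrow> real" where
  "quad c x = x ^ 2 + c"

definition qbeta :: "real \<Rightarrow> real" where
  "qbeta c = Max {x. quad c x = x}"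

text \<open>Affine rescaling of quad c on [-beta,beta] to [-1,1].\<close>
definition quad_unimodal :: "real \<Rightarrow> real \<Rightarrow> real" where
  "quad_unimodal c y = quad c (qbeta c * y) / qbeta c"

end

theory Submission
  imports Defs "HOL-Real_Asymp.Real_Asymp"
begin

text \<open>
  Let \<open>f(x) = x\<^sup>2 + c\<close>, \<open>d\<^sub>n = \<bar>f\<^bsup>q\<^sub>n\<^esup>(0)\<bar>\<close>, and let \<open>D\<^sub>n\<close> be the product of the \<open>2 \<bar>f\<^bsup>i\<^esup>(0)\<bar>\<close>
  over \<open>0 < i < q\<^sub>n\<close>, i.e. the derivative of \<open>f\<^bsup>q\<^sub>n\<^esup>\<close> at \<open>0\<close> with respect to \<open>x\<^sup>2\<close>. The recurrence
  conditions force \<open>f\<^bsup>q\<^sub>n\<^esup>\<close> to be monotone on an interval \<open>[0, e\<^sub>n]\<close> which it maps across \<open>0\<close>, with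
  end points going to \<open>\<plusminus>d\<^sub>n\<close> and to the opposite side \<open>\<plusminus>d\<^sub>n\<^sub>-\<^sub>2\<close>. Monotone branches of iterates of \<open>f\<close> expand
  cross-ratios, and this yields for \<open>Z\<^sub>n = D\<^sub>n d\<^sub>n\<^sub>-\<^sub>1\<close> the two inequalities
  \<open>Z\<^sub>n \<ge> 2 Z\<^sub>n\<^sub>-\<^sub>1 / (1 + d\<^sub>n\<^sub>-\<^sub>2 / d\<^sub>n\<^sub>-\<^sub>4)\<close> and \<open>Z\<^sub>n d\<^sub>n\<^sub>+\<^sub>1\<^sup>2 \<le> 8 d\<^sub>n d\<^sub>n\<^sub>-\<^sub>1\<close>. Since \<open>Z\<^sub>3 > 11\<close>, the second
  inequality bounds \<open>d\<^sub>n\<^sub>+\<^sub>1 / d\<^sub>n\<^sub>-\<^sub>1\<close> away from \<open>1\<close>, so by the first \<open>Z\<^sub>n\<close> grows exponentially and, by the second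
  again, \<open>d\<^sub>n\<close> decays like \<open>exp (- \<kappa> n\<^sup>2)\<close>. The critical orbit is covered by \<open>2 q\<^sub>n\<close> intervals of length at
  most \<open>C\<^sup>n d\<^sub>n\<^sub>-\<^sub>2\<close>, and \<open>log q\<^sub>n = O(n log n)\<close> because the gaps between records make \<open>a\<^sub>n\<close> grow at most
  linearly.
\<close>

section \<open>Absolute values along quadratic orbits\<close>

text \<open>Recurrence compares positions of orbit points only; nowhere does it say where an iterate
  of \<open>f\<close> is monotone, and extracting this is the main obstacle. Whether the branch of
  \<open>f^(q n)\<close> at 0 reaches a zero before its turning point depends on a return two levels
  higher, while locating that return requires the lower branches. Branches and positions are
  therefore established in one staggered induction. The second obstacle is that partial quotients
  are unbounded, so ratios of consecutive \<open>d n\<close> have no a priori bound. The constants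
  must ignore the number of blocks in a run; a whole run is therefore treated as one monotone
  branch, and comparing lengths along the orbit costs a factor 8 per level, not per block. The range
  of \<theta> enters through its first three partial quotients, all equal to 1. They make the lowest
  levels explicit: \<open>q 1\<close>, \<open>q 2\<close>, \<open>q 3\<close> are 1, 2, 3 and
  \<open>c < -17/10\<close>. The resulting bound on \<open>Z 3\<close> has to exceed the 8 of the
  upper inequality to start the growth.\<close>

definition abs_iter :: "real \<Rightarrow> nat \<Rightarrow> real \<Rightarrow> real" where
  "abs_iter c k t = \<bar>(quad c ^^ k) t\<bar>"

lemma abs_iter_0 [simp]: "abs_iter c 0 t = \<bar>t\<bar>"
  by (simp add: abs_iter_def)

lemma abs_iter_nonneg [simp]: "0 \<le> abs_iter c k t"
  by (simp add: abs_iter_def)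

lemma quad_abs [simp]: "quad c \<bar>t\<bar> = quad c t"
  by (simp add: quad_def)

lemma quad_iter_abs: "0 < k \<Longrightarrow> (quad c ^^ k) \<bar>t\<bar> = (quad c ^^ k) t"
  by (cases k) (simp_all add: funpow_Suc_right del: funpow.simps)

lemma abs_iter_abs [simp]: "abs_iter c k \<bar>t\<bar> = abs_iter c k t"
  by (cases "k = 0") (simp_all add: abs_iter_def quad_iter_abs)

lemma abs_iter_add: "abs_iter c (k + l) t = abs_iter c k (abs_iter c l t)"
  by (metis abs_iter_abs abs_iter_def comp_apply funpow_add)

lemma continuous_quad_iter: "continuous_on S (quad c ^^ k)"
proof (induction k)
  case (Suc k)
  have "(quad c ^^ Suc k) = (\<lambda>t. ((quad c ^^ k) t)\<^sup>2 + c)"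
    by (auto simp: quad_def)
  then show ?case
    using Suc by (auto intro!: continuous_intros)
qed (simp add: continuous_on_id id_def)

lemma continuous_abs_iter: "continuous_on S (abs_iter c k)"
  unfolding abs_iter_def using continuous_quad_iter by (auto intro!: continuous_intros)

definition first_zero :: "real \<Rightarrow> nat \<Rightarrow> real" where
  "first_zero c k = Inf {t. 0 \<le> t \<and> abs_iter c k t = 0}"

lemma first_zero_eq:
  assumes "0 \<le> z" "abs_iter c k z = 0" "\<And>t. 0 \<le> t \<Longrightarrow> t < z \<Longrightarrow> abs_iter c k t \<noteq> 0"
  shows "first_zero c k = z"
  unfolding first_zero_def
  by (rule cInf_eq_minimum) (use assms in \<open>auto simp: not_less[symmetric]\<close>)

lemma strict_antimono_on_leD:
  fixes f :: "real \<Rightarrow> real"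
  assumes "strict_antimono_on S f" "s \<in> S" "t \<in> S" "s \<le> t"
  shows "f t \<le> f s"
  using assms by (cases "s = t") (auto dest: monotone_onD)

text \<open>The decreasing branch is extended one power at a time: \<open>abs_iter c (b * P)\<close>
  falls from above \<open>z\<close> to 0 on \<open>{0..u}\<close>, and the point where it equals
  \<open>z\<close> becomes the next \<open>u\<close>; up to there the rising half on
  \<open>{z..e}\<close> keeps the composition decreasing. The last clause makes \<open>u\<close>
  maximal: beyond it some intermediate image has dropped below \<open>z\<close>, which later
  controls points past a turning point.\<close>

lemma zero_of_power:
  fixes c z e :: real
  assumes z: "0 < z" "abs_iter c P z = 0" "strict_antimono_on {0..z} (abs_iter c P)"
    and inc: "strict_mono_on {z..e} (abs_iter c P)"
    and v: "\<And>k. 1 \<le> k \<Longrightarrow> k < b \<Longrightarrow> z < abs_iter c (k * P) 0 \<and> abs_iter c (k * P) 0 \<le> e"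
    and b: "1 \<le> b"
  shows "\<exists>u. 0 < u \<and> u \<le> z \<and> strict_antimono_on {0..u} (abs_iter c (b * P)) \<and>
    abs_iter c (b * P) u = 0 \<and>
    (\<forall>t\<in>{0..u}. \<forall>k. 1 \<le> k \<and> k < b \<longrightarrow>
       z \<le> abs_iter c (k * P) t \<and> abs_iter c (k * P) t \<le> abs_iter c (k * P) 0) \<and>
    (\<forall>t\<in>{0..z}. (\<forall>k. 1 \<le> k \<and> k < b \<longrightarrow> z \<le> abs_iter c (k * P) t) \<longrightarrow> t \<le> u)"
  using b v
proof (induction b rule: dec_induct)
  case base
  then show ?case using z by (intro exI[of _ z]) auto
next
  case (step b)
  let ?A = "\<lambda>k. abs_iter c (k * P)"
  have "\<And>k. 1 \<le> k \<Longrightarrow> k < b \<Longrightarrow> z < ?A k 0 \<and> ?A k 0 \<le> e"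
    using step.prems by simp
  from step.IH[OF this] obtain u where u: "0 < u" "u \<le> z" "strict_antimono_on {0..u} (?A b)" "?A b u = 0"
    "\<And>t k. t \<in> {0..u} \<Longrightarrow> 1 \<le> k \<Longrightarrow> k < b \<Longrightarrow> z \<le> ?A k t \<and> ?A k t \<le> ?A k 0"
    "\<And>t. t \<in> {0..z} \<Longrightarrow> (\<And>k. 1 \<le> k \<Longrightarrow> k < b \<Longrightarrow> z \<le> ?A k t) \<Longrightarrow> t \<le> u"
    by blast
  have vb: "z < ?A b 0" "?A b 0 \<le> e"
    using step.prems[of b] step.hyps by auto
  have "\<exists>x\<ge>0. x \<le> u \<and> ?A b x = z"
    using IVT2'[of "?A b" u z 0, OF _ _ _ continuous_abs_iter] u(1,4) vb(1) z(1) by simp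
  then obtain x where x: "0 \<le> x" "x \<le> u" "?A b x = z" by blast
  have "x \<noteq> 0" using x(3) vb(1) by auto
  have ge: "z \<le> ?A b t \<and> ?A b t \<le> ?A b 0" if "t \<in> {0..x}" for t
    using strict_antimono_on_leD[OF u(3), of t x] strict_antimono_on_leD[OF u(3), of 0 t] x that
    by simp
  have Suc: "?A (Suc b) t = abs_iter c P (?A b t)" for t
    by (simp add: abs_iter_add)
  have "strict_antimono_on {0..x} (?A (Suc b))"
  proof (rule monotone_onI)
    fix s t assume st: "s \<in> {0..x}" "t \<in> {0..x}" "s < t"
    have "?A b t < ?A b s"
      using monotone_onD[OF u(3), of s t] st x by auto
    then show "?A (Suc b) s > ?A (Suc b) t"
      unfolding Suc using ge[OF st(1)] ge[OF st(2)] vb by (intro strict_mono_onD[OF inc]) auto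
  qed
  moreover have "?A (Suc b) x = 0"
    unfolding Suc using x z by simp
  moreover have "t \<le> x" if t: "t \<in> {0..z}" "\<forall>k. 1 \<le> k \<and> k < Suc b \<longrightarrow> z \<le> ?A k t" for t
  proof -
    have "t \<le> u" using u(6)[OF t(1)] t(2) by simp
    moreover have "z \<le> ?A b t" using t step.hyps by auto
    ultimately show ?thesis
      using monotone_onD[OF u(3), of x t] x t by force
  qed
  moreover have "\<forall>t\<in>{0..x}. \<forall>k. 1 \<le> k \<and> k < Suc b \<longrightarrow> z \<le> ?A k t \<and> ?A k t \<le> ?A k 0"
  proof (intro ballI allI impI)
    fix t k assume "t \<in> {0..x}" "1 \<le> k \<and> k < Suc b"
    then show "z \<le> ?A k t \<and> ?A k t \<le> ?A k 0"
      using ge[of t] u(5)[of t k] x(2) by (cases "k = b") auto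
  qed
  ultimately show ?case
    using x u(2) \<open>x \<noteq> 0\<close> by (intro exI[of _ x] conjI) simp_all
qed

section \<open>Monotone branches at closest returns\<close>

text \<open>
  \<open>R n i\<close> stands for \<open>[a\<^sub>1, \<dots>, a\<^sub>n]\<close>-recurrence of the point \<open>f\<^bsup>i\<^esup>(0)\<close>. It holds vacuously for
  \<open>n = 0\<close>, hence the last premise of \<open>R_gt\<close>. As \<open>f\<close> is even, only absolute values matter.
\<close>

locale rotation_recurrence =
  fixes c \<beta> :: real and a q :: "nat \<Rightarrow> nat" and R :: "nat \<Rightarrow> nat \<Rightarrow> bool"
  assumes quad_\<beta>: "quad c \<beta> = \<beta>" and \<beta>_pos: "0 < \<beta>"
    and orbit_le: "abs_iter c k 0 \<le> \<beta>"
    and a_pos: "1 \<le> n \<Longrightarrow> 1 \<le> a n"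
    and a_init: "a 1 = 1" "a 2 = 1" "a 3 = 1"
    and q_init: "q 0 = 1" "q 1 = 1"
    and q_rec: "q (n + 2) = a (n + 2) * q (n + 1) + q n"
    and R_zero: "1 \<le> n \<Longrightarrow> R n 0"
    and R_gt: "R n i \<Longrightarrow> 1 \<le> k \<Longrightarrow> k \<le> q n \<Longrightarrow> 1 \<le> n \<Longrightarrow> abs_iter c i 0 < abs_iter c (i + k) 0"
    and R_closest: "R n i \<Longrightarrow> 1 \<le> m \<Longrightarrow> m \<le> n \<Longrightarrow> 0 < k \<Longrightarrow> k < q m \<Longrightarrow>
      abs_iter c (i + q m) 0 < abs_iter c (i + k) 0"
    and R_between: "R n i \<Longrightarrow> 1 \<le> m \<Longrightarrow> m < n \<Longrightarrow> q m < k \<Longrightarrow> k < q (m + 1) \<Longrightarrow>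
      abs_iter c (i + q m) 0 \<le> abs_iter c (i + k) 0"
    and R_block: "R (Suc n) i \<Longrightarrow> m < a (Suc n) \<Longrightarrow> R n (i + m * q n)"
begin

abbreviation A :: "nat \<Rightarrow> real \<Rightarrow> real" where "A \<equiv> abs_iter c"
abbreviation y :: "nat \<Rightarrow> real" where "y k \<equiv> abs_iter c k 0"
abbreviation d :: "nat \<Rightarrow> real" where "d n \<equiv> abs_iter c (q n) 0"
text \<open>The point at which the blocks of length \<open>q (n - 1)\<close> are used up;
  \<open>q (n - 2)\<close> further steps lead from it to \<open>d n\<close>.\<close>

abbreviation w :: "nat \<Rightarrow> real" where "w n \<equiv> abs_iter c (a n * q (n - 1)) 0"
text \<open>
  \<open>e n\<close> is the turning point of \<open>f\<^bsup>q n\<^esup>\<close> closest to \<open>0\<close>; by \<open>q n = a n * q (n - 1) + q (n - 2)\<close> it is the first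
  point mapped to \<open>0\<close> by \<open>f\<^bsup>a n * q (n - 1)\<^esup>\<close>, and \<open>z n\<close> is the zero of \<open>f\<^bsup>q n\<^esup>\<close> before it.
\<close>

definition z :: "nat \<Rightarrow> real" where "z n = first_zero c (q n)"
definition e :: "nat \<Rightarrow> real" where "e n = first_zero c (a n * q (n - 1))"

section \<open>Denominators and the order of the critical orbit\<close>

lemma A_y: "A k (y i) = y (i + k)"
  using abs_iter_add[of c k i 0] by (simp add: add.commute)

lemma A_1: "A (Suc 0) t = \<bar>t\<^sup>2 + c\<bar>"
  by (simp add: abs_iter_def quad_def)

lemma q_2 [simp]: "q 2 = 2" and q_3 [simp]: "q 3 = 3"
proof -
  show 2: "q 2 = 2" using q_rec[of 0] q_init a_init by (simp add: numeral_2_eq_2)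
  have "q (1 + 2) = a (1 + 2) * q (1 + 1) + q 1" by (rule q_rec)
  then have "q 3 = a 3 * q 2 + q 1"
    by (simp add: numeral_3_eq_3 numeral_2_eq_2)
  then show "q 3 = 3" using 2 q_init a_init by simp
qed

lemma q_pos: "0 < q n"
proof (induction n rule: less_induct)
  case (less n)
  show ?case
  proof (cases "n < 2")
    case True
    then have "n = 0 \<or> n = 1" by auto
    then show ?thesis using q_init by auto
  next
    case False
    then obtain l where "n = l + 2" by (metis add.commute le_Suc_ex not_less)
    then show ?thesis using q_rec[of l] less[of l] by simp
  qed
qed

lemma q_less_Suc: "1 \<le> n \<Longrightarrow> q n < q (Suc n)"
proof -
  assume "1 \<le> n"
  then obtain l where l: "n = Suc l" by (cases n) auto
  have "q (l + 1) \<le> a (l + 2) * q (l + 1)" using a_pos[of "l + 2"] by simp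
  then have "q (l + 1) < q (l + 2)" using q_rec[of l] q_pos[of l] by linarith
  then show ?thesis using l by simp
qed

lemma q_less: "1 \<le> m \<Longrightarrow> m < n \<Longrightarrow> q m < q n"
proof (induction n)
  case (Suc n)
  then show ?case using q_less_Suc[of n] by (cases "m = n") (auto intro: less_trans)
qed simp

lemma q_le_Suc: "q n \<le> q (Suc n)"
  using q_less_Suc[of n] q_init by (cases n) auto

lemma q_mono: "m \<le> n \<Longrightarrow> q m \<le> q n"
  using lift_Suc_mono_le[of q, OF q_le_Suc] by simp

lemma d_less: "1 \<le> m \<Longrightarrow> m < n \<Longrightarrow> d n < d m"
  using R_closest[of n 0 n "q m"] R_zero[of n] q_less[of m n] q_pos[of m] by simp

lemma d_le: "m \<le> n \<Longrightarrow> d n \<le> d m"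
proof (cases "m = n")
  case False
  assume "m \<le> n"
  with False have "m < n" by simp
  show ?thesis
  proof (cases "m = 0")
    case True
    show ?thesis
      using d_less[of 1 n] \<open>m < n\<close> True q_init by (cases "n = 1") auto
  next
    case False
    then show ?thesis using d_less[of m n] \<open>m < n\<close> by simp
  qed
qed simp

text \<open>As \<open>f\<close> is even, an absolute value determines all later ones. A coincidence
  would make the sequence eventually periodic, hence finite, against the strictly decreasing
  \<open>d n\<close>. The case \<open>j = 0\<close> keeps the orbit away from 0 and later makes
  inequalities at turning points strict.\<close>

lemma y_inj:
  assumes "i \<noteq> j"
  shows "y i \<noteq> y j"
proof -
  have *: False if ij: "i < j" "y i = y j" for i j
  proof -
    have per: "y (k + (j - i)) = y k" if "i \<le> k" for k
      using A_y[of "k - i" i] A_y[of "k - i" j] ij that by (simp add: add.commute)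
    have "y k \<in> y ` {..<j}" for k
    proof (induction k rule: less_induct)
      case (less k)
      show ?case
      proof (cases "k < j")
        case False
        then have "y k = y (k - (j - i))"
          using per[of "k - (j - i)"] ij by simp
        then show ?thesis
          using less[of "k - (j - i)"] False ij by auto
      qed auto
    qed
    then have "range (\<lambda>n. d (Suc n)) \<subseteq> y ` {..<j}" by blast
    moreover have "inj (\<lambda>n. d (Suc n))"
    proof (rule linorder_injI)
      fix m n :: nat assume "m < n"
      then show "d (Suc m) \<noteq> d (Suc n)" using d_less[of "Suc m" "Suc n"] by simp
    qed
    ultimately show False
      using range_inj_infinite finite_subset[OF _ finite_imageI[OF finite_lessThan]] by blast
  qed
  show ?thesis
    using *[of i j] *[of j i] assms by (metis linorder_neqE_nat)
qed

lemma y_pos: "0 < k \<Longrightarrow> 0 < y k"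
  using y_inj[of k 0] by (auto simp: abs_iter_def)

lemma R_second:
  assumes "R n i" "1 \<le> m" "m < n" "0 < k" "k < q (m + 1)" "k \<noteq> q m"
  shows "y (i + q m) < y (i + k)"
proof (cases "k < q m")
  case True
  then show ?thesis using R_closest[of n i m k] assms by simp
next
  case False
  then show ?thesis
    using R_between[of n i m k] y_inj[of "i + q m" "i + k"] assms by simp
qed

text \<open>Each \<open>i + k * q n\<close> with \<open>k < a (Suc n)\<close> is recurrent at level
  \<open>n\<close>, so the next \<open>q n\<close> steps move it away from 0: block starts drift
  outwards.\<close>

lemma block_mono:
  assumes "R (Suc n) i" "j \<le> k" "k \<le> a (Suc n)" "1 \<le> n"
  shows "y (i + j * q n) \<le> y (i + k * q n)"
  using assms(2,3)
proof (induction rule: dec_induct)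
  case (step k)
  have "y (i + k * q n) < y (i + k * q n + q n)"
    using R_gt[OF R_block[OF assms(1), of k], of "q n"] q_pos[of n] step assms(4) by simp
  then show ?case using step by (simp add: algebra_simps)
qed simp

lemma block_strict_mono:
  assumes "R (Suc n) i" "j < k" "k \<le> a (Suc n)" "1 \<le> n"
  shows "y (i + j * q n) < y (i + k * q n)"
proof -
  have "i + j * q n \<noteq> i + k * q n" using assms(2) q_pos[of n] by simp
  from y_inj[OF this] block_mono[of n i j k] assms show ?thesis by simp
qed

section \<open>The parameter and the turning point of the first iterate\<close>

lemma c_bounds: "-2 < c" "c < 0"
proof -
  have "y 2 < y 1"
    using d_less[of 1 2] q_init by simp
  then have "\<bar>c\<bar> * \<bar>c + 1\<bar> < \<bar>c\<bar>"
    by (simp add: abs_iter_def quad_def numeral_2_eq_2 abs_mult[symmetric] algebra_simps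
        power2_eq_square)
  then have "\<bar>c\<bar> * \<bar>c + 1\<bar> < \<bar>c\<bar> * 1" by simp
  then have "\<bar>c + 1\<bar> < 1" using mult_less_cancel_left_pos[of "\<bar>c\<bar>"] by (cases "c = 0") auto
  then show "-2 < c" "c < 0" by auto
qed

text \<open>With \<open>c = \<beta> - \<beta>\<^sup>2\<close> one has
  \<open>f(t) - t = (t - \<beta>) * (t + \<beta> - 1)\<close>, and \<open>1 < \<beta>\<close>
  because \<open>c\<close> is negative.\<close>

lemma A_1_less: "0 \<le> t \<Longrightarrow> t\<^sup>2 \<ge> -c \<Longrightarrow> t < \<beta> \<Longrightarrow> A (Suc 0) t < t"
proof -
  assume t: "0 \<le> t" "t\<^sup>2 \<ge> -c" "t < \<beta>"
  have "c = \<beta> - \<beta>\<^sup>2" using quad_\<beta> by (simp add: quad_def)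
  have "c < 0" by (rule c_bounds)
  have "1 < \<beta>"
  proof (rule ccontr)
    assume "\<not> 1 < \<beta>"
    then have "\<beta> * \<beta> \<le> \<beta> * 1" using \<beta>_pos by (intro mult_left_mono) auto
    then show False using \<open>c = _\<close> \<open>c < 0\<close> by (simp add: power2_eq_square)
  qed
  then have "(t - \<beta>) * (t + \<beta> - 1) < 0" using t by (intro mult_neg_pos) auto
  then have "t\<^sup>2 + c < t" using \<open>c = _\<close> by (simp add: algebra_simps power2_eq_square)
  then show "A (Suc 0) t < t" using t unfolding A_1 by auto
qed

lemma y_less_\<beta>: "y k < \<beta>"
proof (rule ccontr)
  assume "\<not> y k < \<beta>"
  then have "y k = \<beta>" using orbit_le[of k] by simp
  then have "y (k + 1) = y k"
    using A_y[of "Suc 0" k] quad_\<beta> \<beta>_pos unfolding A_1 by (simp add: quad_def)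
  then show False using y_inj[of "k + 1" k] by simp
qed

text \<open>Turns recurrence into position at the lowest level: only left of the zero
  \<open>sqrt (-c)\<close> of \<open>f\<close> can an absolute value on the orbit grow.\<close>

lemma growth_le_sqrt:
  assumes "y k < y (k + 1)"
  shows "y k \<le> sqrt (-c)"
proof (rule ccontr)
  assume "\<not> y k \<le> sqrt (-c)"
  then have "-c \<le> (y k)\<^sup>2"
    using c_bounds by (intro sqrt_le_D) auto
  then have "A (Suc 0) (y k) < y k"
    using A_1_less[of "y k"] y_less_\<beta>[of k] by simp
  then show False using assms A_y[of "Suc 0" k] by simp
qed

lemma A_1_dec: "strict_antimono_on {0..sqrt (-c)} (A (Suc 0))"
proof (rule monotone_onI)
  fix s t assume st: "s \<in> {0..sqrt (-c)}" "t \<in> {0..sqrt (-c)}" "s < t"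
  have "t\<^sup>2 \<le> -c" using st c_bounds by (metis atLeastAtMost_iff neg_0_le_iff_le nle_le order.strict_implies_order power_mono real_sqrt_pow2)
  moreover have "s\<^sup>2 < t\<^sup>2" using st by (intro power_strict_mono) auto
  ultimately show "A (Suc 0) t < A (Suc 0) s" unfolding A_1 by simp
qed

lemma A_1_inc: "strict_mono_on {sqrt (-c)..E} (A (Suc 0))"
proof (rule strict_mono_onI)
  fix s t assume st: "s \<in> {sqrt (-c)..E}" "t \<in> {sqrt (-c)..E}" "s < t"
  have s0: "0 \<le> s" using st c_bounds by (auto intro: order_trans[rotated])
  have "s\<^sup>2 \<ge> -c" using st by (auto dest: sqrt_le_D)
  moreover have "s\<^sup>2 < t\<^sup>2" using st s0 by (intro power_strict_mono) auto
  ultimately show "A (Suc 0) s < A (Suc 0) t" unfolding A_1 by simp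
qed

lemma A_1_zero: "A (Suc 0) (sqrt (-c)) = 0"
  using c_bounds unfolding A_1 by simp

section \<open>Shape of the branches and location of recurrent points\<close>

lemma z_1: "z 1 = sqrt (-c)" and z_0: "z 0 = sqrt (-c)"
proof -
  have "first_zero c (Suc 0) = sqrt (-c)"
  proof (rule first_zero_eq)
    fix t assume "0 \<le> t" "t < sqrt (-c)"
    then show "A (Suc 0) t \<noteq> 0"
      using monotone_onD[OF A_1_dec, of t "sqrt (-c)"] A_1_zero c_bounds by auto
  qed (use A_1_zero c_bounds in auto)
  then show "z 1 = sqrt (-c)" "z 0 = sqrt (-c)"
    using q_init by (simp_all add: z_def)
qed

text \<open>In absolute values, a monotone branch of \<open>f^(q n)\<close> crossing 0 appears as a
  fall to \<open>z n\<close> followed by a rise.\<close>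

definition valley :: "nat \<Rightarrow> bool" where
  "valley n \<longleftrightarrow> 0 < z n \<and> z n < e n \<and> A (q n) (z n) = 0 \<and>
     strict_antimono_on {0..z n} (A (q n)) \<and> strict_mono_on {z n..e n} (A (q n))"

text \<open>
  The first alternative below, in which \<open>f\<^bsup>q n\<^esup>\<close> has no zero on the branch, is ruled out only by
  information from level \<open>n + 2\<close> (see \<open>valley_of_branch\<close>), so it has to be carried through the induction.
\<close>

definition branch :: "nat \<Rightarrow> bool" where
  "branch n \<longleftrightarrow> 0 < e n \<and> e n \<le> z (n - 1) \<and> A (q n) (e n) = d (n - 2) \<and>
     strict_antimono_on {0..e n} (A (a n * q (n - 1))) \<and> A (a n * q (n - 1)) (e n) = 0 \<and>
     (\<forall>t\<in>{0..e n}. \<forall>k. 1 \<le> k \<and> k < a n \<longrightarrow>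
        z (n - 1) \<le> A (k * q (n - 1)) t \<and> A (k * q (n - 1)) t \<le> y (k * q (n - 1))) \<and>
     (w n \<le> z (n - 2) \<and> strict_mono_on {0..e n} (A (q n)) \<or> z (n - 2) < w n \<and> valley n)"

text \<open>Serves to expel points: a recurrent point between the turning point and
  \<open>z (n - 1)\<close> would have a next return that is not close enough.\<close>

definition high :: "nat \<Rightarrow> bool" where
  "high n \<longleftrightarrow> (\<forall>t\<in>{e n..z (n - 1)}. d (n - 1) \<le> A (q n) t)"

lemma A_q: "A (q (l + 2)) t = A (q l) (A (a (l + 2) * q (l + 1)) t)"
  using q_rec[of l] abs_iter_add[of c "q l" "a (l + 2) * q (l + 1)" t] by (simp add: add.commute)

lemma A_le_d: "strict_antimono_on {0..z n} (A (q n)) \<Longrightarrow> 0 \<le> s \<Longrightarrow> s \<le> z n \<Longrightarrow> A (q n) s \<le> d n"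
  using strict_antimono_on_leD[of "{0..z n}" "A (q n)" 0 s] by simp

lemma block_pos_mono:
  assumes "1 \<le> n" "j \<le> k" "k \<le> a (n + 1)"
  shows "y (j * q n) \<le> y (k * q n)"
  using block_mono[of n 0 j k] R_zero[of "Suc n"] assms by simp

text \<open>A point below a block start stays below the following ones although
  \<open>A (q n)\<close> is not monotone: left of \<open>z n\<close> the image is at most
  \<open>d n\<close>, which no later block start undercuts; to the right the rising half
  applies.\<close>

lemma chain_le:
  assumes "1 \<le> n" "strict_antimono_on {0..z n} (A (q n))" "strict_mono_on {z n..e n} (A (q n))"
    and v: "\<And>k. 1 \<le> k \<Longrightarrow> k < a (n + 1) \<Longrightarrow> y (k * q n) \<le> e n"
    and s: "0 \<le> s" "s \<le> y (j * q n)" "1 \<le> j" "j + i \<le> a (n + 1)"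
  shows "A (i * q n) s \<le> y ((j + i) * q n)"
  using s(4)
proof (induction i)
  case 0
  then show ?case using s by simp
next
  case (Suc i)
  let ?s = "A (i * q n) s"
  have IH: "?s \<le> y ((j + i) * q n)" using Suc by simp
  have step: "A (Suc i * q n) s = A (q n) ?s" by (simp add: abs_iter_add)
  show ?case
  proof (cases "?s \<le> z n")
    case True
    then have "A (q n) ?s \<le> d n" using A_le_d[OF assms(2), of ?s] by simp
    also have "d n \<le> y ((j + Suc i) * q n)"
      using block_pos_mono[of n 1 "j + Suc i"] assms(1) Suc.prems s(3) by simp
    finally show ?thesis using step by simp
  next
    case False
    have "y ((j + i) * q n) \<le> e n" using v[of "j + i"] Suc.prems s(3) by simp
    then have "A (q n) ?s \<le> A (q n) (y ((j + i) * q n))"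
      using False IH by (intro strict_mono_on_leD[OF assms(3)]) auto
    then show ?thesis using step by (simp add: A_y algebra_simps)
  qed
qed

text \<open>The start of the last block is recurrent at level \<open>l + 1\<close>, so its return
  after \<open>q (l + 1)\<close> steps is closer than that after \<open>q l\<close> steps; the
  former is at least \<open>d (l + 1)\<close> since block starts drift outwards.\<close>

lemma A_last_block:
  assumes "1 \<le> l"
  shows "d (l + 1) < A (q l) (y ((a (l + 2) - 1) * q (l + 1)))"
proof -
  let ?b = "a (l + 2)" and ?Q = "q (l + 1)"
  have b1: "1 \<le> ?b" using a_pos by simp
  have "R (l + 1) (0 + (?b - 1) * ?Q)"
    using R_block[of "l + 1" 0 "?b - 1"] R_zero b1 by simp
  then have "y ((?b - 1) * ?Q + ?Q) < y ((?b - 1) * ?Q + q l)"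
    using R_closest[of "l + 1" _ "l + 1" "q l"] q_less_Suc[OF assms] q_pos[of l] by simp
  moreover have "(?b - 1) * ?Q + ?Q = ?b * ?Q" using b1 by (cases ?b) simp_all
  moreover have "d (l + 1) \<le> y (?b * ?Q)"
    using block_pos_mono[of "l + 1" 1 ?b] b1 by simp
  ultimately show ?thesis by (simp add: A_y)
qed

text \<open>The new map is the fall from \<open>w (l + 2)\<close> to 0 along the blocks, followed by
  \<open>A (q l)\<close>. If \<open>w (l + 2)\<close> is at most \<open>z l\<close>, only the
  falling half of \<open>A (q l)\<close> is met and the composition increases; otherwise the rising
  half is met before it and a valley results. Past the turning point the point lags at least one
  block behind the critical orbit, and \<open>A_last_block\<close> bounds its return from
  below.\<close>

lemma branch_step:
  assumes z1: "0 < z (l + 1)" "strict_antimono_on {0..z (l + 1)} (A (q (l + 1)))"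
      "A (q (l + 1)) (z (l + 1)) = 0"
    and inc1: "2 \<le> a (l + 2) \<Longrightarrow> strict_mono_on {z (l + 1)..e (l + 1)} (A (q (l + 1)))"
    and ez: "2 \<le> a (l + 2) \<Longrightarrow> e (l + 1) \<le> z l"
    and v: "\<And>k. 1 \<le> k \<Longrightarrow> k < a (l + 2) \<Longrightarrow> y (k * q (l + 1)) \<le> e (l + 1)"
    and z0: "0 < z l" "strict_antimono_on {0..z l} (A (q l))" "A (q l) (z l) = 0"
    and inc0: "strict_mono_on {z l..E} (A (q l))" and wE: "w (l + 2) \<le> E"
  shows "branch (l + 2)" "high (l + 2)"
proof -
  let ?z = "z (l + 1)" and ?Q = "q (l + 1)" and ?b = "a (l + 2)"
  let ?v = "\<lambda>k. y (k * ?Q)"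
  have b1: "1 \<le> ?b" using a_pos by simp
  have w: "w (l + 2) = ?v ?b" by simp
  \<comment> \<open>For a single block no rising half is at hand; the one-point interval at
    \<open>z (l + 1)\<close> takes its place.\<close>
  define e' where "e' = (if ?b = 1 then ?z else e (l + 1))"
  \<comment> \<open>Otherwise a second block would start on the falling half and end at most at
    \<open>d (l + 1)\<close>, whereas block starts drift outwards.\<close>
  have d_gt: "?z < d (l + 1)" if "2 \<le> ?b"
  proof (rule ccontr)
    assume "\<not> ?z < d (l + 1)"
    then have "A ?Q (d (l + 1)) \<le> d (l + 1)" using A_le_d[OF z1(2)] by simp
    moreover have "d (l + 1) < y (2 * ?Q)"
      using block_strict_mono[of "l + 1" 0 1 2] R_zero that by simp
    ultimately show False using A_y[of ?Q ?Q] by (simp add: mult_2)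
  qed
  have v_gt: "?z < ?v k \<and> ?v k \<le> e'" if "1 \<le> k" "k < ?b" for k
    using d_gt v[OF that] that block_pos_mono[of "l + 1" 1 k] by (simp add: e'_def)
  have inc': "strict_mono_on {?z..e'} (A ?Q)"
    using inc1 b1 by (auto simp: e'_def intro!: strict_mono_onI)
  obtain u where u: "0 < u" "u \<le> ?z" "strict_antimono_on {0..u} (A (?b * ?Q))" "A (?b * ?Q) u = 0"
      "\<forall>t\<in>{0..u}. \<forall>k. 1 \<le> k \<and> k < ?b \<longrightarrow> ?z \<le> A (k * ?Q) t \<and> A (k * ?Q) t \<le> ?v k"
      "\<forall>t\<in>{0..?z}. (\<forall>k. 1 \<le> k \<and> k < ?b \<longrightarrow> ?z \<le> A (k * ?Q) t) \<longrightarrow> t \<le> u"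
    using zero_of_power[OF z1(1,3,2) inc' v_gt b1] by blast
  let ?G = "A (?b * ?Q)"
  have G_pos: "0 < ?G t" if "0 \<le> t" "t < u" for t
    using monotone_onD[OF u(3), of t u] u(4) that by simp
  have G_le: "?G t \<le> w (l + 2)" if "0 \<le> t" "t \<le> u" for t
    using strict_antimono_on_leD[OF u(3), of 0 t] that by simp
  have eu: "e (l + 2) = u"
    unfolding e_def using G_pos u(1,4) by (intro first_zero_eq) fastforce+
  have Au: "A (q (l + 2)) u = d l"
    using A_q[of l u] u(4) by simp
  have main: "w (l + 2) \<le> z l \<and> strict_mono_on {0..u} (A (q (l + 2))) \<or> z l < w (l + 2) \<and> valley (l + 2)"
  proof (cases "w (l + 2) \<le> z l")
    case True
    have "strict_mono_on {0..u} (A (q (l + 2)))"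
    proof (rule strict_mono_onI)
      fix s t assume st: "s \<in> {0..u}" "t \<in> {0..u}" "s < t"
      have "?G t < ?G s" using monotone_onD[OF u(3)] st by blast
      then show "A (q (l + 2)) s < A (q (l + 2)) t"
        unfolding A_q using G_le[of s] True st
        by (intro monotone_onD[OF z0(2)]) auto
    qed
    then show ?thesis using True by simp
  next
    case False
    have "\<exists>x\<ge>0. x \<le> u \<and> ?G x = z l"
      using IVT2'[of ?G u "z l" 0, OF _ _ _ continuous_abs_iter] u(1,4) z0(1) False by simp
    then obtain x where x: "0 \<le> x" "x \<le> u" "?G x = z l" by blast
    have x0: "x \<noteq> 0" "x \<noteq> u" using x(3) False u(4) z0(1) by auto
    have left: "z l < ?G t" if "0 \<le> t" "t < x" for t
      using monotone_onD[OF u(3), of t x] x that by simp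
    have right: "?G t \<le> z l" if "x \<le> t" "t \<le> u" for t
      using strict_antimono_on_leD[OF u(3), of x t] x that by simp
    have "A (q (l + 2)) t \<noteq> 0" if t: "0 \<le> t" "t < x" for t
      using strict_mono_onD[OF inc0, of "z l" "?G t"] left[OF t] G_le[of t] t x wE z0(3)
      unfolding A_q by simp
    then have zx: "z (l + 2) = x"
      unfolding z_def using x z0(3) A_q[of l x] by (intro first_zero_eq) auto
    have "strict_antimono_on {0..x} (A (q (l + 2)))"
    proof (rule monotone_onI)
      fix s t assume st: "s \<in> {0..x}" "t \<in> {0..x}" "s < t"
      have "?G t < ?G s" using monotone_onD[OF u(3), of s t] st x(2) by simp
      moreover have "z l \<le> ?G t" using left[of t] st x(3) by (cases "t = x") auto
      ultimately show "A (q (l + 2)) t < A (q (l + 2)) s"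
        unfolding A_q using G_le[of s] st x(2) wE
        by (intro strict_mono_onD[OF inc0]) auto
    qed
    moreover have "strict_mono_on {x..u} (A (q (l + 2)))"
    proof (rule strict_mono_onI)
      fix s t assume st: "s \<in> {x..u}" "t \<in> {x..u}" "s < t"
      have "?G t < ?G s" using monotone_onD[OF u(3), of s t] st x(1) by simp
      then show "A (q (l + 2)) s < A (q (l + 2)) t"
        unfolding A_q using right[of s] st
        by (intro monotone_onD[OF z0(2)]) auto
    qed
    ultimately have "valley (l + 2)"
      unfolding valley_def zx eu using x x0 z0(3) A_q[of l x] by simp
    then show ?thesis using False by simp
  qed
  show "branch (l + 2)"
    unfolding branch_def eu using u(1-5) Au main by simp
  show "high (l + 2)"
    unfolding high_def eu
  proof
    fix t assume t: "t \<in> {u..z (l + 2 - 1)}"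
    show "d (l + 2 - 1) \<le> A (q (l + 2)) t"
    proof (cases "t = u")
      case True
      then show ?thesis using Au d_le[of l "l + 1"] by simp
    next
      case False
      have "\<not> (\<forall>k. 1 \<le> k \<and> k < ?b \<longrightarrow> ?z \<le> A (k * ?Q) t)"
      proof
        assume "\<forall>k. 1 \<le> k \<and> k < ?b \<longrightarrow> ?z \<le> A (k * ?Q) t"
        moreover have "t \<in> {0..?z}" using t u(1) by simp
        ultimately have "t \<le> u" using u(6) by blast
        then show False using False t by simp
      qed
      then obtain k where k: "1 \<le> k" "k < ?b" "A (k * ?Q) t < ?z"
        by (auto simp: not_le)
      then have b2: "2 \<le> ?b" by simp
      have l1: "1 \<le> l"
        using b2 a_init(2) by (cases l) (simp_all add: numeral_2_eq_2)
      \<comment> \<open>The drop below \<open>z (l + 1)\<close> resets the point to at most the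
        first block start; as \<open>k\<close> is at least 1, it ends no further out than block
        start \<open>a (l + 2) - 1\<close>.\<close>
      have "A (Suc k * ?Q) t = A ?Q (A (k * ?Q) t)" by (simp add: abs_iter_add)
      also have "\<dots> \<le> d (l + 1)" using A_le_d[OF z1(2)] k(3) by simp
      finally have "A ((?b - Suc k) * ?Q) (A (Suc k * ?Q) t) \<le> y ((1 + (?b - Suc k)) * ?Q)"
        using inc1 b2 v k(2)
        by (intro chain_le z1(2)) (simp_all add: numeral_2_eq_2)
      moreover have "?G t = A ((?b - Suc k) * ?Q) (A (Suc k * ?Q) t)"
      proof -
        have "?b * ?Q = (?b - Suc k) * ?Q + Suc k * ?Q"
          using k(2) by (simp only: add_mult_distrib[symmetric]) simp
        then show ?thesis by (simp only: abs_iter_add)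
      qed
      ultimately have "?G t \<le> y ((1 + (?b - Suc k)) * ?Q)" by simp
      also have "\<dots> \<le> ?v (?b - 1)"
        using block_pos_mono[of "l + 1" "1 + (?b - Suc k)" "?b - 1"] k by simp
      finally have G: "?G t \<le> ?v (?b - 1)" .
      have "1 \<le> ?b - 1" "?b - 1 < ?b" using b2 by simp_all
      from v[OF this] ez[OF b2] have "?v (?b - 1) \<le> z l" by simp
      then have "A (q l) (?v (?b - 1)) \<le> A (q (l + 2)) t"
        unfolding A_q using G
        by (intro strict_antimono_on_leD[OF z0(2)]) auto
      then show ?thesis
        using A_last_block[OF l1] by simp
    qed
  qed
qed

lemma branch_step_one:
  assumes a1: "a (l + 2) = 1"
    and z1: "0 < z (l + 1)" "strict_antimono_on {0..z (l + 1)} (A (q (l + 1)))"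
      "A (q (l + 1)) (z (l + 1)) = 0"
    and z0: "0 < z l" "strict_antimono_on {0..z l} (A (q l))" "A (q l) (z l) = 0"
    and inc0: "strict_mono_on {z l..w (l + 2)} (A (q l))"
  shows "branch (l + 2)" "high (l + 2)"
proof -
  have n2: "\<not> 2 \<le> a (l + 2)" and nk: "\<not> (1 \<le> k \<and> k < a (l + 2))" for k
    using a1 by simp_all
  show "branch (l + 2)" "high (l + 2)"
    by (rule branch_step[OF z1 _ _ _ z0 inc0 order_refl]; use n2 nk in blast)+
qed

text \<open>
  The orbit of a recurrent point, cut into blocks of lengths \<open>q (n - 1), \<dots>, q (n - 1), q (n - 2)\<close>, starts
  every block inside the monotone branch belonging to the length of the block.
\<close>

definition settled :: "nat \<Rightarrow> bool" where
  "settled n \<longleftrightarrow> (\<forall>i. R n i \<longrightarrow>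
     (\<forall>k<a n. y (i + k * q (n - 1)) \<le> e (n - 1)) \<and> y (i + a n * q (n - 1)) \<le> e (n - 2))"

text \<open>The return at time \<open>q (l + 4)\<close> must be closer than
  \<open>y (i + q (l + 3))\<close>, itself below \<open>d (l + 1)\<close>; a point \<open>Y\<close>
  beyond \<open>e (l + 2)\<close> is sent too far out for this. Up to \<open>z (l + 1)\<close> this
  is \<open>high\<close>. Past it, \<open>Y\<close> lies on the rising half of
  \<open>A (q (l + 1))\<close> and moves inwards, which contradicts the order of the returns if
  \<open>a (l + 2) = 1\<close> and makes it lag behind the critical orbit otherwise.\<close>

lemma settled_last:
  assumes l: "1 \<le> l" and R4: "R (l + 4) i" and S: "settled (l + 3)"
    and v: "\<And>k. 1 \<le> k \<Longrightarrow> k < a (l + 2) \<Longrightarrow> y (k * q (l + 1)) \<le> e (l + 1)"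
    and e2: "e (l + 2) \<le> z (l + 1)" and e1: "e (l + 1) \<le> z l"
    and dec: "strict_antimono_on {0..z l} (A (q l))"
    and V: "valley (l + 1)" and H: "high (l + 2)"
  shows "y (i + a (l + 4) * q (l + 3)) \<le> e (l + 2)"
proof (rule ccontr)
  let ?A1 = "A (q (l + 1))" and ?A2 = "A (q (l + 2))" and ?c = "a (l + 2)"
  define Y where "Y = y (i + a (l + 4) * q (l + 3))"
  define i' where "i' = i + (a (l + 4) - 1) * q (l + 3)"
  assume "\<not> y (i + a (l + 4) * q (l + 3)) \<le> e (l + 2)"
  then have Y: "e (l + 2) < Y" by (simp add: Y_def)
  have q4: "q (l + 4) = a (l + 4) * q (l + 3) + q (l + 2)"
    using q_rec[of "l + 2"] by (simp add: eval_nat_numeral)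
  have q3: "q (l + 3) = a (l + 3) * q (l + 2) + q (l + 1)"
    using q_rec[of "l + 1"] by (simp add: eval_nat_numeral)
  have less: "q (l + 2) < q (l + 3)" "q (l + 1) < q (l + 3)" "q (l + 3) < q (l + 4)"
      "q l < q (l + 2)"
    by (rule q_less; use l in simp)+
  have dec1: "strict_antimono_on {0..z (l + 1)} ?A1" and inc1: "strict_mono_on {z (l + 1)..e (l + 1)} ?A1"
    using V by (auto simp: valley_def)
  have a4: "1 \<le> a (l + 4)" by (rule a_pos) simp
  have iY: "i' + q (l + 3) = i + a (l + 4) * q (l + 3)"
    unfolding i'_def using a4 by (cases "a (l + 4)") auto
  have R_i: "R (l + 3) i" and R_i': "R (l + 3) i'"
    using R_block[of "l + 3" i 0] R_block[of "l + 3" i "a (l + 4) - 1"] R4 a4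
    by (simp_all add: i'_def eval_nat_numeral)
  have Y_less: "Y < y (i' + q k)" if "k < l + 3" for k
    using R_closest[OF R_i', of "l + 3" "q k"] q_pos[of k] less q_mono[of k "l + 2"] that
    unfolding Y_def iY[symmetric] by simp
  have S_i': "k < a (l + 3) \<Longrightarrow> y (i' + k * q (l + 2)) \<le> e (l + 2)"
    "y (i' + a (l + 3) * q (l + 2)) \<le> e (l + 1)" for k
    using S R_i' unfolding settled_def by simp_all
  have S_i: "y i \<le> e (l + 2)"
  proof -
    have "0 < a (l + 3)" using a_pos[of "l + 3"] by simp
    then show ?thesis using S R_i unfolding settled_def by fastforce
  qed
  \<comment> \<open>A second block would start inside \<open>{0..e (l + 2)}\<close>, hence closer to
    0 than \<open>Y\<close>, yet \<open>Y\<close> is the closest return of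
    \<open>i'\<close>.\<close>
  have a3: "a (l + 3) = 1"
  proof (rule ccontr)
    assume "a (l + 3) \<noteq> 1"
    then have "1 < a (l + 3)" using a_pos[of "l + 3"] by simp
    then show False using S_i'(1)[of 1] Y_less[of "l + 2"] Y by simp
  qed
  \<comment> \<open>The point of the orbit that precedes \<open>Y\<close> by
    \<open>q (l + 1)\<close> steps. It lies further out on the rising half, so the image of
    \<open>Y\<close> is below \<open>Y\<close>.\<close>
  define \<rho> where "\<rho> = y (i' + q (l + 2))"
  have \<rho>: "Y < \<rho>" "\<rho> \<le> e (l + 1)"
    using Y_less[of "l + 2"] S_i'(2) a3 by (simp_all add: \<rho>_def)
  have A\<rho>: "?A1 \<rho> = Y"
    unfolding \<rho>_def Y_def iY[symmetric] using q3 a3 by (simp add: A_y add.assoc)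
  have t1: "y (i + q (l + 3)) < d (l + 1)"
  proof -
    have "y (i + q (l + 3)) < y (i + q (l + 1))"
      using R_closest[OF R_i, of "l + 3" "q (l + 1)"] less q_pos by simp
    also have "\<dots> = ?A1 (y i)" by (simp add: A_y)
    also have "\<dots> \<le> d (l + 1)" using A_le_d[OF dec1, of "y i"] S_i e2 by simp
    finally show ?thesis .
  qed
  have AY: "?A2 Y < y (i + q (l + 3))"
    using R_closest[OF R4, of "l + 4" "q (l + 3)"] less q_pos
    unfolding Y_def A_y q4 by (simp add: add.assoc)
  have zY: "z (l + 1) \<le> Y"
  proof (rule ccontr)
    assume "\<not> z (l + 1) \<le> Y"
    then have "Y \<in> {e (l + 2)..z (l + 2 - 1)}" using Y by simp
    then have "d (l + 1) \<le> ?A2 Y" using H unfolding high_def by fastforce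
    then show False using AY t1 by simp
  qed
  define \<theta> where "\<theta> = ?A1 Y"
  have \<theta>: "\<theta> < Y"
    unfolding \<theta>_def using strict_mono_onD[OF inc1, of Y \<rho>] zY \<rho> A\<rho> by simp
  have A2: "?A2 Y = A (q l) (A (?c * q (l + 1)) Y)" by (rule A_q)
  show False
  proof (cases "?c = 1")
    case True
    have "A (q l) Y \<le> A (q l) \<theta>"
      using \<theta> \<rho> e1 by (intro strict_antimono_on_leD[OF dec]) (simp_all add: \<theta>_def Y_def)
    moreover have "y (i + q (l + 3)) \<le> y (i + (a (l + 4) * q (l + 3) + q l))"
    proof (rule R_between[OF R4])
      have "q (l + 3) \<le> a (l + 4) * q (l + 3)" using a4 by simp
      then show "q (l + 3) < a (l + 4) * q (l + 3) + q l" using q_pos[of l] by linarith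
      show "a (l + 4) * q (l + 3) + q l < q (l + 3 + 1)"
        using less q4 by (simp add: eval_nat_numeral)
    qed simp_all
    then have "y (i + q (l + 3)) \<le> A (q l) Y" by (simp add: Y_def A_y add.assoc)
    ultimately show False using AY A2 True by (simp add: \<theta>_def)
  next
    case False
    then have c2: "2 \<le> ?c" using a_pos[of "l + 2"] by simp
    have "Y < ?A1 (y i')" using Y_less[of "l + 1"] by (simp add: A_y)
    also have "\<dots> \<le> d (l + 1)"
      using A_le_d[OF dec1, of "y i'"] S_i'(1)[of 0] e2 a3 by simp
    finally have Yd: "Y < d (l + 1)" .
    have "?A1 \<theta> \<le> d (l + 1)"
    proof (cases "\<theta> \<le> z (l + 1)")
      case True
      then show ?thesis using A_le_d[OF dec1, of \<theta>] by (simp add: \<theta>_def)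
    next
      case False
      then have "?A1 \<theta> \<le> ?A1 Y"
        using \<theta> \<rho> by (intro strict_mono_on_leD[OF inc1]) auto
      then show ?thesis using \<theta> Yd by (simp add: \<theta>_def)
    qed
    then have "A ((?c - 2) * q (l + 1)) (?A1 \<theta>) \<le> y ((1 + (?c - 2)) * q (l + 1))"
      using v c2 by (intro chain_le dec1 inc1) (simp_all add: numeral_2_eq_2)
    moreover have "A (?c * q (l + 1)) Y = A ((?c - 2) * q (l + 1)) (?A1 \<theta>)"
    proof -
      have "?c * q (l + 1) = (?c - 2) * q (l + 1) + (q (l + 1) + q (l + 1))"
        using c2 by (metis add_mult_distrib le_add_diff_inverse2 mult_2)
      then show ?thesis by (simp only: abs_iter_add \<theta>_def)
    qed
    moreover have "1 + (?c - 2) = ?c - 1" using c2 by simp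
    ultimately have "A (?c * q (l + 1)) Y \<le> y ((?c - 1) * q (l + 1))" by metis
    moreover have "y ((?c - 1) * q (l + 1)) \<le> z l"
    proof -
      have "1 \<le> ?c - 1" "?c - 1 < ?c" using c2 by simp_all
      from v[OF this] e1 show ?thesis by simp
    qed
    ultimately have "A (q l) (y ((?c - 1) * q (l + 1))) \<le> ?A2 Y"
      unfolding A2 by (intro strict_antimono_on_leD[OF dec]) simp_all
    then show False using A_last_block[OF l] AY t1 by simp
  qed
qed

text \<open>A point past \<open>e (l + 1)\<close> fails on either side of \<open>z l\<close>. To the
  right, the rising half of \<open>A (q l)\<close> would carry it no further than the return at
  \<open>q (l + 2)\<close>, which is closer than every later block start. To the left,
  \<open>high\<close> makes its return after \<open>q (l + 1)\<close> steps no closer than that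
  after \<open>q l\<close> steps.\<close>

lemma settled_init:
  assumes l: "1 \<le> l" and R2: "R (l + 2) i"
    and le: "\<And>k. k < a (l + 2) \<Longrightarrow> y (i + k * q (l + 1)) \<le> e l"
    and last: "y (i + a (l + 2) * q (l + 1)) \<le> e l"
    and V: "valley l" and H: "high (l + 1)" and k: "k < a (l + 2)"
  shows "y (i + k * q (l + 1)) \<le> e (l + 1)"
proof (rule ccontr)
  let ?t = "\<lambda>k. y (i + k * q (l + 1))"
  assume k_gt: "\<not> ?t k \<le> e (l + 1)"
  have dec: "strict_antimono_on {0..z l} (A (q l))" and inc: "strict_mono_on {z l..e l} (A (q l))"
    using V by (auto simp: valley_def)
  have R1: "R (l + 1) (i + k * q (l + 1))"
    using R_block[of "l + 1" i k] R2 k by simp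
  have Suc_t: "?t (Suc k) < A (q l) (?t k)"
    using R_closest[OF R1, of "l + 1" "q l"] q_less_Suc[OF l] q_pos[of l]
    by (simp add: A_y algebra_simps)
  have "?t k < z l"
  proof (rule ccontr)
    assume "\<not> ?t k < z l"
    then have "A (q l) (?t k) \<le> A (q l) (?t (a (l + 2)))"
      using block_mono[of "l + 1" i k "a (l + 2)"] R2 k last
      by (intro strict_mono_on_leD[OF inc]) auto
    also have "\<dots> = y (i + q (l + 2))"
      using q_rec[of l] by (simp add: A_y add.assoc)
    also have "\<dots> < ?t 1"
      using R_closest[OF R2, of "l + 2" "q (l + 1)"] q_less[of "l + 1" "l + 2"] q_pos[of "l + 1"] by simp
    also have "\<dots> \<le> ?t (Suc k)"
      using block_mono[of "l + 1" i 1 "Suc k"] R2 k by simp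
    finally show False using Suc_t by simp
  qed
  then have "d l \<le> A (q (l + 1)) (?t k)" "A (q l) (?t k) \<le> d l"
    using H k_gt A_le_d[OF dec, of "?t k"] unfolding high_def by auto
  then show False using Suc_t by (simp add: A_y algebra_simps)
qed

text \<open>The look-ahead: \<open>w (l + 2)\<close> lies on the branch and is sent to
  \<open>d (l + 2)\<close>, closer to 0 than the image \<open>d l\<close> of 0, so the branch cannot
  be increasing.\<close>

lemma valley_of_branch:
  assumes "1 \<le> l" "branch l" "w (l + 2) \<le> e l"
  shows "valley l" "z (l - 2) < w l"
proof -
  have "A (q l) (w (l + 2)) = d (l + 2)"
    using q_rec[of l] by (simp add: A_y)
  then have "A (q l) (w (l + 2)) < A (q l) 0"
    using d_less[of l "l + 2"] assms(1) by simp
  then have "\<not> strict_mono_on {0..e l} (A (q l))"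
    using strict_mono_on_leD[of "{0..e l}" "A (q l)" 0 "w (l + 2)"] assms(3) by auto
  then show "valley l" "z (l - 2) < w l"
    using assms(2) unfolding branch_def by auto
qed

lemma e_2: "e 2 = sqrt (-c)"
  using z_1 a_init(2) q_init by (simp add: e_def z_def)

lemma y_3_less: "y 3 < sqrt (-c)"
proof -
  have a4: "1 \<le> a 4" by (rule a_pos) simp
  have "q (2 + 2) = a (2 + 2) * q (2 + 1) + q 2" by (rule q_rec)
  then have "q 4 = a 4 * 3 + 2" by simp
  moreover have "R 4 0" by (rule R_zero) simp
  ultimately have "y 3 < y 4"
    using R_second[of 4 0 3 4] a4 by simp
  then have "y 3 \<le> sqrt (-c)"
    using growth_le_sqrt[of 3] by simp
  moreover have "A 1 (y 3) \<noteq> 0" using y_pos[of 4] A_y[of 1 3] by simp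
  then have "y 3 \<noteq> sqrt (-c)" using A_1_zero by auto
  ultimately show ?thesis by simp
qed

text \<open>Base case by comparison with the critical orbit. Otherwise the three absolute values
  after \<open>i'\<close> all lie right of \<open>sqrt (-c)\<close>, where
  \<open>\<bar>f\<bar>\<close> increases; from \<open>y (i' + 1) \<le> y 1\<close> follows
  \<open>y (i' + 3) \<le> y 3\<close>, which lies to the left.\<close>

lemma settled_last_4:
  assumes "R 4 i"
  shows "y (i + a 4 * q 3) \<le> e 2"
proof (rule ccontr)
  define i' where "i' = i + (a 4 - 1) * 3"
  assume "\<not> y (i + a 4 * q 3) \<le> e 2"
  moreover have a4: "1 \<le> a 4" by (rule a_pos) simp
  ultimately have Y: "sqrt (-c) < y (i' + 3)"
    unfolding i'_def e_2 by (cases "a 4") (simp_all add: algebra_simps)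
  have R3: "R 3 i'"
    using R_block[of 3 i "a 4 - 1"] assms a4 by (simp add: i'_def)
  have le: "y (i' + 3) < y (i' + 2)" "y (i' + 2) < y (i' + 1)"
    using R_closest[OF R3, of 3 2] R_closest[OF R3, of 2 1] by simp_all
  have "y i' \<le> sqrt (-c)"
    using R_gt[OF R3, of 1] by (intro growth_le_sqrt) simp
  then have "(y i')\<^sup>2 \<le> -c"
    using c_bounds power_mono[of "y i'" "sqrt (-c)" 2] by simp
  moreover have "y (i' + 1) = \<bar>(y i')\<^sup>2 + c\<bar>" using A_y[of "Suc 0" i'] A_1 by simp
  ultimately have y1: "y (i' + 1) \<le> -c" by simp
  have sq: "-c < (y (i' + k))\<^sup>2" if "sqrt (-c) < y (i' + k)" for k
    using power_strict_mono[OF that, of 2] c_bounds by simp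
  have y_Suc: "y (k + 1) = \<bar>(y k)\<^sup>2 + c\<bar>" for k using A_y[of "Suc 0" k] A_1 by simp
  have y01: "y 1 = -c" using y_Suc[of 0] c_bounds by simp
  have "y (i' + 2) \<le> y 2"
  proof -
    have "y (i' + 2) = (y (i' + 1))\<^sup>2 + c"
      using y_Suc[of "i' + 1"] sq[of 1] le Y by simp
    also have "\<dots> \<le> (-c)\<^sup>2 + c" using y1 by (intro add_right_mono power_mono) simp_all
    also have "\<dots> \<le> y 2" using y_Suc[of 1] y01 by (simp add: numeral_2_eq_2)
    finally show ?thesis .
  qed
  then have "(y (i' + 2))\<^sup>2 \<le> (y 2)\<^sup>2" by (rule power_mono) simp
  then have "y (i' + 3) \<le> y 3"
    using y_Suc[of "i' + 2"] y_Suc[of 2] sq[of 2] le Y by (simp add: numeral_eq_Suc)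
  then show False using y_3_less Y by simp
qed

text \<open>At level 1 there is no rising half, as \<open>e 1 = z 1\<close>; only the falling half
  is uniform in \<open>n\<close>.\<close>

lemma left_side:
  assumes "1 \<le> n" "2 \<le> n \<Longrightarrow> valley n"
  shows "0 < z n" "strict_antimono_on {0..z n} (A (q n))" "A (q n) (z n) = 0"
proof -
  have "0 < z n \<and> strict_antimono_on {0..z n} (A (q n)) \<and> A (q n) (z n) = 0"
  proof (cases "n = 1")
    case True
    then show ?thesis using z_1 A_1_dec A_1_zero c_bounds q_init by simp
  next
    case False
    then show ?thesis using assms by (auto simp: valley_def)
  qed
  then show "0 < z n" "strict_antimono_on {0..z n} (A (q n))" "A (q n) (z n) = 0" by auto
qed

text \<open>The ranges reflect what each step consumes: \<open>settled_last\<close> puts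
  \<open>w (n + 2)\<close> before \<open>e n\<close>, which turns \<open>branch n\<close> into
  \<open>valley n\<close>; \<open>branch_step\<close> then builds level \<open>n + 1\<close>, and
  \<open>settled_init\<close> completes \<open>settled (n + 2)\<close>.\<close>

lemma structure_aux:
  "(\<forall>m\<in>{4..l + 4}. settled m) \<and> (\<forall>m\<in>{2..l + 2}. valley m \<and> z (m - 2) < w m) \<and>
   (\<forall>m\<in>{2..l + 3}. branch m \<and> high m)"
proof (induction l)
  case 0
  have z0: "0 < z 0" "strict_antimono_on {0..z 0} (A (q 0))" "A (q 0) (z 0) = 0"
    using z_0 A_1_dec A_1_zero c_bounds q_init by simp_all
  have b2: "branch 2" "high 2"
    using branch_step_one[of 0] left_side[of 1] z0 a_init(2) A_1_inc q_init z_0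
    by (simp_all add: numeral_2_eq_2)
  have "w 4 \<le> e 2"
    using settled_last_4[of 0] R_zero[of 4] by simp
  then have v2: "valley 2" "z 0 < w 2"
    using valley_of_branch[of 2] b2 by simp_all
  have b3: "branch 3" "high 3"
  proof -
    show "branch 3" "high 3"
      using branch_step_one[of 1] left_side[of 1] left_side[of 2] v2 a_init(3) A_1_inc q_init z_1
      by (simp_all add: numeral_2_eq_2 numeral_3_eq_3)
  qed
  have "settled 4"
    unfolding settled_def
  proof (intro allI impI conjI)
    fix i assume R4: "R 4 i"
    show "y (i + a 4 * q (4 - 1)) \<le> e (4 - 2)"
      using settled_last_4[OF R4] by simp
    have "y (i + k * q 3) \<le> e 2" if "k < a 4" for k
    proof -
      have "R 3 (i + k * q 3)" using R_block[of 3 i k] R4 that by simp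
      then show ?thesis
        unfolding e_2 using R_gt[of 3 "i + k * q 3" 1] by (intro growth_le_sqrt) simp
    qed
    then show "y (i + k * q (4 - 1)) \<le> e (4 - 1)" if "k < a 4" for k
      using settled_init[of 2 i k] R4 settled_last_4[OF R4] v2(1) b3(2) that by simp
  qed
  then have "(\<forall>m\<in>{4}. settled m) \<and> (\<forall>m\<in>{2}. valley m \<and> z (m - 2) < w m) \<and>
      (\<forall>m\<in>{2, 3}. branch m \<and> high m)"
    using v2 b2 b3 by simp
  moreover have "{4..0 + 4} = {4::nat}" "{2..0 + 2} = {2::nat}" "{2..0 + 3} = {2, 3::nat}" by auto
  ultimately show ?case by (simp only:)
next
  case (Suc l)
  define p where "p = l + 1"
  have p1 [simp]: "1 \<le> p" "Suc 0 \<le> p" by (simp_all add: p_def)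
  have S: "settled m" if "4 \<le> m" "m \<le> p + 3" for m using Suc that by (simp add: p_def)
  have V: "valley m" "z (m - 2) < w m" if "2 \<le> m" "m \<le> p + 1" for m using Suc that by (auto simp: p_def)
  have B: "branch m" "high m" if "2 \<le> m" "m \<le> p + 2" for m using Suc that by (auto simp: p_def)
  have e_le: "e (Suc m) \<le> z m" if "1 \<le> m" "m \<le> p + 1" for m
    using B(1)[of "Suc m"] that by (simp add: branch_def)
  have S0: "k < a m \<Longrightarrow> y (k * q (m - 1)) \<le> e (m - 1)" "w m \<le> e (m - 2)"
    if "4 \<le> m" "m \<le> p + 3" for m k
    using S[OF that] R_zero[of m] that unfolding settled_def by (metis add_0 order_trans one_le_numeral)+
  have v: "y (k * q m) \<le> e m" if "2 \<le> m" "m \<le> p + 2" "1 \<le> k" "k < a (m + 1)" for m k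
  proof (cases "m = 2")
    case True
    then show ?thesis using that a_init(3) by (simp add: numeral_3_eq_3)
  next
    case False
    then show ?thesis using S0(1)[of "m + 1" k] that by simp
  qed
  have last: "y (i + a (p + 4) * q (p + 3)) \<le> e (p + 2)" if "R (p + 4) i" for i
    using that
  proof (rule settled_last[rotated])
    show "y (k * q (p + 1)) \<le> e (p + 1)" if "1 \<le> k" "k < a (p + 2)" for k
      using v[of "p + 1" k] p1 that by simp
  qed (use p1 S V B e_le[of "p + 1"] e_le[of p] left_side[of p] in auto)
  have p41: "p + 4 - 1 = p + 3" and p42: "p + 4 - 2 = p + 2" and p22: "p + 2 + 2 = p + 4"
    by simp_all
  have R_0: "R (p + 4) 0" by (rule R_zero) simp
  have wl: "w (p + 4) \<le> e (p + 2)"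
    using last[OF R_0] by (simp only: p41 add_0)
  have V2: "valley (p + 2)" "z (p + 2 - 2) < w (p + 2)"
    using valley_of_branch[of "p + 2"] B[of "p + 2"] wl unfolding p22 by simp_all
  have "branch (p + 1 + 2) \<and> high (p + 1 + 2)"
  proof -
    note * = branch_step[of "p + 1" "e (p + 1)"]
    have "strict_mono_on {z (p + 1)..e (p + 1)} (A (q (p + 1)))"
      "strict_mono_on {z (p + 1 + 1)..e (p + 1 + 1)} (A (q (p + 1 + 1)))"
      using V[of "p + 1"] V2 by (auto simp: valley_def)
    moreover have "y (k * q (p + 1 + 1)) \<le> e (p + 1 + 1)" if "1 \<le> k" "k < a (p + 1 + 2)" for k
      using v[of "p + 2" k] that by (simp add: eval_nat_numeral)
    moreover have "w (p + 1 + 2) \<le> e (p + 1)"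
      using S0(2)[of "p + 3"] by (simp add: eval_nat_numeral)
    ultimately show ?thesis
      using * left_side[of "p + 1"] left_side[of "p + 1 + 1"] V V2 e_le[of "p + 1"]
      by (simp add: eval_nat_numeral)
  qed
  then have B3: "branch (p + 3)" "high (p + 3)" by (simp_all add: eval_nat_numeral)
  have S4: "settled (p + 4)"
    unfolding settled_def
  proof (intro allI impI conjI)
    fix i assume R4: "R (p + 4) i"
    show "y (i + a (p + 4) * q (p + 4 - 1)) \<le> e (p + 4 - 2)"
      using last[OF R4] by (simp only: p41 p42)
    have le: "y (i + k * q (p + 3)) \<le> e (p + 2)" if "k < a (p + 4)" for k
    proof -
      have "R (p + 3) (i + k * q (p + 3))"
        using R_block[of "p + 3" i k] R4 that by (simp add: eval_nat_numeral)
      moreover have "0 < a (p + 3)" using a_pos[of "p + 3"] by simp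
      ultimately show ?thesis
        using S[of "p + 3"] unfolding settled_def by fastforce
    qed
    show "y (i + k * q (p + 4 - 1)) \<le> e (p + 4 - 1)" if "k < a (p + 4)" for k
      using settled_init[of "p + 2" i k] R4 le last[OF R4] V2(1) B3(2) that
      by (simp add: eval_nat_numeral)
  qed
  have "{4..Suc l + 4} = insert (p + 4) {4..l + 4}" "{2..Suc l + 2} = insert (p + 2) {2..l + 2}"
    "{2..Suc l + 3} = insert (p + 3) {2..l + 3}" by (auto simp: p_def)
  then show ?case using Suc S4 V2 B3 by simp
qed

lemma valley: "2 \<le> n \<Longrightarrow> valley n"
  and z_less_w: "2 \<le> n \<Longrightarrow> z (n - 2) < w n"
  and branch: "2 \<le> n \<Longrightarrow> branch n"
  and settled: "4 \<le> n \<Longrightarrow> settled n"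
  using structure_aux[of n] by auto

section \<open>Positions of returns and absence of critical points\<close>

lemma z_pos: "1 \<le> n \<Longrightarrow> 0 < z n"
  and A_dec: "1 \<le> n \<Longrightarrow> strict_antimono_on {0..z n} (A (q n))"
  and A_z: "1 \<le> n \<Longrightarrow> A (q n) (z n) = 0"
  using left_side valley by auto

lemma z_less_e: "2 \<le> n \<Longrightarrow> z n < e n"
  and A_inc: "2 \<le> n \<Longrightarrow> strict_mono_on {z n..e n} (A (q n))"
  using valley by (auto simp: valley_def)

lemma e_le_z: "1 \<le> n \<Longrightarrow> e (n + 1) \<le> z n"
  and A_e: "2 \<le> n \<Longrightarrow> A (q n) (e n) = d (n - 2)"
  using branch[of "n + 1"] branch[of n] by (auto simp: branch_def)

lemma z_antimono: "1 \<le> m \<Longrightarrow> m \<le> n \<Longrightarrow> z n \<le> z m"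
proof (induction n)
  case (Suc n)
  then show ?case using z_less_e[of "Suc n"] e_le_z[of n] by (cases "m = Suc n") auto
qed simp

lemma w_le_e: "2 \<le> n \<Longrightarrow> w (n + 2) \<le> e n"
  using settled[of "n + 2"] R_zero[of "n + 2"] unfolding settled_def by fastforce

lemma block_le_e:
  assumes "2 \<le> n" "1 \<le> k" "k < a (n + 1)"
  shows "y (k * q n) \<le> e n"
proof (cases "n = 2")
  case True
  then show ?thesis using assms a_init(3) by (simp add: numeral_3_eq_3)
next
  case False
  then show ?thesis
    using settled[of "n + 1"] R_zero[of "n + 1"] assms unfolding settled_def by fastforce
qed

lemma d_le_w: "d (n + 1) \<le> w (n + 2)"
  using block_pos_mono[of "n + 1" 1 "a (n + 2)"] a_pos[of "n + 2"] by simp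

lemma w_less_d:
  assumes "2 \<le> n"
  shows "w (n + 2) < d n"
proof -
  let ?k = "a (n + 2) - 1"
  let ?t = "y (?k * q (n + 1))"
  have a1: "1 \<le> a (n + 2)" by (rule a_pos) simp
  have "R (n + 1) (0 + ?k * q (n + 1))"
    using R_block[of "n + 1" 0 ?k] R_zero[of "n + 2"] a1 by simp
  then have "y (?k * q (n + 1) + q (n + 1)) < y (?k * q (n + 1) + q n)"
    using R_closest[of "n + 1" "?k * q (n + 1)" "n + 1" "q n"] q_less_Suc[of n] q_pos[of n] assms by simp
  moreover have "?k * q (n + 1) + q (n + 1) = a (n + 2) * q (n + 1)" using a1 by (cases "a (n + 2)") auto
  ultimately have "w (n + 2) < A (q n) ?t" by (simp add: A_y)
  also have "?t \<le> z n"
  proof (cases "?k = 0")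
    case False
    then have "1 \<le> ?k" "?k < a (n + 1 + 1)" by simp_all
    then have "?t \<le> e (n + 1)" using block_le_e[of "n + 1" ?k] assms by simp
    then show ?thesis using e_le_z[of n] assms by simp
  qed (use z_pos[of n] assms in simp)
  then have "A (q n) ?t \<le> d n" using A_le_d[OF A_dec[of n]] assms by simp
  finally show ?thesis .
qed

lemma z_less_d: "1 \<le> n \<Longrightarrow> z n < d n"
proof (cases "n = 1")
  case True
  then show ?thesis using z_less_w[of 2] z_0 z_1 a_init(2) q_init by simp
next
  case False
  assume "1 \<le> n"
  then show ?thesis using w_less_d[of n] z_less_w[of "n + 2"] False by simp
qed

lemma tower:
  assumes "2 \<le> n" "0 \<le> t" "t \<le> e n" "1 \<le> k" "k < a n"
  shows "z (n - 1) \<le> A (k * q (n - 1)) t" "A (k * q (n - 1)) t \<le> y (k * q (n - 1))"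
  using branch[of n] assms unfolding branch_def by auto

lemma tower_last:
  assumes "2 \<le> n" "0 \<le> t" "t \<le> e n"
  shows "A (a n * q (n - 1)) t \<le> w n" "t < e n \<Longrightarrow> 0 < A (a n * q (n - 1)) t"
proof -
  have *: "strict_antimono_on {0..e n} (A (a n * q (n - 1)))" "A (a n * q (n - 1)) (e n) = 0" "0 < e n"
    using branch[of n] assms unfolding branch_def by auto
  show "A (a n * q (n - 1)) t \<le> w n"
    using strict_antimono_on_leD[OF *(1), of 0 t] assms by simp
  show "0 < A (a n * q (n - 1)) t" if "t < e n"
    using monotone_onD[OF *(1), of t "e n"] * that assms by simp
qed

lemma block_less_e:
  assumes "2 \<le> n" "1 \<le> k" "k < a (n + 1)"
  shows "y (k * q n) < e n"
proof -
  have "A (a n * q (n - 1)) (e n) = 0" using branch[OF assms(1)] by (simp add: branch_def)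
  then have "y (k * q n) \<noteq> e n"
    using A_y[of "a n * q (n - 1)" "k * q n"] y_pos[of "k * q n + a n * q (n - 1)"] assms(2) q_pos[of n]
    by auto
  then show ?thesis using block_le_e[OF assms] by simp
qed

lemma w_less_e: 
  assumes "2 \<le> n"
  shows "w (n + 2) < e n"
proof -
  have "A (a n * q (n - 1)) (e n) = 0" using branch[OF assms(1)] by (simp add: branch_def)
  then have "w (n + 2) \<noteq> e n"
    using A_y[of "a n * q (n - 1)" "a (n + 2) * q (n + 1)"] a_pos[of "n + 2"] q_pos[of "n + 1"]
      y_pos[of "a (n + 2) * q (n + 1) + a n * q (n - 1)"] by auto
  then show ?thesis using w_le_e[OF assms] by simp
qed

text \<open>By the chain rule, \<open>f^(q n)\<close> has no critical point inside the branch. Every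
  block starts inside the branch of its own level, so the time left within a block is handled by
  induction.\<close>

lemma nonvanishing:
  assumes "2 \<le> n" "0 < t" "t < e n" "1 \<le> i" "i < q n"
  shows "A i t \<noteq> 0"
  using assms
proof (induction n arbitrary: t i rule: less_induct)
  case (less n)
  obtain l where l: "n = l + 2" using less.prems(1) by (metis add.commute le_Suc_ex)
  define Q where "Q = q (l + 1)"
  define k r where "k = min (i div Q) (a n)" and "r = i - k * Q"
  have "k * Q \<le> i" unfolding k_def by (metis div_times_less_eq_dividend min.cobounded1 mult_le_mono1 order_trans)
  then have i: "i = r + k * Q" by (simp add: r_def)
  have qn: "q n = a n * Q + q l" using q_rec[of l] by (simp add: l Q_def)
  have Ai: "A i t = A r (A (k * Q) t)" unfolding i by (rule abs_iter_add)
  show ?case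
  proof (cases "k = a n")
    case True
    let ?s = "A (a n * Q) t"
    have r: "r < q l" using i qn less.prems(5) True by simp
    have s: "0 < ?s" "?s \<le> w n"
      using tower_last[of n t] less.prems by (auto simp: l Q_def)
    show ?thesis
    proof (cases "r = 0")
      case False
      have l2: "2 \<le> l"
      proof (rule ccontr)
        assume "\<not> 2 \<le> l"
        then have "l = 0 \<or> l = 1" by auto
        then show False using r False q_init by auto
      qed
      then have "?s < e l" using s(2) w_less_e[of l] l by simp
      then show ?thesis using less.IH[of l ?s r] s(1) r False l2 l True Ai by simp
    qed (use s True Ai in simp)
  next
    case False
    then have k: "k < a n" "k = i div Q" by (auto simp: k_def)
    have r: "r < Q" using k(2) q_pos[of "l + 1"] by (simp add: r_def Q_def minus_div_mult_eq_mod)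
    let ?s = "A (k * Q) t"
    have s: "0 < ?s \<and> (2 \<le> l + 1 \<longrightarrow> ?s < e (l + 1))"
    proof (cases "k = 0")
      case True
      have "e n \<le> z (l + 1)" using e_le_z[of "l + 1"] l by simp
      then show ?thesis using True less.prems z_less_e[of "l + 1"] by auto
    next
      case False
      then show ?thesis
        using tower[of n t k] less.prems k z_pos[of "l + 1"] block_less_e[of "l + 1" k]
        by (auto simp: l Q_def)
    qed
    show ?thesis
    proof (cases "r = 0")
      case False
      then have "2 \<le> l + 1" using r q_init by (cases l) (auto simp: Q_def)
      then show ?thesis using less.IH[of "l + 1" ?s r] s r False l Ai by (simp add: Q_def)
    qed (use s Ai in simp)
  qed
qed

end

section \<open>Cross-ratio inequalities for iterates of a quadratic map\<close>

text \<open>Zeros of iterates are allowed at the end points, since 0 and turning points occur there;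
  time 0 is covered by \<open>0 \<le> p\<close>.\<close>

locale monotone_iterate =
  fixes c p r :: real and k :: nat
  assumes p_nonneg: "0 \<le> p" and p_less_r: "p < r"
    and nonzero: "1 \<le> i \<Longrightarrow> i < k \<Longrightarrow> p < t \<Longrightarrow> t < r \<Longrightarrow> (quad c ^^ i) t \<noteq> 0"
begin

abbreviation X :: "nat \<Rightarrow> real \<Rightarrow> real" where "X i \<equiv> quad c ^^ i"

lemma X_Suc: "X (Suc i) t = (X i t)\<^sup>2 + c"
  by (simp add: quad_def)

text \<open>Reduces each inequality below to comparing two products of sums of absolute values;
  their difference factors into terms whose signs come from \<open>ordered_abs\<close>.\<close>

lemma X_Suc_diff: "\<bar>X (Suc i) t - X (Suc i) s\<bar> = \<bar>X i t - X i s\<bar> * \<bar>X i t + X i s\<bar>"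
  unfolding X_Suc abs_mult[symmetric] by (simp add: power2_eq_square algebra_simps)

text \<open>The two claims alternate: monotonicity without interior zeros gives a constant sign, and
  on one side of 0 squaring is monotone.\<close>

lemma monotone: "i \<le> k \<Longrightarrow> strict_mono_on {p..r} (X i) \<or> strict_antimono_on {p..r} (X i)"
  and sign: "i < k \<Longrightarrow> (\<forall>t\<in>{p..r}. 0 \<le> X i t) \<or> (\<forall>t\<in>{p..r}. X i t \<le> 0)"
proof -
  have sign': "(\<forall>t\<in>{p..r}. 0 \<le> X i t) \<or> (\<forall>t\<in>{p..r}. X i t \<le> 0)"
    if i: "i < k" and mono: "strict_mono_on {p..r} (X i) \<or> strict_antimono_on {p..r} (X i)" for i
  proof (rule ccontr)
    assume neg: "\<not> ?thesis"
    have nz: "X i t \<noteq> 0" if "p < t" "t < r" for t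
      using nonzero[of i t] that i p_nonneg by (cases "i = 0") auto
    have "\<exists>t. p \<le> t \<and> t \<le> r \<and> X i t = 0 \<and> X i p \<noteq> 0 \<and> X i r \<noteq> 0"
      using mono
    proof
      assume m: "strict_mono_on {p..r} (X i)"
      obtain s t where "s \<in> {p..r}" "t \<in> {p..r}" "X i s < 0" "0 < X i t"
        using neg by (auto simp: not_le)
      then have "X i p < 0" "0 < X i r"
        using strict_mono_on_leD[OF m, of p s] strict_mono_on_leD[OF m, of t r] p_less_r by auto
      then show ?thesis
        using IVT'[of "X i" p 0 r, OF _ _ _ continuous_quad_iter] p_less_r by force
    next
      assume m: "strict_antimono_on {p..r} (X i)"
      obtain s t where "s \<in> {p..r}" "t \<in> {p..r}" "X i s < 0" "0 < X i t"
        using neg by (auto simp: not_le)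
      then have "X i r < 0" "0 < X i p"
        using strict_antimono_on_leD[OF m, of s r] strict_antimono_on_leD[OF m, of p t] p_less_r by auto
      then show ?thesis
        using IVT2'[of "X i" r 0 p, OF _ _ _ continuous_quad_iter] p_less_r by force
    qed
    then show False using nz by (metis less_le)
  qed
  have mono: "strict_mono_on {p..r} (X i) \<or> strict_antimono_on {p..r} (X i)" if "i \<le> k" for i
    using that
  proof (induction i)
    case 0
    have "strict_mono_on {p..r} (X 0)" by (rule strict_mono_onI) simp
    then show ?case ..
  next
    case (Suc i)
    have sq: "x\<^sup>2 < u\<^sup>2" if "0 \<le> x \<and> x < u \<or> u < x \<and> x \<le> 0" for x u :: real
      using that by (auto simp: abs_le_square_iff[symmetric] not_le[symmetric])
    from Suc have IH: "strict_mono_on {p..r} (X i) \<or> strict_antimono_on {p..r} (X i)" and i: "i < k"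
      by auto
    from IH sign'[OF i IH] show ?case
    proof (elim disjE)
      assume m: "strict_mono_on {p..r} (X i)" and s: "\<forall>t\<in>{p..r}. 0 \<le> X i t"
      have "strict_mono_on {p..r} (X (Suc i))"
        unfolding X_Suc using s strict_mono_onD[OF m] by (intro strict_mono_onI add_strict_right_mono sq) auto
      then show ?thesis ..
    next
      assume m: "strict_mono_on {p..r} (X i)" and s: "\<forall>t\<in>{p..r}. X i t \<le> 0"
      have "strict_antimono_on {p..r} (X (Suc i))"
        unfolding X_Suc using s strict_mono_onD[OF m] by (intro monotone_onI add_strict_right_mono sq) auto
      then show ?thesis ..
    next
      assume m: "strict_antimono_on {p..r} (X i)" and s: "\<forall>t\<in>{p..r}. 0 \<le> X i t"
      have "strict_antimono_on {p..r} (X (Suc i))"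
        unfolding X_Suc using s monotone_onD[OF m] by (intro monotone_onI add_strict_right_mono sq) auto
      then show ?thesis ..
    next
      assume m: "strict_antimono_on {p..r} (X i)" and s: "\<forall>t\<in>{p..r}. X i t \<le> 0"
      have "strict_mono_on {p..r} (X (Suc i))"
        unfolding X_Suc using s monotone_onD[OF m] by (intro strict_mono_onI add_strict_right_mono sq) auto
      then show ?thesis ..
    qed
  qed
  show "i \<le> k \<Longrightarrow> strict_mono_on {p..r} (X i) \<or> strict_antimono_on {p..r} (X i)" by (rule mono)
  show "i < k \<Longrightarrow> (\<forall>t\<in>{p..r}. 0 \<le> X i t) \<or> (\<forall>t\<in>{p..r}. X i t \<le> 0)"
    using sign' mono by simp
qed

lemma ordered:
  assumes "i \<le> k" "p \<le> s" "s < t" "t < u" "u \<le> r"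
  shows "X i s < X i t \<and> X i t < X i u \<or> X i u < X i t \<and> X i t < X i s"
  using monotone[OF assms(1)] assms
    strict_mono_onD[of "{p..r}" "X i"] monotone_onD[of "{p..r}" "(<)" "(>)" "X i"]
  by (elim disjE) auto

lemma ordered_abs:
  assumes "i < k" "p \<le> s" "s < t" "t < u" "u \<le> r"
  shows "\<bar>X i s\<bar> < \<bar>X i t\<bar> \<and> \<bar>X i t\<bar> < \<bar>X i u\<bar> \<or> \<bar>X i u\<bar> < \<bar>X i t\<bar> \<and> \<bar>X i t\<bar> < \<bar>X i s\<bar>"
  using ordered[of i s t u] sign[OF assms(1)] assms by fastforce

lemma abs_add:
  assumes "i < k" "s \<in> {p..r}" "t \<in> {p..r}"
  shows "\<bar>X i s + X i t\<bar> = \<bar>X i s\<bar> + \<bar>X i t\<bar>"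
proof -
  have "0 \<le> X i s \<and> 0 \<le> X i t \<or> X i s \<le> 0 \<and> X i t \<le> 0"
    using sign[OF assms(1)] assms(2,3) by blast
  then show ?thesis by auto
qed

text \<open>Expansion of the cross-ratio with the middle interval shrunk to \<open>b\<close>, in the
  coordinate \<open>t\<^sup>2\<close>, in which the first iterate is a translation. The product is
  the derivative at \<open>b\<close>; \<open>2 * b\<close> converts it to a derivative with respect
  to \<open>t\<^sup>2\<close>.\<close>

lemma derivative_lower:
  assumes b: "p < b" "b < r" and i: "1 \<le> i" "i \<le> k"
  shows "2 * b * (r\<^sup>2 - p\<^sup>2) * (\<bar>X i b - X i p\<bar> * \<bar>X i r - X i b\<bar>) \<le>
    (\<Prod>j<i. 2 * \<bar>X j b\<bar>) * \<bar>X i r - X i p\<bar> * ((b\<^sup>2 - p\<^sup>2) * (r\<^sup>2 - b\<^sup>2))"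
  using i
proof (induction i rule: dec_induct)
  case base
  have "p\<^sup>2 < b\<^sup>2" "b\<^sup>2 < r\<^sup>2" using b p_nonneg by (auto intro!: power_strict_mono)
  then show ?case using b p_nonneg by (simp add: quad_def)
next
  case (step i)
  let ?x = "\<bar>X i p\<bar>" and ?u = "\<bar>X i b\<bar>" and ?v = "\<bar>X i r\<bar>"
  have ik: "i < k" using step by simp
  have "0 \<le> (?u - ?x) * (?v - ?u)"
    using ordered_abs[OF ik, of p b r] b p_less_r by (auto intro: mult_nonneg_nonneg mult_nonpos_nonpos)
  then have *: "(?u + ?x) * (?v + ?u) \<le> 2 * ?u * (?v + ?x)"
    by (simp add: algebra_simps)
  have "2 * b * (r\<^sup>2 - p\<^sup>2) * (\<bar>X (Suc i) b - X (Suc i) p\<bar> * \<bar>X (Suc i) r - X (Suc i) b\<bar>)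
    = (2 * b * (r\<^sup>2 - p\<^sup>2) * (\<bar>X i b - X i p\<bar> * \<bar>X i r - X i b\<bar>)) * ((?u + ?x) * (?v + ?u))"
    unfolding X_Suc_diff using abs_add[OF ik, of b p] abs_add[OF ik, of r b] b p_less_r by simp
  also have "\<dots> \<le> ((\<Prod>j<i. 2 * \<bar>X j b\<bar>) * \<bar>X i r - X i p\<bar> * ((b\<^sup>2 - p\<^sup>2) * (r\<^sup>2 - b\<^sup>2))) * (2 * ?u * (?v + ?x))"
  proof (rule mult_mono)
    have "p\<^sup>2 < b\<^sup>2" "b\<^sup>2 < r\<^sup>2" using b p_nonneg by (auto intro!: power_strict_mono)
    then show "0 \<le> (\<Prod>j<i. 2 * \<bar>X j b\<bar>) * \<bar>X i r - X i p\<bar> * ((b\<^sup>2 - p\<^sup>2) * (r\<^sup>2 - b\<^sup>2))"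
      by (intro mult_nonneg_nonneg prod_nonneg) auto
  qed (use * step in simp_all)
  also have "\<dots> = (\<Prod>j<Suc i. 2 * \<bar>X j b\<bar>) * \<bar>X (Suc i) r - X (Suc i) p\<bar> * ((b\<^sup>2 - p\<^sup>2) * (r\<^sup>2 - b\<^sup>2))"
    unfolding X_Suc_diff using abs_add[OF ik, of r p] p_less_r by (simp add: mult_ac)
  finally show ?case .
qed

text \<open>The cross-ratio with two points merged at the critical point, again in the coordinate
  \<open>t\<^sup>2\<close>; hence the product omits time 0.\<close>

lemma derivative_upper:
  assumes p: "p = 0" and b: "0 < b" "b < r" and i: "1 \<le> i" "i \<le> k"
  shows "(\<Prod>j\<in>{1..<i}. 2 * \<bar>X j 0\<bar>) * \<bar>X i r - X i b\<bar> * (b\<^sup>2 * r\<^sup>2) \<le>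
    (r\<^sup>2 - b\<^sup>2) * (\<bar>X i b - X i 0\<bar> * \<bar>X i r - X i 0\<bar>)"
  using i
proof (induction i rule: dec_induct)
  case base
  have "b\<^sup>2 < r\<^sup>2" using b by (intro power_strict_mono) auto
  then show ?case by (simp add: quad_def)
next
  case (step i)
  let ?x = "\<bar>X i 0\<bar>" and ?u = "\<bar>X i b\<bar>" and ?v = "\<bar>X i r\<bar>"
  have ik: "i < k" using step by simp
  have "0 \<le> (?u - ?x) * (?v - ?x)"
    using ordered_abs[OF ik, of 0 b r] b p by (auto intro: mult_nonneg_nonneg mult_nonpos_nonpos)
  then have *: "2 * ?x * (?v + ?u) \<le> (?u + ?x) * (?v + ?x)"
    by (simp add: algebra_simps)
  have b2: "b\<^sup>2 \<le> r\<^sup>2" using b by (intro power_mono) auto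
  have "(\<Prod>j\<in>{1..<Suc i}. 2 * \<bar>X j 0\<bar>) * \<bar>X (Suc i) r - X (Suc i) b\<bar> * (b\<^sup>2 * r\<^sup>2)
    = ((\<Prod>j\<in>{1..<i}. 2 * \<bar>X j 0\<bar>) * \<bar>X i r - X i b\<bar> * (b\<^sup>2 * r\<^sup>2)) * (2 * ?x * (?v + ?u))"
    unfolding X_Suc_diff using abs_add[OF ik, of r b] b p step(1) by (simp add: mult_ac)
  also have "\<dots> \<le> ((r\<^sup>2 - b\<^sup>2) * (\<bar>X i b - X i 0\<bar> * \<bar>X i r - X i 0\<bar>)) * ((?u + ?x) * (?v + ?x))"
    by (rule mult_mono) (use step b2 * in simp_all)
  also have "\<dots> = (r\<^sup>2 - b\<^sup>2) * (\<bar>X (Suc i) b - X (Suc i) 0\<bar> * \<bar>X (Suc i) r - X (Suc i) 0\<bar>)"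
    unfolding X_Suc_diff using abs_add[OF ik, of b 0] abs_add[OF ik, of r 0] b p by (simp add: mult_ac)
  finally show ?case .
qed

text \<open>The cross-ratio \<open>(t - s) * (r - p) / ((s - p) * (r - t))\<close> does not
  decrease, multiplied out so that intervals may degenerate.\<close>

lemma cross_ratio_expands:
  assumes st: "p \<le> s" "s < t" "t \<le> r" and i: "i \<le> k"
  shows "(t - s) * (r - p) * (\<bar>X i s - X i p\<bar> * \<bar>X i r - X i t\<bar>) \<le>
    (\<bar>X i t - X i s\<bar> * \<bar>X i r - X i p\<bar>) * ((s - p) * (r - t))"
proof (cases "s = p \<or> t = r")
  case False
  then have st': "p < s" "t < r" using st by auto
  show ?thesis
    using i
  proof (induction i)
    case 0
    then show ?case using st p_less_r by simp
  next
    case (Suc i)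
    let ?x = "\<bar>X i p\<bar>" and ?s = "\<bar>X i s\<bar>" and ?t = "\<bar>X i t\<bar>" and ?v = "\<bar>X i r\<bar>"
    have ik: "i < k" using Suc by simp
    have "0 \<le> (?v - ?s) * (?t - ?x)"
      using ordered_abs[OF ik, of p s t] ordered_abs[OF ik, of s t r] st st'
      by (auto intro: mult_nonneg_nonneg mult_nonpos_nonpos)
    then have *: "(?s + ?x) * (?v + ?t) \<le> (?t + ?s) * (?v + ?x)"
      by (simp add: algebra_simps)
    have "(t - s) * (r - p) * (\<bar>X (Suc i) s - X (Suc i) p\<bar> * \<bar>X (Suc i) r - X (Suc i) t\<bar>)
      = ((t - s) * (r - p) * (\<bar>X i s - X i p\<bar> * \<bar>X i r - X i t\<bar>)) * ((?s + ?x) * (?v + ?t))"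
      unfolding X_Suc_diff using abs_add[OF ik, of s p] abs_add[OF ik, of r t] st by simp
    also have "\<dots> \<le> ((\<bar>X i t - X i s\<bar> * \<bar>X i r - X i p\<bar>) * ((s - p) * (r - t))) * ((?t + ?s) * (?v + ?x))"
      by (rule mult_mono) (use Suc st * in simp_all)
    also have "\<dots> = (\<bar>X (Suc i) t - X (Suc i) s\<bar> * \<bar>X (Suc i) r - X (Suc i) p\<bar>) * ((s - p) * (r - t))"
      unfolding X_Suc_diff using abs_add[OF ik, of t s] abs_add[OF ik, of r p] st p_less_r
      by (simp add: mult_ac)
    finally show ?case .
  qed
qed (use st p_less_r in auto)

end

lemma abs_diff_opposite: "x < 0 \<and> 0 < u \<or> u < 0 \<and> 0 < x \<Longrightarrow> \<bar>u - x\<bar> = \<bar>u\<bar> + \<bar>x\<bar>"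
  for x u :: real
  by auto

lemma abs_diff_same: "0 < u \<and> u < v \<or> v < u \<and> u < 0 \<Longrightarrow> \<bar>v - u\<bar> = \<bar>v\<bar> - \<bar>u\<bar>"
  for u v :: real
  by auto

context rotation_recurrence
begin

section \<open>Growth of derivatives at closest returns\<close>

text \<open>\<open>{0..e (l + 1)}\<close> is pulled back \<open>j\<close> times through the rising
  half at level \<open>l + 2\<close>. This is possible because that half has range
  \<open>{0..d l}\<close> and \<open>r \<le> z l < d l\<close> holds at each stage.\<close>

lemma chain_interval:
  assumes l: "1 \<le> l" and j: "j < a (l + 3)"
  shows "\<exists>p r. 0 \<le> p \<and> p < r \<and> r \<le> z l \<and>
    A (j * q (l + 2)) p = 0 \<and> A (j * q (l + 2)) r = e (l + 1) \<and>
    (\<forall>i t. 1 \<le> i \<and> i < j * q (l + 2) + q (l + 1) \<and> p < t \<and> t < r \<longrightarrow> A i t \<noteq> 0) \<and>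
    (\<forall>t\<in>{0..e (l + 3)}. p \<le> A ((a (l + 3) - j) * q (l + 2)) t \<and>
       A ((a (l + 3) - j) * q (l + 2)) t < r)"
  using j
proof (induction j)
  case 0
  have "A (a (l + 3) * q (l + 2)) t < e (l + 1)" if "t \<in> {0..e (l + 3)}" for t
    using tower_last(1)[of "l + 3" t] w_less_e[of "l + 1"] that l by (simp add: eval_nat_numeral)
  then show ?case
    using l e_le_z[of l] z_pos[of "l + 1"] z_less_e[of "l + 1"] nonvanishing[of "l + 1"]
    by (intro exI[of _ 0] exI[of _ "e (l + 1)"]) auto
next
  case (Suc j)
  let ?Q = "q (l + 2)"
  obtain p r where pr: "0 \<le> p" "p < r" "r \<le> z l"
    and zero: "A (j * ?Q) p = 0" and end_e: "A (j * ?Q) r = e (l + 1)"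
    and nz: "\<And>i t. 1 \<le> i \<Longrightarrow> i < j * ?Q + q (l + 1) \<Longrightarrow> p < t \<Longrightarrow> t < r \<Longrightarrow> A i t \<noteq> 0"
    and loc: "\<And>t. t \<in> {0..e (l + 3)} \<Longrightarrow>
      p \<le> A ((a (l + 3) - j) * ?Q) t \<and> A ((a (l + 3) - j) * ?Q) t < r"
    using Suc.IH Suc.prems by auto
  have inc: "strict_mono_on {z (l + 2)..e (l + 2)} (A ?Q)" and ze: "z (l + 2) < e (l + 2)"
    using A_inc[of "l + 2"] z_less_e[of "l + 2"] by simp_all
  have Az: "A ?Q (z (l + 2)) = 0" and Ae: "A ?Q (e (l + 2)) = d l"
    using A_z[of "l + 2"] A_e[of "l + 2"] by simp_all
  have ex: "\<exists>x\<ge>z (l + 2). x \<le> e (l + 2) \<and> A ?Q x = s" if "0 \<le> s" "s \<le> r" for s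
    using IVT'[of "A ?Q" "z (l + 2)" s "e (l + 2)", OF _ _ _ continuous_abs_iter] Az Ae ze that pr
      z_less_d[OF l] by simp
  obtain p' where p': "z (l + 2) \<le> p'" "p' \<le> e (l + 2)" "A ?Q p' = p"
    using ex[of p] pr by auto
  obtain r' where r': "z (l + 2) \<le> r'" "r' \<le> e (l + 2)" "A ?Q r' = r"
    using ex[of r] pr by auto
  have less: "A ?Q s < A ?Q t \<longleftrightarrow> s < t" if "s \<in> {z (l + 2)..e (l + 2)}" "t \<in> {z (l + 2)..e (l + 2)}" for s t
    using strict_mono_on_less[OF inc that] .
  have zpos: "0 < z (l + 2)" using z_pos by simp
  have shift: "A (i + ?Q) t = A i (A ?Q t)" for i t by (rule abs_iter_add)
  have "p' < r'" using less[of p' r'] p' r' pr by simp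
  moreover have "r' \<le> z l"
    using r'(2) e_le_z[of "l + 1"] z_antimono[of l "l + 1"] l by (simp add: eval_nat_numeral)
  moreover have "A (Suc j * ?Q) p' = 0" "A (Suc j * ?Q) r' = e (l + 1)"
    using shift[of "j * ?Q"] p' r' zero end_e by (simp_all add: add.commute)
  moreover have "A i t \<noteq> 0" if it: "1 \<le> i" "i < Suc j * ?Q + q (l + 1)" "p' < t" "t < r'" for i t
  proof -
    consider "i < ?Q" | "i = ?Q" | "i = (i - ?Q) + ?Q" "1 \<le> i - ?Q" by linarith
    then show ?thesis
    proof cases
      case 1
      then show ?thesis using nonvanishing[of "l + 2" t i] it p' r' zpos by simp
    next
      case 2
      then show ?thesis using less[of p' t] it p' r' pr by simp
    next
      case 3
      have "p < A ?Q t" "A ?Q t < r" using less[of p' t] less[of t r'] it p' r' by simp_all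
      then have "A (i - ?Q) (A ?Q t) \<noteq> 0" using nz[of "i - ?Q" "A ?Q t"] 3 it(2) by simp
      then show ?thesis using 3(1) shift by metis
    qed
  qed
  moreover have "p' \<le> A ((a (l + 3) - Suc j) * ?Q) t \<and> A ((a (l + 3) - Suc j) * ?Q) t < r'"
    if t: "t \<in> {0..e (l + 3)}" for t
  proof -
    let ?k = "a (l + 3) - Suc j"
    have k: "1 \<le> ?k" "?k < a (l + 3)" "Suc ?k = a (l + 3) - j" using Suc.prems by simp_all
    have s: "A (?k * ?Q) t \<in> {z (l + 2)..e (l + 2)}"
      using tower[of "l + 3" t ?k] block_le_e[of "l + 2" ?k] k t by (simp add: eval_nat_numeral)
    have "A ?Q (A (?k * ?Q) t) = A ((a (l + 3) - j) * ?Q) t"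
      unfolding k(3)[symmetric] by (simp add: abs_iter_add)
    then show ?thesis
      using loc[OF t] less[OF s, of p'] less[OF s, of r'] p' r' by auto
  qed
  ultimately show ?case
    using p' zpos by (intro exI[of _ p'] exI[of _ r']) simp
qed

text \<open>After the remaining blocks the ends are 0 and \<open>e (l + 1)\<close>; the final
  \<open>q (l + 1)\<close> steps carry them to the returns \<open>d (l + 1)\<close> and
  \<open>d (l - 1)\<close>.\<close>

lemma chain_interval_ends:
  assumes l: "1 \<le> l" and k: "1 \<le> k" "k \<le> a (l + 3)"
  obtains p r where "0 \<le> p" "p < r" "r \<le> z l"
    "monotone_iterate c p r (q (l + 3) - k * q (l + 2))"
    "A (q (l + 3) - k * q (l + 2)) p = d (l + 1)" "A (q (l + 3) - k * q (l + 2)) r = d (l - 1)"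
    "\<And>t. t \<in> {0..e (l + 3)} \<Longrightarrow> p \<le> A (k * q (l + 2)) t \<and> A (k * q (l + 2)) t < r"
proof -
  let ?j = "a (l + 3) - k"
  have qn: "q (l + 3) = a (l + 3) * q (l + 2) + q (l + 1)"
    using q_rec[of "l + 1"] by (simp add: eval_nat_numeral)
  then have L: "q (l + 3) - k * q (l + 2) = q (l + 1) + ?j * q (l + 2)"
    using k(2) by (simp add: diff_mult_distrib)
  have j: "?j < a (l + 3)" "a (l + 3) - ?j = k" using k by simp_all
  obtain p r where pr: "0 \<le> p" "p < r" "r \<le> z l"
    "A (?j * q (l + 2)) p = 0" "A (?j * q (l + 2)) r = e (l + 1)"
    "\<forall>i t. 1 \<le> i \<and> i < ?j * q (l + 2) + q (l + 1) \<and> p < t \<and> t < r \<longrightarrow> A i t \<noteq> 0"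
    "\<forall>t\<in>{0..e (l + 3)}. p \<le> A (k * q (l + 2)) t \<and> A (k * q (l + 2)) t < r"
    using chain_interval[OF l j(1)] unfolding j(2) by blast
  have "monotone_iterate c p r (q (l + 3) - k * q (l + 2))"
    unfolding L using pr(1,2,6) by unfold_locales (auto simp: abs_iter_def add.commute)
  moreover have "A (q (l + 3) - k * q (l + 2)) p = d (l + 1)" "A (q (l + 3) - k * q (l + 2)) r = d (l - 1)"
    unfolding L abs_iter_add using pr(4,5) A_e[of "l + 1"] l by simp_all
  ultimately show ?thesis using that pr by blast
qed

definition D :: "nat \<Rightarrow> real" where "D n = (\<Prod>i\<in>{1..<q n}. 2 * y i)"

definition Z :: "nat \<Rightarrow> real" where "Z n = D n * d (n - 1)"

lemma d_pos: "0 < d n"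
  by (rule y_pos[OF q_pos])

lemma D_pos: "0 < D n"
  unfolding D_def using y_pos by (intro prod_pos) auto

lemma Z_pos: "0 < Z n"
  unfolding Z_def using D_pos d_pos by simp

lemma D_split:
  assumes "1 \<le> m" "m \<le> n"
  shows "D n = D m * (\<Prod>j<q n - q m. 2 * y (q m + j))"
proof -
  have le: "1 \<le> q m" "q m \<le> q n" using q_pos[of m] q_mono[OF assms(2)] by simp_all
  have "D n = D m * (\<Prod>i\<in>{q m..<q n}. 2 * y i)"
    unfolding D_def using prod.atLeastLessThan_concat[OF le, of "\<lambda>i. 2 * y i"] by simp
  also have "(\<Prod>i\<in>{q m..<q n}. 2 * y i) = (\<Prod>j<q n - q m. 2 * y (q m + j))"
    using le(2) prod.shift_bounds_nat_ivl[of "\<lambda>i. 2 * y i" 0 "q m" "q n - q m"]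
    by (simp add: atLeast0LessThan add.commute)
  finally show ?thesis .
qed

text \<open>Eliminates the unknown positions: \<open>p\<close> is compared with 0, then
  \<open>r\<close> with \<open>M\<close> and \<eta> with \<open>b\<close> jointly, and the remaining
  \<eta> disappears by \<open>d1 \<le> M\<close>.\<close>

lemma growth_arith:
  fixes p b r M \<eta> d1 P :: real
  assumes p: "0 \<le> p" "p < b" "b < r" "r \<le> M" and \<eta>: "0 < \<eta>" "\<eta> \<le> b" and d1: "0 < d1" "d1 \<le> M"
    and P: "0 \<le> P"
    and main: "2 * b * (r\<^sup>2 - p\<^sup>2) * ((\<eta> + d1) * (M - \<eta>)) \<le> P * (M + d1) * ((b\<^sup>2 - p\<^sup>2) * (r\<^sup>2 - b\<^sup>2))"
  shows "2 * M * d1 \<le> P * b * (M + d1)"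
proof -
  define W where "W = P * (M + d1)"
  have b: "0 < b" and M: "0 < M" "\<eta> < M" using p \<eta> by auto
  have bp: "0 < b\<^sup>2 - p\<^sup>2" and rb: "0 < r\<^sup>2 - b\<^sup>2"
    using p power_strict_mono[of p b 2] power_strict_mono[of b r 2] by auto
  have "0 \<le> p\<^sup>2 * (r\<^sup>2 - b\<^sup>2)" using rb by simp
  then have "r\<^sup>2 * (b\<^sup>2 - p\<^sup>2) \<le> (r\<^sup>2 - p\<^sup>2) * b\<^sup>2" by (simp add: algebra_simps)
  then have "2 * ((\<eta> + d1) * (M - \<eta>)) * (r\<^sup>2 * (b\<^sup>2 - p\<^sup>2)) \<le> 2 * ((\<eta> + d1) * (M - \<eta>)) * ((r\<^sup>2 - p\<^sup>2) * b\<^sup>2)"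
    using \<eta> d1 M by (intro mult_left_mono) auto
  also have "\<dots> = (2 * b * (r\<^sup>2 - p\<^sup>2) * ((\<eta> + d1) * (M - \<eta>))) * b"
    by algebra
  also have "\<dots> \<le> (W * ((b\<^sup>2 - p\<^sup>2) * (r\<^sup>2 - b\<^sup>2))) * b"
    using main b by (intro mult_right_mono) (auto simp: W_def)
  finally have "(2 * ((\<eta> + d1) * (M - \<eta>)) * r\<^sup>2) * (b\<^sup>2 - p\<^sup>2) \<le> (W * b * (r\<^sup>2 - b\<^sup>2)) * (b\<^sup>2 - p\<^sup>2)"
    by (simp add: mult_ac)
  then have 1: "2 * ((\<eta> + d1) * (M - \<eta>)) * r\<^sup>2 \<le> W * b * (r\<^sup>2 - b\<^sup>2)"
    using bp by (rule mult_right_le_imp_le)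
  have "r\<^sup>2 * \<eta>\<^sup>2 \<le> M\<^sup>2 * b\<^sup>2"
    using p \<eta> by (intro mult_mono power_mono) auto
  then have "M\<^sup>2 * (r\<^sup>2 - b\<^sup>2) \<le> r\<^sup>2 * (M\<^sup>2 - \<eta>\<^sup>2)" by (simp add: algebra_simps)
  then have "2 * (\<eta> + d1) * (M\<^sup>2 * (r\<^sup>2 - b\<^sup>2)) \<le> 2 * (\<eta> + d1) * (r\<^sup>2 * (M\<^sup>2 - \<eta>\<^sup>2))"
    using \<eta> d1 by (intro mult_left_mono) auto
  also have "\<dots> = (2 * ((\<eta> + d1) * (M - \<eta>)) * r\<^sup>2) * (M + \<eta>)"
    by (simp add: power2_eq_square algebra_simps)
  also have "\<dots> \<le> (W * b * (r\<^sup>2 - b\<^sup>2)) * (M + \<eta>)"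
    using 1 M \<eta> by (intro mult_right_mono) auto
  finally have "(2 * M\<^sup>2 * (\<eta> + d1)) * (r\<^sup>2 - b\<^sup>2) \<le> (W * b * (M + \<eta>)) * (r\<^sup>2 - b\<^sup>2)"
    by (simp only: mult_ac)
  then have 2: "2 * M\<^sup>2 * (\<eta> + d1) \<le> W * b * (M + \<eta>)"
    using rb by (rule mult_right_le_imp_le)
  have "d1 * \<eta> \<le> M * \<eta>" using d1 \<eta> by (intro mult_right_mono) auto
  then have "2 * M * (d1 * (M + \<eta>)) \<le> 2 * M * (M * (\<eta> + d1))"
    using M by (intro mult_left_mono) (auto simp: algebra_simps)
  then have "(2 * M * d1) * (M + \<eta>) \<le> (W * b) * (M + \<eta>)"
    using 2 by (simp add: power2_eq_square mult_ac)
  then have "2 * M * d1 \<le> W * b"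
    by (rule mult_right_le_imp_le) (use M \<eta> in simp)
  then show ?thesis by (simp add: W_def mult_ac)
qed

text \<open>
  The map \<open>f\<^bsup>q\<^sub>n - q\<^sub>n\<^sub>-\<^sub>1\<^esup>\<close> is monotone on an interval \<open>[p, r]\<close> around \<open>d\<^sub>n\<^sub>-\<^sub>1\<close> whose end points go to
  \<open>\<plusminus>d\<^sub>n\<^sub>-\<^sub>2\<close> and \<open>\<plusminus>d\<^sub>n\<^sub>-\<^sub>4\<close>. Since \<open>r \<le> d\<^sub>n\<^sub>-\<^sub>4\<close>, the resulting lower bound for the derivative
  compensates every possible degeneration of the ratios \<open>d\<^sub>k / d\<^sub>k\<^sub>-\<^sub>1\<close>.
\<close>

lemma Z_growth:
  assumes l: "1 \<le> l"
  shows "Z (l + 2) * (2 * d (l - 1)) \<le> Z (l + 3) * (d (l - 1) + d (l + 1))"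
proof -
  let ?L = "q (l + 3) - 1 * q (l + 2)"
  have a1: "1 \<le> a (l + 3)" by (rule a_pos) simp
  obtain p r where pr: "0 \<le> p" "p < r" "r \<le> z l"
    and mi: "monotone_iterate c p r ?L"
    and Ap: "A ?L p = d (l + 1)" and Ar: "A ?L r = d (l - 1)"
    and loc: "\<And>t. t \<in> {0..e (l + 3)} \<Longrightarrow> p \<le> A (1 * q (l + 2)) t \<and> A (1 * q (l + 2)) t < r"
    using chain_interval_ends[OF l order_refl a1] by blast
  interpret monotone_iterate c p r ?L by (rule mi)
  define b where "b = d (l + 2)"
  \<comment> \<open>A zero between \<open>p\<close> and \<open>b\<close>; it determines the signs
    and thereby the differences of the values at \<open>p\<close>, \<open>b\<close> and
    \<open>r\<close>.\<close>
  define u where "u = A (q (l + 2)) (z (l + 3))"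
  have q_le: "q (l + 2) < q (l + 3)" by (rule q_less) auto
  have L1: "1 \<le> ?L" using q_le by simp
  have e_pos: "0 < z (l + 3)" "z (l + 3) < e (l + 3)" using z_pos z_less_e by simp_all
  have b_loc: "p \<le> b" "b < r" using loc[of 0] e_pos by (simp_all add: b_def)
  have u_loc: "p \<le> u" "u < r" using loc[of "z (l + 3)"] e_pos by (simp_all add: u_def)
  have Ab: "A ?L b = d (l + 3)"
    using q_le by (simp add: b_def A_y)
  have Au: "A ?L u = 0"
    using q_le A_z[of "l + 3"] abs_iter_add[of c ?L "q (l + 2)" "z (l + 3)"] by (simp add: u_def)
  have "e (l + 3) \<le> z (l + 2)" using e_le_z[of "l + 2"] by (simp add: eval_nat_numeral)
  then have ub: "u < b"
    using monotone_onD[OF A_dec[of "l + 2"], of 0 "z (l + 3)"] e_pos by (simp add: u_def b_def)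
  have pu: "p < u" using u_loc Ap Au d_pos[of "l + 1"] by (cases "p = u") auto
  have ds: "d (l + 3) < d (l + 1)" "d (l + 1) \<le> d (l - 1)" "d (l + 3) < d (l + 2)"
    using d_less[of "l + 1" "l + 3"] d_le[of "l - 1" "l + 1"] d_less[of "l + 2" "l + 3"] by simp_all
  have abs: "\<bar>X ?L p\<bar> = d (l + 1)" "\<bar>X ?L r\<bar> = d (l - 1)" "\<bar>X ?L b\<bar> = d (l + 3)" "X ?L u = 0"
    using Ap Ar Ab Au by (simp_all add: abs_iter_def)
  have o1: "X ?L p < 0 \<and> 0 < X ?L b \<or> X ?L b < 0 \<and> 0 < X ?L p"
    using ordered[OF order_refl order_refl pu ub less_imp_le[OF b_loc(2)]] unfolding abs(4) by blast
  have o2: "0 < X ?L b \<and> X ?L b < X ?L r \<or> X ?L r < X ?L b \<and> X ?L b < 0"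
    using ordered[OF order_refl u_loc(1) ub b_loc(2) order_refl] unfolding abs(4) by blast
  have diffs: "\<bar>X ?L b - X ?L p\<bar> = d (l + 3) + d (l + 1)"
    "\<bar>X ?L r - X ?L b\<bar> = d (l - 1) - d (l + 3)" "\<bar>X ?L r - X ?L p\<bar> = d (l - 1) + d (l + 1)"
  proof -
    have "X ?L p < 0 \<and> 0 < X ?L r \<or> X ?L r < 0 \<and> 0 < X ?L p" using o1 o2 by auto
    then show "\<bar>X ?L r - X ?L p\<bar> = d (l - 1) + d (l + 1)"
      unfolding abs(1,2)[symmetric] by (rule abs_diff_opposite)
    show "\<bar>X ?L b - X ?L p\<bar> = d (l + 3) + d (l + 1)"
      unfolding abs(1,3)[symmetric] by (rule abs_diff_opposite[OF o1])
    show "\<bar>X ?L r - X ?L b\<bar> = d (l - 1) - d (l + 3)"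
      unfolding abs(2,3)[symmetric] by (rule abs_diff_same[OF o2])
  qed
  have Xj: "\<bar>X j b\<bar> = y (q (l + 2) + j)" for j
  proof -
    have "\<bar>X j b\<bar> = A j b" by (simp add: abs_iter_def)
    then show ?thesis by (simp add: b_def A_y)
  qed
  let ?P = "\<Prod>j<?L. 2 * \<bar>X j b\<bar>"
  have "2 * d (l - 1) * d (l + 1) \<le> ?P * b * (d (l - 1) + d (l + 1))"
  proof (rule growth_arith)
    show "r \<le> d (l - 1)" using pr(3) z_less_d[OF l] d_le[of "l - 1" l] by simp
    show "2 * b * (r\<^sup>2 - p\<^sup>2) * ((d (l + 3) + d (l + 1)) * (d (l - 1) - d (l + 3)))
      \<le> ?P * (d (l - 1) + d (l + 1)) * ((b\<^sup>2 - p\<^sup>2) * (r\<^sup>2 - b\<^sup>2))"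
      using derivative_lower[of b, OF _ b_loc(2) L1 order_refl] pu ub unfolding diffs by simp
  qed (use pr pu ub b_loc ds d_pos in \<open>auto simp: b_def intro!: prod_nonneg\<close>)
  then have "D (l + 2) * (2 * d (l - 1) * d (l + 1)) \<le> D (l + 2) * (?P * b * (d (l - 1) + d (l + 1)))"
    using D_pos[of "l + 2"] by (intro mult_left_mono) auto
  moreover have "D (l + 3) = D (l + 2) * ?P"
    using D_split[of "l + 2" "l + 3"] by (simp add: Xj)
  ultimately show ?thesis by (simp add: Z_def b_def mult_ac eval_nat_numeral)
qed

text \<open>The constant 8 collects three factors 2, from bounding \<open>e n + b\<close>,
  \<open>d n + \<eta>\<close> and \<open>d n + M\<close>. The factor \<open>M - \<eta>\<close>
  cancels because \<open>e n * \<eta> \<le> M * b\<close>, so no ratio of returns enters.\<close>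

lemma D_upper:
  assumes n: "2 \<le> n"
  shows "D n * (w (n + 2))\<^sup>2 \<le> 8 * d n"
proof -
  define b where "b = w (n + 2)"
  define M where "M = d (n - 2)"
  define \<eta> where "\<eta> = d (n + 2)"
  have zb: "0 < z n" "z n < b" "b < e n" "b < d n"
    using z_pos[of n] z_less_w[of "n + 2"] w_less_e[OF n] w_less_d[OF n] n by (simp_all add: b_def)
  have e_pos: "0 < e n" using zb by linarith
  interpret monotone_iterate c 0 "e n" "q n"
  proof
    show "(quad c ^^ i) t \<noteq> 0" if "1 \<le> i" "i < q n" "0 < t" "t < e n" for i t
      using nonvanishing[OF n that(3,4,1,2)] unfolding abs_iter_def by simp
  qed (use e_pos in simp_all)
  have Xb: "\<bar>X (q n) b\<bar> = \<eta>" "\<bar>X (q n) 0\<bar> = d n" "\<bar>X (q n) (e n)\<bar> = M" "X (q n) (z n) = 0"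
  proof -
    have "A (q n) b = \<eta>" "A (q n) (e n) = M" "A (q n) (z n) = 0"
      using A_y[of "q n" "a (n + 2) * q (n + 1)"] q_rec[of n] A_e[OF n] A_z[of n] n
      by (simp_all add: b_def \<eta>_def M_def)
    then show "\<bar>X (q n) b\<bar> = \<eta>" "\<bar>X (q n) 0\<bar> = d n" "\<bar>X (q n) (e n)\<bar> = M" "X (q n) (z n) = 0"
      unfolding abs_iter_def by simp_all
  qed
  have o1: "X (q n) 0 < 0 \<and> 0 < X (q n) b \<or> X (q n) b < 0 \<and> 0 < X (q n) 0"
    using ordered[OF order_refl order_refl zb(1,2) less_imp_le[OF zb(3)]] unfolding Xb(4) by blast
  have o2: "0 < X (q n) b \<and> X (q n) b < X (q n) (e n) \<or> X (q n) (e n) < X (q n) b \<and> X (q n) b < 0"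
    using ordered[OF order_refl less_imp_le[OF zb(1)] zb(2,3) order_refl] unfolding Xb(4) by blast
  have diffs: "\<bar>X (q n) b - X (q n) 0\<bar> = d n + \<eta>" "\<bar>X (q n) (e n) - X (q n) 0\<bar> = d n + M"
    "\<bar>X (q n) (e n) - X (q n) b\<bar> = M - \<eta>"
  proof -
    have "X (q n) 0 < 0 \<and> 0 < X (q n) (e n) \<or> X (q n) (e n) < 0 \<and> 0 < X (q n) 0" using o1 o2 by auto
    from abs_diff_opposite[OF this] show "\<bar>X (q n) (e n) - X (q n) 0\<bar> = d n + M"
      unfolding Xb(2,3) by simp
    from abs_diff_opposite[OF o1] show "\<bar>X (q n) b - X (q n) 0\<bar> = d n + \<eta>"
      unfolding Xb(1,2) by simp
    from abs_diff_same[OF o2] show "\<bar>X (q n) (e n) - X (q n) b\<bar> = M - \<eta>"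
      unfolding Xb(1,3) .
  qed
  have Dn: "(\<Prod>j\<in>{1..<q n}. 2 * \<bar>X j 0\<bar>) = D n"
    by (simp add: D_def abs_iter_def)
  have "D n * (M - \<eta>) * (b\<^sup>2 * (e n)\<^sup>2) \<le> ((e n)\<^sup>2 - b\<^sup>2) * ((d n + \<eta>) * (d n + M))"
    using derivative_upper[OF refl, of b "q n"] zb q_pos[of n] unfolding diffs Dn by simp
  also have "\<dots> \<le> (2 * e n * (e n - b)) * ((2 * d n) * (2 * M))"
  proof (intro mult_mono)
    have "(e n)\<^sup>2 - b\<^sup>2 = (e n + b) * (e n - b)" by (simp add: power2_eq_square algebra_simps)
    also have "\<dots> \<le> 2 * e n * (e n - b)" using zb by (intro mult_right_mono) auto
    finally show "(e n)\<^sup>2 - b\<^sup>2 \<le> 2 * e n * (e n - b)" .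
    show "d n + \<eta> \<le> 2 * d n" "d n + M \<le> 2 * M"
      using d_le[of n "n + 2"] d_le[of "n - 2" n] by (simp_all add: \<eta>_def M_def)
  qed (use zb d_pos in \<open>auto simp: \<eta>_def M_def less_imp_le\<close>)
  also have "\<dots> = 8 * d n * (e n * ((e n - b) * M))" by simp
  also have "\<dots> \<le> 8 * d n * (e n * (e n * (M - \<eta>)))"
  proof -
    have "\<eta> \<le> b" using d_le_w[of n] d_le[of "n + 1" "n + 2"] by (simp add: \<eta>_def b_def)
    moreover have "e n \<le> M"
    proof -
      have n1: "1 \<le> n - 1" "n - 1 + 1 = n" "n - 2 \<le> n - 1" using n by simp_all
      show ?thesis
        using e_le_z[OF n1(1)] z_less_d[OF n1(1)] d_le[OF n1(3)] unfolding n1(2)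
        by (simp add: M_def)
    qed
    ultimately have "e n * \<eta> \<le> M * b" using zb d_pos by (intro mult_mono) (auto simp: \<eta>_def M_def less_imp_le)
    then show ?thesis using zb d_pos[of n] by (intro mult_left_mono) (auto simp: algebra_simps)
  qed
  finally have "(D n * b\<^sup>2) * ((M - \<eta>) * (e n)\<^sup>2) \<le> (8 * d n) * ((M - \<eta>) * (e n)\<^sup>2)"
    by (simp add: power2_eq_square mult_ac)
  moreover have "\<eta> < M"
    using d_less[of n "n + 2"] d_le[of "n - 2" n] n by (simp add: M_def \<eta>_def)
  ultimately show ?thesis
    unfolding b_def[symmetric] using zb by (elim mult_right_le_imp_le) simp
qed

lemma Z_upper: "2 \<le> n \<Longrightarrow> Z n * (w (n + 2))\<^sup>2 \<le> 8 * d n * d (n - 1)"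
  using mult_right_mono[OF D_upper, of n "d (n - 1)"] d_pos[of "n - 1"] by (simp add: Z_def mult_ac)

text \<open>As \<open>w 3 = y 2\<close>, the bound \<open>z 1 < w 3\<close> reads
  \<open>k < (y 2)\<^sup>2\<close>, that is \<open>k * (k - 1)\<^sup>2 > 1\<close>, which forces
  \<open>k > 17/10\<close>. Then \<open>Z 3 = 4 * k * (y 2)\<^sup>2\<close> exceeds
  \<open>4 * k\<^sup>2 > 11\<close>.\<close>

lemma Z_3: "11 < Z 3"
proof -
  define k where "k = -c"
  have y1: "y 1 = k" using A_1[of 0] c_bounds by (simp add: k_def)
  have y2: "y 2 = \<bar>k\<^sup>2 - k\<bar>" using A_y[of 1 1] A_1[of "y 1"] y1 by (simp add: k_def numeral_2_eq_2)
  have k: "0 < k" "k < 2" using c_bounds by (simp_all add: k_def)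
  have "sqrt k < y 2"
    using z_less_w[of 3] z_1 a_init(3) by (simp add: k_def)
  then have "(sqrt k)\<^sup>2 < (y 2)\<^sup>2" using k by (intro power_strict_mono) auto
  then have sq: "k < (y 2)\<^sup>2" using k by simp
  then have "k * 1 < k * (k * (k - 1)\<^sup>2)"
    unfolding y2 by (simp add: power2_eq_square algebra_simps)
  then have "1 < k * (k - 1)\<^sup>2" using k by (simp add: mult_less_cancel_left_pos)
  have "17 / 10 < k"
  proof (rule ccontr)
    assume "\<not> 17 / 10 < k"
    show False
    proof (cases "k \<le> 1")
      case True
      then have "k * (k - 1)\<^sup>2 \<le> 1 * 1" using k by (intro mult_mono) (auto simp: abs_square_le_1)
      then show False using \<open>1 < k * (k - 1)\<^sup>2\<close> by simp
    next
      case False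
      then have "k * (k - 1)\<^sup>2 \<le> 17 / 10 * (7 / 10)\<^sup>2"
        using \<open>\<not> 17 / 10 < k\<close> by (intro mult_mono power_mono) auto
      then show False using \<open>1 < k * (k - 1)\<^sup>2\<close> by (simp add: power2_eq_square)
    qed
  qed
  have "(17 / 10) * (17 / 10) < k * k"
    using \<open>17 / 10 < k\<close> by (intro mult_strict_mono) auto
  also have "k * k < k * (y 2)\<^sup>2" using sq k by simp
  finally have "11 < 4 * (k * (y 2)\<^sup>2)" by simp
  moreover have "{1..<q 3} = {1, 2::nat}" by auto
  then have "Z 3 = 4 * (k * (y 2)\<^sup>2)"
    using y1 by (simp add: Z_def D_def power2_eq_square mult_ac)
  ultimately show ?thesis by simp
qed

lemma Z_mono: "3 \<le> n \<Longrightarrow> Z n \<le> Z (n + 1)"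
proof -
  assume "3 \<le> n"
  then obtain l where l: "n = l + 2" "1 \<le> l" using that[of "n - 2"] by simp
  have "Z (l + 2) * (2 * d (l - 1)) \<le> Z (l + 3) * (d (l - 1) + d (l + 1))"
    by (rule Z_growth[OF l(2)])
  also have "\<dots> \<le> Z (l + 3) * (2 * d (l - 1))"
    using d_le[of "l - 1" "l + 1"] Z_pos[of "l + 3"] by (intro mult_left_mono) auto
  finally have "Z (l + 2) \<le> Z (l + 3)" by (rule mult_right_le_imp_le) (use d_pos in simp)
  then show ?thesis by (simp add: l eval_nat_numeral)
qed

lemma Z_ge_11: "3 \<le> n \<Longrightarrow> 11 \<le> Z n"
proof (induction n rule: dec_induct)
  case (step n)
  then show ?case using Z_mono[of n] by simp
qed (use Z_3 in simp)

lemma w_ratio: "3 \<le> n \<Longrightarrow> Z n * (w (n + 2))\<^sup>2 \<le> 8 * (d (n - 1))\<^sup>2"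
proof -
  assume n: "3 \<le> n"
  have "Z n * (w (n + 2))\<^sup>2 \<le> 8 * d n * d (n - 1)" using Z_upper n by simp
  also have "\<dots> \<le> 8 * d (n - 1) * d (n - 1)"
    using d_le[of "n - 1" n] d_pos by (intro mult_right_mono) (auto simp: less_imp_le)
  finally show ?thesis by (simp add: power2_eq_square mult_ac)
qed

lemma d_ratio: "3 \<le> n \<Longrightarrow> d (n + 1) \<le> 86 / 100 * d (n - 1)"
proof -
  assume n: "3 \<le> n"
  have "11 * (w (n + 2))\<^sup>2 \<le> Z n * (w (n + 2))\<^sup>2" using Z_ge_11[OF n] by (intro mult_right_mono) auto
  then have "(w (n + 2))\<^sup>2 \<le> 8 / 11 * (d (n - 1))\<^sup>2" using w_ratio[OF n] by simp
  \<comment> \<open>0.86 squared is 0.7396, just above 8/11.\<close>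
  also have "\<dots> \<le> (86 / 100 * d (n - 1))\<^sup>2" by (simp add: power_mult_distrib power2_eq_square)
  finally have "w (n + 2) \<le> 86 / 100 * d (n - 1)" by (rule power2_le_imp_le) simp
  then show ?thesis using d_le_w[of n] by simp
qed

text \<open>The ratio 0.86 gives the growth factor 2 / 1.86, which exceeds 1.07.\<close>

lemma Z_exp: "5 \<le> n \<Longrightarrow> 11 * (107 / 100) ^ (n - 5) \<le> Z n"
proof (induction n rule: dec_induct)
  case base
  then show ?case using Z_ge_11[of 5] by simp
next
  case (step n)
  obtain l where l: "n = l + 2" "3 \<le> l" using that[of "n - 2"] step by simp
  have "d (l + 1) \<le> 86 / 100 * d (l - 1)" by (rule d_ratio[OF l(2)])
  then have "Z (l + 3) * (d (l - 1) + d (l + 1)) \<le> Z (l + 3) * (186 / 100 * d (l - 1))"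
    using Z_pos[of "l + 3"] by (intro mult_left_mono) auto
  with Z_growth[of l] l have "(2 * Z (l + 2)) * d (l - 1) \<le> (186 / 100 * Z (l + 3)) * d (l - 1)"
    by (simp add: mult_ac)
  then have "2 * Z (l + 2) \<le> 186 / 100 * Z (l + 3)" by (rule mult_right_le_imp_le) (rule d_pos)
  then have "107 / 100 * Z n \<le> Z (Suc n)"
    using Z_pos[of "l + 2"] by (simp add: l eval_nat_numeral)
  moreover have "(107 / 100 :: real) ^ (Suc n - 5) = 107 / 100 * (107 / 100) ^ (n - 5)"
  proof -
    have "Suc n - 5 = Suc (n - 5)" using step by simp
    then show ?thesis by simp
  qed
  ultimately show ?case using step by simp
qed

text \<open>As 1.03 squared is below 1.07, passing from \<open>n - 2\<close> to \<open>n\<close>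
  gains \<open>1.03^(n - 6)\<close>. The exponent \<open>n * (n - 10) / 4\<close> solves this
  recursion exactly and is not positive for \<open>n < 10\<close>, where
  \<open>d n \<le> y 1 < 2\<close> suffices.\<close>

lemma d_decay: "d n \<le> 2 * (103 / 100) powr (- (real n * (real n - 10) / 4))"
proof (induction n rule: less_induct)
  case (less n)
  show ?case
  proof (cases "n < 10")
    case True
    have "d n \<le> y 1" using d_le[of 0 n] q_init by simp
    also have "\<dots> \<le> 2 * 1" using A_1[of 0] c_bounds by simp
    also have "(1::real) \<le> (103 / 100) powr (- (real n * (real n - 10) / 4))"
      using True by (intro ge_one_powr_ge_zero) (auto simp: mult_nonneg_nonpos)
    finally show ?thesis by simp
  next
    case False
    obtain l where l: "n = l + 2" "8 \<le> l" using that[of "n - 2"] False by simp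
    have L: "l + 1 - 1 = l" "l + 1 + 1 = n" using l by simp_all
    have "Z (l + 1) * (d n)\<^sup>2 \<le> Z (l + 1) * (w (l + 1 + 2))\<^sup>2"
      using d_le_w[of "l + 1"] Z_pos[of "l + 1"] d_pos[of n] L
      by (intro mult_left_mono power_mono) (auto simp: less_imp_le)
    also have "\<dots> \<le> 8 * (d l)\<^sup>2" using w_ratio[of "l + 1"] l by simp
    finally have 1: "Z (l + 1) * (d n)\<^sup>2 \<le> 8 * (d l)\<^sup>2" .
    have "((103 / 100) ^ (l - 4) * d n)\<^sup>2 = ((103 / 100)\<^sup>2) ^ (l - 4) * (d n)\<^sup>2"
      by (simp add: power_mult_distrib power_mult[symmetric] mult.commute)
    also have "\<dots> \<le> (107 / 100) ^ (l - 4) * (d n)\<^sup>2"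
      by (intro mult_right_mono power_mono) (auto simp: power2_eq_square)
    also have "\<dots> \<le> Z (l + 1) / 11 * (d n)\<^sup>2"
      using Z_exp[of "l + 1"] l by (intro mult_right_mono) simp_all
    also have "\<dots> = Z (l + 1) * (d n)\<^sup>2 / 11" by simp
    also have "\<dots> \<le> 8 * (d l)\<^sup>2 / 11" using 1 by (intro divide_right_mono) auto
    also have "\<dots> \<le> (d l)\<^sup>2" by simp
    finally have "(103 / 100) ^ (l - 4) * d n \<le> d l"
      by (rule power2_le_imp_le) simp
    then have "d n \<le> d l * (103 / 100) powr (- real (l - 4))"
      by (simp add: powr_minus powr_realpow field_simps)
    also have "\<dots> \<le> (2 * (103 / 100) powr (- (real l * (real l - 10) / 4))) * (103 / 100) powr (- real (l - 4))"
      using less[of l] l by (intro mult_right_mono) auto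
    also have "\<dots> = 2 * (103 / 100) powr (- (real l * (real l - 10) / 4) - real (l - 4))"
      by (simp add: powr_add[symmetric] powr_diff powr_minus field_simps)
    also have "- (real l * (real l - 10) / 4) - real (l - 4) = - (real n * (real n - 10) / 4)"
      using l by (simp add: field_simps of_nat_diff)
    finally show ?thesis .
  qed
qed

section \<open>Covering the critical orbit\<close>

lemma ex_sig: "3 \<le> n \<Longrightarrow> \<exists>s. z n \<le> s \<and> s \<le> e n \<and> A (q n) s = w (n + 1)"
proof -
  assume n: "3 \<le> n"
  have n1: "2 \<le> n - 1" "n - 1 + 2 = n + 1" "n - 2 \<le> n - 1" using n by simp_all
  have "w (n + 1) \<le> d (n - 2)"
    using w_less_d[OF n1(1)] d_le[OF n1(3)] unfolding n1(2) by simp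
  then show ?thesis
    using IVT'[of "A (q n)" "z n" "w (n + 1)" "e n", OF _ _ _ continuous_abs_iter] A_z[of n] A_e[of n]
      z_less_e[of n] n by auto
qed

text \<open>All blocks of length \<open>q n\<close> start in \<open>[0, sig n]\<close>, away from the turning point \<open>e n\<close>.\<close>

definition sig :: "nat \<Rightarrow> real" where
  "sig n = (SOME s. z n \<le> s \<and> s \<le> e n \<and> A (q n) s = w (n + 1))"

lemma sig:
  assumes "3 \<le> n"
  shows "z n \<le> sig n" "sig n \<le> e n" "A (q n) (sig n) = w (n + 1)"
  using someI_ex[OF ex_sig[OF assms]] unfolding sig_def by auto

lemma sig_less_d: "3 \<le> n \<Longrightarrow> sig n < d (n - 1)"
proof -
  assume n: "3 \<le> n"
  have n1: "1 \<le> n - 1" "n - 1 + 1 = n" using n by simp_all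
  show ?thesis using sig(2)[OF n] e_le_z[OF n1(1)] z_less_d[OF n1(1)] unfolding n1(2) by simp
qed

lemma le_sigI:
  assumes "3 \<le> n" "s \<le> e n" "A (q n) s \<le> w (n + 1)"
  shows "s \<le> sig n"
proof (rule ccontr)
  assume "\<not> s \<le> sig n"
  then have "A (q n) (sig n) < A (q n) s"
    using sig[OF assms(1)] assms by (intro strict_mono_onD[OF A_inc[of n]]) auto
  then show False using sig[OF assms(1)] assms by simp
qed

text \<open>The bounds \<open>sig\<close> fit together: the image of a block start is at most
  \<open>w (n + 2)\<close>, the value defining \<open>sig (n + 1)\<close>; and
  \<open>w (n + 2)\<close> itself returns to \<open>d (n + 2) \<le> w (n + 1)\<close>, hence lies
  before \<open>sig n\<close>.\<close>

lemma block_start: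
  assumes n: "3 \<le> n" and t: "0 \<le> t" "t \<le> sig (n + 2)"
  shows "k < a (n + 2) \<Longrightarrow> A (k * q (n + 1)) t \<le> sig (n + 1)"
    and "A (a (n + 2) * q (n + 1)) t \<le> sig n"
    and "1 \<le> k \<Longrightarrow> k \<le> a (n + 2) \<Longrightarrow> A (k * q (n + 1)) t \<le> w (n + 2)"
proof -
  have te: "t \<le> e (n + 2)" using t n sig(2)[of "n + 2"] by simp
  have *: "A (k * q (n + 1)) t \<le> y (k * q (n + 1))" if "1 \<le> k" "k \<le> a (n + 2)" for k
    using tower[of "n + 2" t k] tower_last(1)[of "n + 2" t] te t that by (cases "k = a (n + 2)") auto
  show "1 \<le> k \<Longrightarrow> k \<le> a (n + 2) \<Longrightarrow> A (k * q (n + 1)) t \<le> w (n + 2)"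
    using *[of k] block_pos_mono[of "n + 1" k "a (n + 2)"] by simp
  show "A (k * q (n + 1)) t \<le> sig (n + 1)" if k: "k < a (n + 2)"
  proof (cases "k = 0")
    case True
    have "e (n + 2) \<le> z (n + 1)" using e_le_z[of "n + 1"] by simp
    then show ?thesis using True te t sig(1)[of "n + 1"] n by simp
  next
    case False
    have "y (k * q (n + 1)) \<le> sig (n + 1)"
    proof (rule le_sigI)
      show "y (k * q (n + 1)) \<le> e (n + 1)" using block_le_e[of "n + 1" k] k False n by simp
      show "A (q (n + 1)) (y (k * q (n + 1))) \<le> w (n + 1 + 1)"
        using block_pos_mono[of "n + 1" "Suc k" "a (n + 2)"] k by (simp add: A_y add.commute)
    qed (use n in simp)
    then show ?thesis using *[of k] k False by simp
  qed
  have "w (n + 2) \<le> sig n"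
  proof (rule le_sigI)
    show "w (n + 2) \<le> e n" using w_le_e[of n] n by simp
    have n1: "n - 1 + 1 = n" "n - 1 + 2 = n + 1" using n by simp_all
    have "A (q n) (w (n + 2)) = d (n + 2)" using q_rec[of n] by (simp add: A_y)
    also have "\<dots> \<le> d n" by (rule d_le) simp
    also have "\<dots> \<le> w (n + 1)" using d_le_w[of "n - 1"] unfolding n1 .
    finally show "A (q n) (w (n + 2)) \<le> w (n + 1)" .
  qed (use n in simp)
  moreover have "1 \<le> a (n + 2)" by (rule a_pos) simp
  ultimately show "A (a (n + 2) * q (n + 1)) t \<le> sig n" using *[of "a (n + 2)"] by simp
qed

text \<open>\<open>n = 0\<close> serves the cover, with times from 0; \<open>n = 1\<close> serves
  the comparison of lengths, where a remainder of at least 1 permits absolute values at block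
  starts.\<close>

lemma block_decomposition:
  assumes "n \<le> i" "i < n + q (l + 2)" "n \<le> 1"
  obtains k r where "i = k * q (l + 1) + r" "k < a (l + 2)" "n \<le> r" "r < n + q (l + 1)"
    | r where "i = a (l + 2) * q (l + 1) + r" "n \<le> r" "r < n + q l"
proof -
  let ?Q = "q (l + 1)"
  have Q: "0 < ?Q" by (rule q_pos)
  show thesis
  proof (cases "(i - n) div ?Q < a (l + 2)")
    case True
    have "i - n = (i - n) div ?Q * ?Q + (i - n) mod ?Q" by simp
    then have "i = (i - n) div ?Q * ?Q + (n + (i - n) mod ?Q)" using assms(1) by linarith
    then show ?thesis using that(1)[of "(i - n) div ?Q" "n + (i - n) mod ?Q"] True Q by simp
  next
    case False
    then have "a (l + 2) * ?Q \<le> (i - n) div ?Q * ?Q" by simp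
    also have "\<dots> \<le> i - n" by simp
    finally have le: "a (l + 2) * ?Q \<le> i - n" .
    show ?thesis
    proof (rule that(2)[of "i - a (l + 2) * ?Q"])
      show "i = a (l + 2) * ?Q + (i - a (l + 2) * ?Q)" "n \<le> i - a (l + 2) * ?Q"
        using le assms(1) by linarith+
      show "i - a (l + 2) * ?Q < n + q l" using le assms(1,2) q_rec[of l] by linarith
    qed
  qed
qed

text \<open>Blocks are refined until their level is \<open>n\<close> or \<open>n - 1\<close>; both
  occur, as a block of level \<open>m\<close> splits into levels \<open>m - 1\<close> and
  \<open>m - 2\<close>.\<close>

lemma tower_decomposition:
  assumes n: "4 \<le> n" and m: "n - 1 \<le> m" and i: "i < q m" and t: "0 \<le> t" "t \<le> sig m"
  shows "\<exists>m'\<in>{n - 1, n}. \<exists>j r. i = j + r \<and> r < q m' \<and> A j t \<le> sig m'"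
  using m i t
proof (induction m arbitrary: i t rule: less_induct)
  case (less m)
  show ?case
  proof (cases "m \<in> {n - 1, n}")
    case True
    then show ?thesis using less.prems by (intro bexI[of _ m] exI[of _ 0] exI[of _ i]) simp_all
  next
    case False
    then obtain l where l: "m = l + 2" "3 \<le> l" "n - 1 \<le> l" using less.prems(1) n that[of "m - 2"] by auto
    have *: ?thesis if "m'' < m" "n - 1 \<le> m''" "i = j0 + r0" "r0 < q m''" "A j0 t \<le> sig m''" for m'' j0 r0
    proof -
      note h = that
      obtain m' j r where "m' \<in> {n - 1, n}" "r0 = j + r" "r < q m'" "A j (A j0 t) \<le> sig m'"
        using less.IH[OF h(1,2,4) _ h(5)] by auto
      then show ?thesis
        using abs_iter_add[of c j j0 t] h(3)
        by (intro bexI[of _ m'] exI[of _ "j + j0"] exI[of _ r]) auto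
    qed
    from less.prems(2) have "0 \<le> i" "i < 0 + q (l + 2)" "(0::nat) \<le> 1" using l by simp_all
    then show ?thesis
    proof (cases rule: block_decomposition)
      case (1 k r)
      then show ?thesis
        using *[of "l + 1" "k * q (l + 1)" r] block_start(1)[of l t k] less.prems l by simp
    next
      case (2 r)
      then show ?thesis
        using *[of l "a (l + 2) * q (l + 1)" r] block_start(2)[of l t] less.prems l by simp
    qed
  qed
qed

text \<open>Time 0 is left out: near the critical point no \<open>K\<close> bounds a length by that
  of its image.\<close>

definition length_bound :: "nat \<Rightarrow> real \<Rightarrow> bool" where
  "length_bound n K \<longleftrightarrow> (\<forall>s\<in>{0..sig n}. \<forall>t\<in>{0..sig n}. \<forall>r\<in>{1..q n}.
     \<bar>(quad c ^^ r) t - (quad c ^^ r) s\<bar> \<le> K * \<bar>(quad c ^^ q n) t - (quad c ^^ q n) s\<bar>)"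

lemma length_bound_mono: "length_bound n K \<Longrightarrow> K \<le> K' \<Longrightarrow> length_bound n K'"
  unfolding length_bound_def by (meson abs_ge_zero mult_right_mono order_trans)

lemma monotone_branch:
  assumes "2 \<le> n"
  shows "monotone_iterate c 0 (e n) (q n)"
proof
  show "(quad c ^^ i) t \<noteq> 0" if "1 \<le> i" "i < q n" "0 < t" "t < e n" for i t
    using nonvanishing[OF assms that(3,4,1,2)] unfolding abs_iter_def by simp
qed (use z_less_e[OF assms] z_pos[of n] assms in simp_all)

lemma sig_less_e: "3 \<le> n \<Longrightarrow> sig n < e n"
proof -
  assume n: "3 \<le> n"
  have n1: "2 \<le> n - 1" "n - 1 + 2 = n + 1" "n - 2 \<le> n - 1" "2 \<le> n" using n by simp_all
  have "A (q n) (sig n) < A (q n) (e n)"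
    using w_less_d[OF n1(1)] d_le[OF n1(3)] sig(3)[OF n] A_e[OF n1(4)] unfolding n1(2) by simp
  then show ?thesis using sig(2)[OF n] by (cases "sig n = e n") auto
qed

text \<open>Compactness at a fixed level: the iterates between times 1 and \<open>q n - 1\<close>
  stay away from 0 on \<open>{0..sig n}\<close> because \<open>sig n < e n\<close>. Such a constant
  starts the recursion at levels 20 and 21.\<close>

lemma ex_length_bound:
  assumes n: "3 \<le> n"
  shows "\<exists>K. length_bound n K"
proof -
  interpret monotone_iterate c 0 "e n" "q n" using monotone_branch n by simp
  have sig_pos: "0 \<le> sig n" using sig(1)[OF n] z_pos[of n] n by simp
  have "\<exists>x>0. \<forall>t\<in>{0..sig n}. x \<le> \<bar>X j t\<bar>" if j: "1 \<le> j" "j < q n" for j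
  proof -
    have "continuous_on {0..sig n} (\<lambda>t. \<bar>X j t\<bar>)"
      using continuous_quad_iter by (intro continuous_intros)
    then obtain u where u: "u \<in> {0..sig n}" "\<forall>t\<in>{0..sig n}. \<bar>X j u\<bar> \<le> \<bar>X j t\<bar>"
      using continuous_attains_inf[of "{0..sig n}" "\<lambda>t. \<bar>X j t\<bar>"] sig_pos by auto
    have "X j u \<noteq> 0"
      using y_pos[of j] nonzero[OF j, of u] u(1) sig_less_e[OF n] j by (cases "u = 0") (auto simp: abs_iter_def)
    then show ?thesis using u by (intro exI[of _ "\<bar>X j u\<bar>"]) simp
  qed
  then obtain x where x: "\<And>j. 1 \<le> j \<Longrightarrow> j < q n \<Longrightarrow> 0 < x j \<and> (\<forall>t\<in>{0..sig n}. x j \<le> \<bar>X j t\<bar>)"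
    by metis
  define \<delta> where "\<delta> = Min (insert 1 (x ` {1..<q n}))"
  have \<delta>: "0 < \<delta>" "\<delta> \<le> 1"
    using x unfolding \<delta>_def by (simp_all add: Min_gr_iff)
  have \<delta>_le: "\<delta> \<le> x j" if "1 \<le> j" "j < q n" for j
    unfolding \<delta>_def using that by (intro Min_le) auto
  have "length_bound n (1 / \<delta> ^ q n)"
    unfolding length_bound_def
  proof (intro ballI)
    fix s t r assume st: "s \<in> {0..sig n}" "t \<in> {0..sig n}" and r: "r \<in> {1..q n}"
    have "\<delta> ^ i * \<bar>X r t - X r s\<bar> \<le> \<bar>X (r + i) t - X (r + i) s\<bar>" if "r + i \<le> q n" for i
      using that
    proof (induction i)
      case (Suc i)
      have ri: "1 \<le> r + i" "r + i < q n" using Suc.prems r by auto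
      have "\<delta> ^ Suc i * \<bar>X r t - X r s\<bar> = (\<delta> ^ i * \<bar>X r t - X r s\<bar>) * \<delta>" by simp
      also have "\<dots> \<le> \<bar>X (r + i) t - X (r + i) s\<bar> * \<bar>X (r + i) t + X (r + i) s\<bar>"
      proof (rule mult_mono)
        have "\<delta> \<le> \<bar>X (r + i) t\<bar>" using \<delta>_le[OF ri] x[OF ri] st by force
        also have "\<dots> \<le> \<bar>X (r + i) t + X (r + i) s\<bar>"
          using abs_add[OF ri(2), of t s] st sig_less_e[OF n] by simp
        finally show "\<delta> \<le> \<bar>X (r + i) t + X (r + i) s\<bar>" .
      qed (use Suc \<delta> in simp_all)
      also have "\<dots> = \<bar>X (r + Suc i) t - X (r + Suc i) s\<bar>"
        using X_Suc_diff[of "r + i" t s] by simp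
      finally show ?case .
    qed simp
    from this[of "q n - r"] r have 1: "\<delta> ^ (q n - r) * \<bar>X r t - X r s\<bar> \<le> \<bar>X (q n) t - X (q n) s\<bar>" by simp
    have "\<delta> ^ q n \<le> \<delta> ^ (q n - r)" using \<delta> by (intro power_decreasing) auto
    then have "\<delta> ^ q n * \<bar>X r t - X r s\<bar> \<le> \<delta> ^ (q n - r) * \<bar>X r t - X r s\<bar>"
      by (rule mult_right_mono) simp
    with 1 show "\<bar>X r t - X r s\<bar> \<le> 1 / \<delta> ^ q n * \<bar>X (q n) t - X (q n) s\<bar>"
      using \<delta>(1) by (simp add: field_simps)
  qed
  then show ?thesis ..
qed

lemma w_half: "22 \<le> n \<Longrightarrow> w (n + 1) \<le> d (n - 2) / 2"
proof -
  assume n: "22 \<le> n"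
  have n1: "3 \<le> n - 1" "n - 1 + 2 = n + 1" "n - 1 - 1 = n - 2" "5 \<le> n - 1" using n by simp_all
  \<comment> \<open>16 is the least value of \<open>n - 6\<close>, and 32 is
    \<open>8 * 2\<^sup>2\<close>, as the factor 1/2 requires.\<close>
  have "(32::real) \<le> 11 * (107 / 100) ^ 16" by (simp add: power_divide)
  also have "\<dots> \<le> 11 * (107 / 100) ^ (n - 1 - 5)"
    using n by (intro mult_left_mono power_increasing) auto
  also have "\<dots> \<le> Z (n - 1)" by (rule Z_exp[OF n1(4)])
  finally have "32 * (w (n + 1))\<^sup>2 \<le> Z (n - 1) * (w (n + 1))\<^sup>2" by (intro mult_right_mono) auto
  also have "\<dots> \<le> 8 * (d (n - 2))\<^sup>2" using w_ratio[OF n1(1)] unfolding n1 .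
  finally have "(w (n + 1))\<^sup>2 \<le> (d (n - 2) / 2)\<^sup>2" by (simp add: power_divide)
  then show ?thesis by (rule power2_le_imp_le) simp
qed

lemma A_le_w: "3 \<le> n \<Longrightarrow> 0 \<le> t \<Longrightarrow> t \<le> sig n \<Longrightarrow> A (q n) t \<le> w (n + 1)"
proof (cases "t \<le> z n")
  case True
  assume n: "3 \<le> n" and t: "0 \<le> t"
  have n1: "n - 1 + 1 = n" "n - 1 + 2 = n + 1" using n by simp_all
  have "d n \<le> w (n + 1)" using d_le_w[of "n - 1"] unfolding n1 .
  then show ?thesis using A_le_d[OF A_dec[of n] t True] n by simp
next
  case False
  assume n: "3 \<le> n" and t: "t \<le> sig n"
  have "A (q n) t \<le> A (q n) (sig n)"
    using sig[OF n] False t n by (intro strict_mono_on_leD[OF A_inc]) auto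
  then show ?thesis using sig(3)[OF n] by simp
qed

lemma cross_ratio_arith:
  fixes m M p r S T x u v w :: real
  assumes m: "0 < m" "m \<le> M" and ST: "0 \<le> p" "p \<le> S" "S < T" "T < r" "S \<le> m"
    and u: "m / 2 \<le> u" and v: "M / 2 \<le> v" and w: "w \<le> 2 * M" and x: "0 \<le> x"
    and main: "(T - S) * (r - p) * (u * v) \<le> (x * w) * ((S - p) * (r - T))"
  shows "T - S \<le> 8 * x"
proof -
  have "(m / 2) * (M / 2) \<le> u * v"
    using m u v by (intro mult_mono) auto
  then have "(T - S) * (r - p) * ((m / 2) * (M / 2)) \<le> (T - S) * (r - p) * (u * v)"
    using ST by (intro mult_left_mono) auto
  also note main
  also have "(x * w) * ((S - p) * (r - T)) \<le> (x * (2 * M)) * (m * (r - p))"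
    using ST m w x by (intro mult_mono mult_left_mono) auto
  finally have "(T - S) * ((r - p) * m * M) \<le> (8 * x) * ((r - p) * m * M)"
    by (simp add: mult_ac)
  then show ?thesis by (rule mult_right_le_imp_le) (use ST m in simp)
qed

text \<open>The remaining time sends the ends of \<open>{p..r}\<close> to distances
  \<open>d (l + 1)\<close> and \<open>d (l - 1)\<close> from 0, and \<open>S\<close>,
  \<open>T\<close> to within \<open>d (l + 1) / 2\<close>. With this space on both sides, expansion
  of the cross-ratio bounds \<open>T - S\<close> by 8 times the final length, whatever
  \<open>k\<close> is.\<close>

lemma block_length:
  assumes l: "19 \<le> l" and st: "s \<in> {0..sig (l + 3)}" "t \<in> {0..sig (l + 3)}"
    and k: "1 \<le> k" "k \<le> a (l + 3)"
  shows "\<bar>(quad c ^^ (k * q (l + 2))) t - (quad c ^^ (k * q (l + 2))) s\<bar> \<le>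
    8 * \<bar>(quad c ^^ q (l + 3)) t - (quad c ^^ q (l + 3)) s\<bar>"
  using st
proof (induction "A (k * q (l + 2)) s" "A (k * q (l + 2)) t" arbitrary: s t rule: linorder_wlog)
  case sym
  then show ?case by (metis abs_minus_commute)
next
  case le
  let ?n = "l + 3" and ?i = "k * q (l + 2)"
  let ?L = "q ?n - ?i"
  define S T where "S = A ?i s" and "T = A ?i t"
  have qn: "q ?n = a ?n * q (l + 2) + q (l + 1)"
    using q_rec[of "l + 1"] by (simp add: eval_nat_numeral)
  have "?i \<le> a ?n * q (l + 2)" using k(2) by simp
  then have i_less: "?i < q ?n" using qn q_pos[of "l + 1"] by linarith
  have 1: "1 \<le> l" using l by simp
  obtain p r where pr: "0 \<le> p" "p < r" "r \<le> z l"
    and mi: "monotone_iterate c p r ?L"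
    and Ap: "A ?L p = d (l + 1)" and Ar: "A ?L r = d (l - 1)"
    and loc: "\<And>t. t \<in> {0..e ?n} \<Longrightarrow> p \<le> A ?i t \<and> A ?i t < r"
    using chain_interval_ends[OF 1 k] by blast
  have ste: "s \<in> {0..e ?n}" "t \<in> {0..e ?n}" using le sig_less_e[of ?n] by auto
  have ST: "p \<le> S" "S \<le> T" "T < r" using loc ste le by (auto simp: S_def T_def)
  have n2: "?n = l + 1 + 2" "l + 1 + 1 = l + 2" by simp_all
  have S_le: "S \<le> d (l + 1)"
    using block_start(3)[of "l + 1" s k] w_less_d[of "l + 1"] le k l unfolding n2 by (simp add: S_def)
  have small: "A (q ?n) u \<le> d (l + 1) / 2" if "u \<in> {0..sig ?n}" for u
  proof -
    have n3: "?n - 2 = l + 1" by simp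
    have "A (q ?n) u \<le> w (?n + 1)" using A_le_w[of ?n u] that by simp
    also have "\<dots> \<le> d (l + 1) / 2" using w_half[of ?n] l unfolding n3 by simp
    finally show ?thesis .
  qed
  have XL: "(quad c ^^ ?L) (A ?i u) = (quad c ^^ q ?n) u" for u
  proof -
    have "(quad c ^^ ?L) (A ?i u) = (quad c ^^ ?L) ((quad c ^^ ?i) u)"
      unfolding abs_iter_def using i_less by (intro quad_iter_abs) simp
    also have "\<dots> = (quad c ^^ (?L + ?i)) u" by (simp add: funpow_add)
    finally show ?thesis using i_less by simp
  qed
  have abs: "\<bar>(quad c ^^ ?L) p\<bar> = d (l + 1)" "\<bar>(quad c ^^ ?L) r\<bar> = d (l - 1)"
    "\<bar>(quad c ^^ ?L) S\<bar> \<le> d (l + 1) / 2" "\<bar>(quad c ^^ ?L) T\<bar> \<le> d (l + 1) / 2"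
    using Ap Ar small[OF le(2)] small[OF le(3)] unfolding S_def T_def XL
    by (simp_all add: abs_iter_def)
  let ?X = "quad c ^^ ?L"
  let ?M = "d (l - 1)" and ?m = "d (l + 1)"
  have mM: "0 < ?m" "?m \<le> ?M" using d_pos d_le[of "l - 1" "l + 1"] by simp_all
  have dist: "?m / 2 \<le> \<bar>?X S - ?X p\<bar>" "?M / 2 \<le> \<bar>?X r - ?X T\<bar>" "\<bar>?X r - ?X p\<bar> \<le> 2 * ?M"
  proof -
    have "?m / 2 \<le> ?m - \<bar>?X S\<bar>" using abs(3) by simp
    also have "\<dots> \<le> \<bar>?X S - ?X p\<bar>"
      using abs_triangle_ineq2_sym[of "?X p" "?X S"] unfolding abs(1) .
    finally show "?m / 2 \<le> \<bar>?X S - ?X p\<bar>" .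
    have "?M / 2 \<le> ?M - \<bar>?X T\<bar>" using abs(4) mM by simp
    also have "\<dots> \<le> \<bar>?X r - ?X T\<bar>"
      using abs_triangle_ineq2[of "?X r" "?X T"] unfolding abs(2) .
    finally show "?M / 2 \<le> \<bar>?X r - ?X T\<bar>" .
    show "\<bar>?X r - ?X p\<bar> \<le> 2 * ?M"
      using abs_triangle_ineq4[of "?X r" "?X p"] mM unfolding abs(1,2) by simp
  qed
  have "T - S \<le> 8 * \<bar>?X T - ?X S\<bar>"
  proof (cases "S = T")
    case False
    interpret monotone_iterate c p r ?L by (rule mi)
    have "(T - S) * (r - p) * (\<bar>?X S - ?X p\<bar> * \<bar>?X r - ?X T\<bar>)
      \<le> (\<bar>?X T - ?X S\<bar> * \<bar>?X r - ?X p\<bar>) * ((S - p) * (r - T))"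
      using cross_ratio_expands[of S T ?L] ST False by simp
    moreover have "S < T" using ST(2) False by simp
    ultimately show ?thesis
      using cross_ratio_arith[OF mM pr(1) ST(1) _ ST(3) S_le dist abs_ge_zero] by blast
  qed simp
  moreover have "\<bar>(quad c ^^ ?i) t - (quad c ^^ ?i) s\<bar> = T - S"
  proof -
    interpret monotone_iterate c 0 "e ?n" "q ?n" by (rule monotone_branch) simp
    show ?thesis
      using sign[OF i_less] ste ST(2) unfolding S_def T_def abs_iter_def by force
  qed
  ultimately show ?case unfolding S_def T_def XL by simp
qed

text \<open>The lower level compares time \<open>r\<close> with the end of its block, and
  \<open>block_length\<close> compares that end with \<open>q (l + 3)\<close>.\<close>

lemma length_bound_step:
  assumes l: "19 \<le> l" and K: "1 \<le> K" "length_bound (l + 1) K" "length_bound (l + 2) K"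
  shows "length_bound (l + 3) (8 * K)"
  unfolding length_bound_def
proof (intro ballI)
  fix s t r assume st: "s \<in> {0..sig (l + 3)}" "t \<in> {0..sig (l + 3)}" and r: "r \<in> {1..q (l + 3)}"
  let ?f = "\<lambda>i u. (quad c ^^ i) u"
  let ?Q = "q (l + 2)"
  have n3: "l + 3 = l + 1 + 2" "l + 2 = l + 1 + 1" by simp_all
  have comp: "?f (j + r0) u = ?f r0 (A j u)" if "1 \<le> r0" for j r0 u
    using quad_iter_abs[of r0 c "?f j u"] that unfolding abs_iter_def by (simp add: add.commute[of j] funpow_add)
  have start: "A (k * ?Q) u \<in> {0..sig (l + 2)}" if "k < a (l + 3)" "u \<in> {0..sig (l + 3)}" for k u
    using block_start(1)[of "l + 1" u k] that l unfolding n3 by simp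
  have start': "A (a (l + 3) * ?Q) u \<in> {0..sig (l + 1)}" if "u \<in> {0..sig (l + 3)}" for u
    using block_start(2)[of "l + 1" u] that l unfolding n3 by simp
  have qn: "q (l + 3) = a (l + 3) * ?Q + q (l + 1)"
    using q_rec[of "l + 1"] by (simp add: eval_nat_numeral)
  have "1 \<le> r" "r < 1 + q (l + 1 + 2)" "(1::nat) \<le> 1" using r unfolding n3 by auto
  then show "\<bar>?f r t - ?f r s\<bar> \<le> 8 * K * \<bar>?f (q (l + 3)) t - ?f (q (l + 3)) s\<bar>"
  proof (cases rule: block_decomposition)
    case (1 k r0)
    have k: "k < a (l + 3)" "r = k * ?Q + r0" "1 \<le> r0" "r0 \<le> ?Q" using 1 by (simp_all add: n3)
    have "\<bar>?f r t - ?f r s\<bar> = \<bar>?f r0 (A (k * ?Q) t) - ?f r0 (A (k * ?Q) s)\<bar>"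
      unfolding k(2) comp[OF k(3)] ..
    also have "\<dots> \<le> K * \<bar>?f ?Q (A (k * ?Q) t) - ?f ?Q (A (k * ?Q) s)\<bar>"
      using K(3) start[OF k(1)] st k unfolding length_bound_def by simp
    also have "\<dots> = K * \<bar>?f (Suc k * ?Q) t - ?f (Suc k * ?Q) s\<bar>"
      using comp[of ?Q "k * ?Q"] q_pos[of "l + 2"] by (simp add: add.commute)
    also have "\<dots> \<le> K * (8 * \<bar>?f (q (l + 3)) t - ?f (q (l + 3)) s\<bar>)"
      using block_length[OF l st, of "Suc k"] k K by (intro mult_left_mono) auto
    finally show ?thesis by simp
  next
    case (2 r0)
    have k: "r = a (l + 3) * ?Q + r0" "1 \<le> r0" "r0 \<le> q (l + 1)" using 2 by (simp_all add: n3)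
    have "\<bar>?f r t - ?f r s\<bar> = \<bar>?f r0 (A (a (l + 3) * ?Q) t) - ?f r0 (A (a (l + 3) * ?Q) s)\<bar>"
      unfolding k(1) comp[OF k(2)] ..
    also have "\<dots> \<le> K * \<bar>?f (q (l + 1)) (A (a (l + 3) * ?Q) t) - ?f (q (l + 1)) (A (a (l + 3) * ?Q) s)\<bar>"
      using K(2) start' st k unfolding length_bound_def by simp
    also have "\<dots> = K * \<bar>?f (q (l + 3)) t - ?f (q (l + 3)) s\<bar>"
      using comp[of "q (l + 1)" "a (l + 3) * ?Q"] q_pos[of "l + 1"] unfolding qn by simp
    also have "\<dots> \<le> 8 * K * \<bar>?f (q (l + 3)) t - ?f (q (l + 3)) s\<bar>"
      using K by (intro mult_right_mono) auto
    finally show ?thesis .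
  qed
qed

lemma length_bounds: "\<exists>B\<ge>1. \<forall>n\<ge>20. length_bound n (B * 8 ^ n)"
proof -
  obtain K1 K2 where K: "length_bound 20 K1" "length_bound 21 K2"
    using ex_length_bound[of 20] ex_length_bound[of 21] by auto
  define B where "B = max 1 (max K1 K2)"
  have B: "1 \<le> B" "K1 \<le> B" "K2 \<le> B" by (auto simp: B_def)
  have "length_bound (l + 20) (B * 8 ^ l) \<and> length_bound (l + 21) (B * 8 ^ l)" for l
  proof (induction l)
    case 0
    then show ?case using K B by (auto intro: length_bound_mono)
  next
    case (Suc l)
    have "1 * 1 \<le> B * 8 ^ l" using B(1) by (intro mult_mono) auto
    then have "length_bound (l + 19 + 3) (8 * (B * 8 ^ l))"
      using Suc by (intro length_bound_step) (simp_all add: eval_nat_numeral)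
    moreover have "length_bound (l + 21) (8 * (B * 8 ^ l))"
      using Suc B by (auto intro: length_bound_mono)
    ultimately show ?case by (simp add: eval_nat_numeral mult.left_commute)
  qed
  then have "length_bound n (B * 8 ^ n)" if "20 \<le> n" for n
  proof -
    have "length_bound n (B * 8 ^ (n - 20))"
      using \<open>\<And>l. length_bound (l + 20) (B * 8 ^ l) \<and> _\<close>[of "n - 20"] that by simp
    moreover have "B * 8 ^ (n - 20) \<le> B * 8 ^ n"
      using B by (intro mult_left_mono power_increasing) auto
    ultimately show ?thesis by (rule length_bound_mono)
  qed
  with B show ?thesis by blast
qed

lemma q_ge: "n \<le> q n"
proof (induction n)
  case (Suc n)
  then show ?case using q_less_Suc[of n] q_pos[of "Suc n"] by (cases n) auto
qed simp

definition pieces :: "nat \<Rightarrow> real set set" where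
  "pieces n = (\<Union>m\<in>{n - 1, n}. (\<lambda>r. (quad c ^^ r) ` {-sig m..sig m}) ` {..<q m})"

lemma pieces_finite: "finite (pieces n)" and pieces_card: "card (pieces n) \<le> 2 * q n"
proof -
  show "finite (pieces n)" by (simp add: pieces_def)
  have "card (pieces n) \<le> (\<Sum>m\<in>{n - 1, n}. card ((\<lambda>r. (quad c ^^ r) ` {-sig m..sig m}) ` {..<q m}))"
    unfolding pieces_def by (intro card_UN_le) simp
  also have "\<dots> \<le> (\<Sum>m\<in>{n - 1, n}. q m)"
    by (intro sum_mono) (use card_image_le[of "{..<q _}"] in auto)
  also have "\<dots> \<le> (\<Sum>m\<in>{n - 1, n}. q n)"
    by (intro sum_mono) (auto intro: q_mono)
  also have "\<dots> \<le> 2 * q n"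
    by (simp add: card_insert_if)
  finally show "card (pieces n) \<le> 2 * q n" .
qed

lemma pieces_cover:
  assumes n: "4 \<le> n"
  shows "closure (range (\<lambda>k. (quad c ^^ k) 0)) \<subseteq> \<Union> (pieces n)"
proof (rule closure_minimal)
  show "closed (\<Union> (pieces n))"
  proof (intro closed_Union pieces_finite ballI)
    fix P assume "P \<in> pieces n"
    then show "closed P"
      unfolding pieces_def
      by (auto intro!: compact_imp_closed compact_continuous_image continuous_quad_iter)
  qed
  show "range (\<lambda>k. (quad c ^^ k) 0) \<subseteq> \<Union> (pieces n)"
  proof (rule image_subsetI)
    fix k :: nat
    define N where "N = max n (k + 1)"
    have k: "k < q N" using q_ge[of N] by (simp add: N_def)
    have N: "n - 1 \<le> N" "3 \<le> N" "1 \<le> N" using n by (simp_all add: N_def)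
    have "0 \<le> sig N" using sig(1)[OF N(2)] z_pos[OF N(3)] by simp
    from tower_decomposition[OF n N(1) k order_refl this]
    obtain m j r where m: "m \<in> {n - 1, n}" "k = j + r" "r < q m" "y j \<le> sig m"
      by blast
    have "(quad c ^^ k) 0 = (quad c ^^ r) ((quad c ^^ j) 0)"
      using m(2) by (simp add: add.commute[of j] funpow_add)
    moreover have "(quad c ^^ j) 0 \<in> {-sig m..sig m}"
      using m(4) by (auto simp: abs_iter_def)
    ultimately show "(quad c ^^ k) 0 \<in> \<Union> (pieces n)"
      using m(1,3) unfolding pieces_def by blast
  qed
qed

lemma pieces_small: "\<exists>B\<ge>1. \<forall>n\<ge>21. \<forall>P\<in>pieces n. bounded P \<and> diameter P \<le> B * 8 ^ n * d (n - 2)"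
proof -
  obtain B where B: "1 \<le> B" and len: "\<And>n. 20 \<le> n \<Longrightarrow> length_bound n (B * 8 ^ n)"
    using length_bounds by blast
  have *: "bounded P \<and> diameter P \<le> 2 * B * 8 ^ n * d (n - 2)" if n: "21 \<le> n" and P: "P \<in> pieces n" for n P
  proof -
    from P obtain m r where m: "m \<in> {n - 1, n}" "r < q m" "P = (quad c ^^ r) ` {-sig m..sig m}"
      unfolding pieces_def by blast
    have m3: "3 \<le> m" "20 \<le> m" "m \<le> n" "n - 2 \<le> m - 1" "2 \<le> m - 1" "m - 1 + 2 = m + 1" using m(1) n by auto
    have B8: "1 * 1 \<le> B * 8 ^ n" "B * 8 ^ m \<le> B * 8 ^ n"
      using B m3 by (intro mult_mono one_le_power mult_left_mono power_increasing; simp)+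
    have dm: "d (m - 1) \<le> d (n - 2)" using d_le[OF m3(4)] .
    have dist: "\<bar>(quad c ^^ r) t - (quad c ^^ r) s\<bar> \<le> 2 * B * 8 ^ n * d (n - 2)"
      if st: "s \<in> {-sig m..sig m}" "t \<in> {-sig m..sig m}" for s t
    proof (cases "r = 0")
      \<comment> \<open>At time 0 the piece is the interval itself, and
        \<open>sig m < d (m - 1)\<close> bounds it.\<close>
      case True
      have "\<bar>t - s\<bar> \<le> 2 * (1 * d (n - 2))" using st sig_less_d[OF m3(1)] dm by auto
      also have "\<dots> \<le> 2 * ((B * 8 ^ n) * d (n - 2))"
        using B8 d_pos[of "n - 2"] by (intro mult_left_mono mult_right_mono) auto
      finally show ?thesis using True by simp
    next
      case False
      have abs: "\<bar>s\<bar> \<in> {0..sig m}" "\<bar>t\<bar> \<in> {0..sig m}" using st by auto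
      have "\<bar>(quad c ^^ r) \<bar>t\<bar> - (quad c ^^ r) \<bar>s\<bar>\<bar>
        \<le> B * 8 ^ m * \<bar>(quad c ^^ q m) \<bar>t\<bar> - (quad c ^^ q m) \<bar>s\<bar>\<bar>"
        using len[OF m3(2)] abs False m(2) unfolding length_bound_def by simp
      also have "\<dots> \<le> (B * 8 ^ n) * (2 * d (n - 2))"
      proof (rule mult_mono)
        have "\<bar>(quad c ^^ q m) \<bar>t\<bar> - (quad c ^^ q m) \<bar>s\<bar>\<bar> \<le> A (q m) \<bar>t\<bar> + A (q m) \<bar>s\<bar>"
          unfolding abs_iter_def by (rule abs_triangle_ineq4)
        also have "\<dots> \<le> 2 * w (m + 1)"
          using A_le_w[OF m3(1), of "\<bar>t\<bar>"] A_le_w[OF m3(1), of "\<bar>s\<bar>"] abs by simp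
        also have "w (m + 1) \<le> d (n - 2)"
          using w_less_d[OF m3(5)] dm unfolding m3(6) by simp
        finally show "\<bar>(quad c ^^ q m) \<bar>t\<bar> - (quad c ^^ q m) \<bar>s\<bar>\<bar> \<le> 2 * d (n - 2)" by simp
      qed (use B8 in auto)
      finally show ?thesis using False by (simp add: quad_iter_abs mult_ac)
    qed
    have "0 \<le> 2 * B * 8 ^ n * d (n - 2)" using B by simp
    then have "diameter P \<le> 2 * B * 8 ^ n * d (n - 2)"
      unfolding m(3) using dist by (intro diameter_le) (auto simp: dist_commute)
    moreover have "bounded P"
      unfolding m(3) by (intro compact_imp_bounded compact_continuous_image continuous_quad_iter) simp
    ultimately show ?thesis by simp
  qed
  show ?thesis
  proof (rule exI, intro conjI allI impI ballI)
    show "1 \<le> 2 * B" using B by simp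
    show "bounded P" if "21 \<le> n" "P \<in> pieces n" for n P
      using *[OF that] by (rule conjunct1)
    show "diameter P \<le> 2 * B * 8 ^ n * d (n - 2)" if "21 \<le> n" "P \<in> pieces n" for n P
      using *[OF that] by (rule conjunct2)
  qed
qed

lemma q_upper:
  assumes "\<And>n. 1 \<le> n \<Longrightarrow> a n \<le> n + C" "1 \<le> n"
  shows "q n \<le> (n + C + 1) ^ n"
  using assms(2)
proof (induction n rule: dec_induct)
  case base
  then show ?case using q_init by simp
next
  case (step n)
  then obtain l where l: "n = l + 1" using that[of "n - 1"] by simp
  have "q (l + 2) \<le> a (l + 2) * q (l + 1) + q (l + 1)"
    using q_rec[of l] q_le_Suc[of l] by simp
  also have "\<dots> = (a (l + 2) + 1) * q (l + 1)" by simp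
  also have "\<dots> \<le> (n + C + 2) * (n + C + 1) ^ n"
    using step.IH assms(1)[of "l + 2"] l by (intro mult_mono) simp_all
  also have "\<dots> \<le> (n + C + 2) * (n + C + 2) ^ n"
    by (intro mult_mono power_mono) simp_all
  finally show ?case using l by simp
qed

end

section \<open>Hausdorff dimension from finite covers\<close>

lemma hausdorff_measure_zeroI:
  fixes S :: "real set"
  assumes s: "0 < s"
    and cover: "\<And>n. n0 \<le> n \<Longrightarrow> finite (F n) \<and> S \<subseteq> \<Union> (F n) \<and> (\<forall>P\<in>F n. bounded P \<and> diameter P \<le> \<delta> n)"
    and \<delta>: "\<delta> \<longlonglongrightarrow> 0" and sum: "(\<lambda>n. real (card (F n)) * \<delta> n powr s) \<longlonglongrightarrow> 0"
  shows "hausdorff_measure s S = 0"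
proof -
  have small: "hausdorff_pre s x S \<le> ennreal \<eta>" if x: "0 < x" and \<eta>: "0 < \<eta>" for x \<eta>
  proof -
    have "eventually (\<lambda>n. n0 \<le> n \<and> \<delta> n < x \<and> real (card (F n)) * \<delta> n powr s < \<eta>) sequentially"
      using eventually_ge_at_top order_tendstoD(2)[OF \<delta> x] order_tendstoD(2)[OF sum \<eta>]
      by eventually_elim auto
    then obtain n where n: "n0 \<le> n" "\<delta> n < x" "real (card (F n)) * \<delta> n powr s < \<eta>"
      by (auto simp: eventually_sequentially)
    have Fn: "finite (F n)" "S \<subseteq> \<Union> (F n)" "\<And>P. P \<in> F n \<Longrightarrow> bounded P \<and> diameter P \<le> \<delta> n"
      using cover[OF n(1)] by auto
    obtain h where h: "bij_betw h {..<card (F n)} (F n)"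
      using ex_bij_betw_nat_finite[OF Fn(1)] by (auto simp: atLeast0LessThan)
    have hF: "h i \<in> F n" if "i < card (F n)" for i
      using h that by (auto simp: bij_betw_def)
    \<comment> \<open>The finite cover is padded with empty sets, which contribute 0.\<close>
    define U where "U i = (if i < card (F n) then h i else {})" for i
    have "hausdorff_pre s x S \<le> (\<Sum>i. ennreal (diameter (U i) powr s))"
      unfolding hausdorff_pre_def
    proof (rule INF_lower, intro CollectI conjI allI)
      show "S \<subseteq> (\<Union>i. U i)"
      proof
        fix u assume "u \<in> S"
        then obtain P where P: "P \<in> F n" "u \<in> P" using Fn(2) by (meson UnionE subsetD)
        then have "P \<in> h ` {..<card (F n)}" using bij_betw_imp_surj_on[OF h] by simp
        then obtain i where "i < card (F n)" "P = h i" by (metis imageE lessThan_iff)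
        then show "u \<in> (\<Union>i. U i)" using P(2) by (intro UN_I[of i]) (simp_all add: U_def)
      qed
      show "bounded (U i)" for i using Fn(3) hF by (simp add: U_def)
      show "diameter (U i) \<le> x" for i
        using Fn(3)[OF hF, of i] n(2) x by (cases "i < card (F n)") (simp_all add: U_def)
    qed
    also have "\<dots> = (\<Sum>i<card (F n). ennreal (diameter (U i) powr s))"
      by (rule suminf_finite) (simp_all add: U_def)
    also have "\<dots> \<le> (\<Sum>i<card (F n). ennreal (\<delta> n powr s))"
      using Fn(3) hF s by (intro sum_mono ennreal_leI powr_mono2) (auto simp: U_def intro: diameter_ge_0)
    also have "\<dots> = ennreal (real (card (F n)) * \<delta> n powr s)"
      by (simp add: ennreal_mult' ennreal_of_nat_eq_real_of_nat)
    also have "\<dots> \<le> ennreal \<eta>" using n(3) by (intro ennreal_leI) simp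
    finally show ?thesis .
  qed
  have "hausdorff_pre s x S \<le> 0" if "0 < x" for x
    by (rule ennreal_le_epsilon) (use small[OF that] in simp)
  then have "hausdorff_measure s S \<le> 0"
    unfolding hausdorff_measure_def by (intro SUP_least) simp
  then show ?thesis by simp
qed

lemma hausdorff_dim_zeroI:
  assumes "\<And>s. 0 < s \<Longrightarrow> hausdorff_measure s S = 0"
  shows "hausdorff_dim S = 0"
proof -
  let ?T = "{s. 0 \<le> s \<and> hausdorff_measure s S = 0}"
  have "Inf ?T \<le> s" if "0 < s" for s
    using assms that by (intro cInf_lower) (auto intro!: bdd_belowI[of _ 0])
  then have "Inf ?T \<le> 0" by (rule field_le_epsilon[of _ 0, simplified])
  moreover have "0 \<le> Inf ?T"
    using assms[of 1] by (intro cInf_greatest) (auto intro: exI[of _ 1])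
  ultimately show ?thesis unfolding hausdorff_dim_def by simp
qed

section \<open>Continued fractions and the rescaled quadratic map\<close>

text \<open>\<open>cf_list\<close> unfolds from the left while convergents extend to the right; with
  a free tail the extension becomes a substitution.\<close>

fun cf_tail :: "nat list \<Rightarrow> rat \<Rightarrow> rat" where
  "cf_tail [] t = t"
| "cf_tail (x # xs) t = 1 / (of_nat x + cf_tail xs t)"

lemma cf_tail_0: "cf_list xs = cf_tail xs 0"
  by (induction xs) simp_all

lemma cf_tail_snoc: "cf_tail (xs @ [x]) t = cf_tail xs (1 / (of_nat x + t))"
  by (induction xs) simp_all

fun conv_num :: "(nat \<Rightarrow> nat) \<Rightarrow> nat \<Rightarrow> nat" where
  "conv_num a 0 = 0"
| "conv_num a (Suc 0) = 1"
| "conv_num a (Suc (Suc n)) = a (Suc (Suc n)) * conv_num a (Suc n) + conv_num a n"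

fun conv_den :: "(nat \<Rightarrow> nat) \<Rightarrow> nat \<Rightarrow> nat" where
  "conv_den a 0 = 1"
| "conv_den a (Suc 0) = a 1"
| "conv_den a (Suc (Suc n)) = a (Suc (Suc n)) * conv_den a (Suc n) + conv_den a n"

lemma conv_den_pos:
  assumes "\<And>i. 1 \<le> i \<Longrightarrow> 1 \<le> a i"
  shows "0 < conv_den a n"
proof -
  have "0 < conv_den a n \<and> 0 < conv_den a (Suc n)"
    using assms[of 1] by (induction n) auto
  then show ?thesis ..
qed

lemma conv_det:
  "int (conv_num a (Suc n)) * int (conv_den a n) - int (conv_num a n) * int (conv_den a (Suc n)) = (-1) ^ n"
  by (induction n) (simp_all add: algebra_simps)

lemma cf_tail_conv:
  assumes a: "\<And>i. 1 \<le> i \<Longrightarrow> 1 \<le> a i" and t: "0 \<le> t"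
  shows "cf_tail (map a [1..<Suc (Suc n)]) t =
    (of_nat (conv_num a (Suc n)) + t * of_nat (conv_num a n)) /
    (of_nat (conv_den a (Suc n)) + t * of_nat (conv_den a n))"
  using t
proof (induction n arbitrary: t)
  case 0
  then show ?case by simp
next
  case (Suc n)
  let ?x = "of_nat (a (Suc (Suc n))) + t :: rat"
  have x: "0 < ?x" using a[of "Suc (Suc n)"] Suc.prems by (intro add_pos_nonneg) auto
  have "map a [1..<Suc (Suc (Suc n))] = map a [1..<Suc (Suc n)] @ [a (Suc (Suc n))]" by simp
  then have "cf_tail (map a [1..<Suc (Suc (Suc n))]) t = cf_tail (map a [1..<Suc (Suc n)]) (1 / ?x)"
    by (simp only: cf_tail_snoc)
  also have "\<dots> = (of_nat (conv_num a (Suc n)) + 1 / ?x * of_nat (conv_num a n)) /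
    (of_nat (conv_den a (Suc n)) + 1 / ?x * of_nat (conv_den a n))"
    using x by (intro Suc.IH) simp
  also have "\<dots> = (?x * (of_nat (conv_num a (Suc n)) + 1 / ?x * of_nat (conv_num a n))) /
    (?x * (of_nat (conv_den a (Suc n)) + 1 / ?x * of_nat (conv_den a n)))"
    using x by simp
  also have "\<dots> = (?x * of_nat (conv_num a (Suc n)) + of_nat (conv_num a n)) /
    (?x * of_nat (conv_den a (Suc n)) + of_nat (conv_den a n))"
  proof -
    have "?x * (u + 1 / ?x * v) = ?x * u + v" for u v :: rat
      using x by (simp add: distrib_left)
    then show ?thesis by simp
  qed
  also have "\<dots> = (of_nat (conv_num a (Suc (Suc n))) + t * of_nat (conv_num a (Suc n))) /
    (of_nat (conv_den a (Suc (Suc n))) + t * of_nat (conv_den a (Suc n)))"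
    by (simp add: algebra_simps)
  finally show ?case .
qed

text \<open>By the determinant identity the fraction is reduced, so \<open>quotient_of\<close>
  returns exactly this denominator.\<close>

lemma cf_q_eq_conv_den:
  assumes a: "\<And>i. 1 \<le> i \<Longrightarrow> 1 \<le> a i"
  shows "cf_q a n = conv_den a n"
proof (cases n)
  case 0
  then show ?thesis by (simp add: cf_q_def)
next
  case (Suc m)
  have pos: "0 < conv_den a n" by (rule conv_den_pos) (rule a)
  have "coprime (int (conv_num a n)) (int (conv_den a n))"
  proof (rule coprimeI)
    fix x assume "x dvd int (conv_num a n)" "x dvd int (conv_den a n)"
    then have "x dvd (-1) ^ m"
      unfolding Suc conv_det[of a m, symmetric] by (simp add: dvd_diff dvd_mult dvd_mult2)
    then show "is_unit x" by (cases "even m") simp_all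
  qed
  moreover have "cf_list (map a [1..<Suc n]) = Fract (int (conv_num a n)) (int (conv_den a n))"
  proof -
    have "cf_tail (map a [1..<Suc (Suc m)]) 0 =
      (of_nat (conv_num a (Suc m)) + 0 * of_nat (conv_num a m)) /
      (of_nat (conv_den a (Suc m)) + 0 * of_nat (conv_den a m))"
      by (rule cf_tail_conv) (use a in simp_all)
    then show ?thesis by (simp add: Suc cf_tail_0 Fract_of_int_quotient del: upt_Suc)
  qed
  ultimately show ?thesis
    using pos by (simp add: cf_q_def quotient_of_Fract normalize_stable)
qed

text \<open>A first quotient of at least 2 would keep all these convergents at most 1/2. Inversion
  then gives the shifted expansion, that is, the Gauss map.\<close>

lemma cf_first_one:
  fixes \<theta> :: real
  assumes a: "\<And>i. 1 \<le> i \<Longrightarrow> 1 \<le> b i"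
    and lim: "(\<lambda>n. real_of_rat (cf_list (map b [1..<Suc n]))) \<longlonglongrightarrow> \<theta>"
    and \<theta>: "1 / 2 < \<theta>"
  shows "b 1 = 1" and "(\<lambda>n. real_of_rat (cf_list (map (\<lambda>i. b (Suc i)) [1..<Suc n]))) \<longlonglongrightarrow> 1 / \<theta> - 1"
proof -
  let ?s = "\<lambda>n. real_of_rat (cf_list (map (\<lambda>i. b (Suc i)) [1..<Suc n]))"
  have nonneg: "0 \<le> cf_list xs" for xs by (induction xs) simp_all
  have "map b [1..<Suc (Suc n)] = b 1 # map (\<lambda>i. b (Suc i)) [1..<Suc n]" for n
    by (simp add: upt_conv_Cons map_Suc_upt[symmetric] del: upt_Suc map_Suc_upt)
  then have eq: "real_of_rat (cf_list (map b [1..<Suc (Suc n)])) = 1 / (real (b 1) + ?s n)" for n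
    by (simp add: of_rat_divide of_rat_add)
  have lim': "(\<lambda>n. 1 / (real (b 1) + ?s n)) \<longlonglongrightarrow> \<theta>"
    using LIMSEQ_Suc[OF lim] unfolding eq .
  show b1: "b 1 = 1"
  proof (rule ccontr)
    assume "b 1 \<noteq> 1"
    then have "2 \<le> b 1" using a[of 1] by simp
    then have "2 \<le> real (b 1) + ?s n" for n
      using nonneg by (simp add: add_increasing2)
    then have "1 / (real (b 1) + ?s n) \<le> 1 / 2" for n
      by (intro frac_le) simp_all
    then have "\<theta> \<le> 1 / 2" using LIMSEQ_le_const2[OF lim'] by blast
    then show False using \<theta> by simp
  qed
  have "(\<lambda>n. 1 / (1 / (real (b 1) + ?s n)) - 1) \<longlonglongrightarrow> 1 / \<theta> - 1"
    using \<theta> by (intro tendsto_diff tendsto_divide tendsto_const lim') simp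
  then show "?s \<longlonglongrightarrow> 1 / \<theta> - 1" using b1 by simp
qed

text \<open>
  Without a fixed point, or beyond the largest one, every step of the orbit increases it by a
  definite amount.
\<close>

lemma increasing_orbit_unbounded:
  fixes x :: "nat \<Rightarrow> real"
  assumes step: "\<And>k. n \<le> k \<Longrightarrow> x k + \<epsilon> \<le> x (Suc k)" and \<epsilon>: "0 < \<epsilon>"
  shows "\<not> bounded (range x)"
proof
  assume "bounded (range x)"
  then obtain B where B: "\<And>k. x k \<le> B" by (auto simp: bounded_iff abs_le_iff)
  have lower: "x n + real j * \<epsilon> \<le> x (n + j)" for j
  proof (induction j)
    case (Suc j)
    then show ?case using step[of "n + j"] by (simp add: algebra_simps)
  qed simp
  obtain j :: nat where "(B - x n) / \<epsilon> < real j" using reals_Archimedean2 by blast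
  then have "B - x n < real j * \<epsilon>" using \<epsilon> by (simp add: pos_divide_less_eq)
  then show False using lower[of j] B[of "n + j"] by simp
qed

lemma bounded_orbit:
  fixes c :: real
  assumes bounded: "bounded (range (\<lambda>k. (quad c ^^ k) 0))"
  shows "quad c (qbeta c) = qbeta c" "0 < qbeta c" "\<bar>(quad c ^^ k) 0\<bar> \<le> qbeta c"
proof -
  have c: "c \<le> 1 / 4"
  proof (rule ccontr)
    assume c: "\<not> c \<le> 1 / 4"
    have "x + (c - 1 / 4) \<le> quad c x" for x
      using zero_le_power2[of "x - 1 / 2"] by (simp add: quad_def power2_eq_square algebra_simps)
    then show False
      using increasing_orbit_unbounded[of 0 "\<lambda>k. (quad c ^^ k) 0" "c - 1 / 4"] c bounded by simp
  qed
  define b where "b = (1 + sqrt (1 - 4 * c)) / 2"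
  define b' where "b' = (1 - sqrt (1 - 4 * c)) / 2"
  have fact: "quad c x - x = (x - b) * (x - b')" for x
  proof -
    have "(sqrt (1 - 4 * c))\<^sup>2 = 1 - 4 * c" using c by simp
    then show ?thesis by (simp add: quad_def b_def b'_def power2_eq_square field_simps)
  qed
  have b: "b' \<le> b" "0 < b" using c by (auto simp: b_def b'_def add_pos_nonneg)
  have "{x. quad c x = x} = {b, b'}"
    using fact by (auto simp: eq_iff_diff_eq_0[of "quad c _"])
  then have qb: "qbeta c = b" using b by (simp add: qbeta_def)
  then show "quad c (qbeta c) = qbeta c" "0 < qbeta c" using fact[of b] b by simp_all
  show "\<bar>(quad c ^^ k) 0\<bar> \<le> qbeta c"
  proof (rule ccontr)
    let ?x = "\<lambda>k. (quad c ^^ k) 0"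
    assume "\<not> \<bar>?x k\<bar> \<le> qbeta c"
    then have k: "b < \<bar>?x k\<bar>" by (simp add: qb)
    have up: "t + (t - b) * (t - b') \<le> quad c t" for t using fact[of t] by simp
    \<comment> \<open>The gain at the escaping point bounds the gain at every larger point, as both
      factors increase.\<close>
    define \<epsilon> where "\<epsilon> = (\<bar>?x k\<bar> - b) * (\<bar>?x k\<bar> - b')"
    have \<epsilon>: "0 < \<epsilon>" using k b by (simp add: \<epsilon>_def)
    have step: "\<bar>?x k\<bar> \<le> t \<Longrightarrow> t + \<epsilon> \<le> quad c t" for t
    proof -
      assume t: "\<bar>?x k\<bar> \<le> t"
      have "\<epsilon> \<le> (t - b) * (t - b')" unfolding \<epsilon>_def using t k b by (intro mult_mono) auto
      then show ?thesis using up[of t] by simp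
    qed
    have ge: "\<bar>?x k\<bar> \<le> ?x (Suc k + j)" for j
    proof (induction j)
      case 0
      have "?x (Suc k + 0) = quad c \<bar>?x k\<bar>" by (simp add: quad_def)
      then show ?case using step[of "\<bar>?x k\<bar>"] \<epsilon> by simp
    next
      case (Suc j)
      then show ?case using step[OF Suc] \<epsilon> by simp
    qed
    have "\<not> bounded (range ?x)"
    proof (rule increasing_orbit_unbounded[OF _ \<epsilon>])
      fix i assume "Suc k \<le> i"
      then show "?x i + \<epsilon> \<le> ?x (Suc i)" using step[OF ge[of "i - Suc k"]] by simp
    qed
    then show False using bounded by simp
  qed
qed

section \<open>Recurrence of the rescaled map in terms of absolute values\<close>

lemma quad_unimodal_iter:
  assumes "0 < qbeta c"
  shows "(quad_unimodal c ^^ k) t = (quad c ^^ k) (qbeta c * t) / qbeta c"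
  using assms by (induction k) (simp_all add: quad_unimodal_def)

lemma quad_unimodal_less_iff:
  assumes "0 < qbeta c"
  shows "quad_unimodal c s < quad_unimodal c t \<longleftrightarrow> \<bar>s\<bar> < \<bar>t\<bar>"
proof -
  have "quad_unimodal c s < quad_unimodal c t \<longleftrightarrow> (qbeta c * s)\<^sup>2 < (qbeta c * t)\<^sup>2"
    using assms by (simp add: quad_unimodal_def quad_def divide_less_cancel)
  also have "\<dots> \<longleftrightarrow> \<bar>qbeta c * s\<bar> < \<bar>qbeta c * t\<bar>"
    by (simp add: abs_le_square_iff[symmetric] not_le[symmetric])
  finally show ?thesis using assms by (simp add: abs_mult)
qed

lemma quad_unimodal_Ival:
  assumes \<beta>: "0 < qbeta c" and x: "\<bar>x\<bar> \<le> 1"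
  shows "t \<notin> Ival (quad_unimodal c) x \<longleftrightarrow> \<bar>x\<bar> < \<bar>t\<bar>"
proof -
  have "uprime (quad_unimodal c) x = -x"
  proof (cases "x = 0")
    case False
    have eq: "quad_unimodal c s = quad_unimodal c x \<longleftrightarrow> \<bar>s\<bar> = \<bar>x\<bar>" for s
      using quad_unimodal_less_iff[OF \<beta>, of s x] quad_unimodal_less_iff[OF \<beta>, of x s] by linarith
    have "(THE s. s \<in> {-1..1} \<and> s \<noteq> x \<and> quad_unimodal c s = quad_unimodal c x) = -x"
      unfolding eq using False x by (intro the_equality) auto
    then show ?thesis using False by (simp add: uprime_def)
  qed (simp add: uprime_def)
  then show ?thesis by (auto simp: Ival_def)
qed

lemma dimension_zero:
  assumes "rotation_recurrence c \<beta> a q R" and a: "\<And>n. 1 \<le> n \<Longrightarrow> a n \<le> n + C"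
  shows "hausdorff_dim (closure (range (\<lambda>k. (quad c ^^ k) 0))) = 0"
proof -
  interpret rotation_recurrence c \<beta> a q R by (rule assms(1))
  obtain B where B: "1 \<le> B"
    and small: "\<And>n P. 21 \<le> n \<Longrightarrow> P \<in> pieces n \<Longrightarrow> bounded P \<and> diameter P \<le> B * 8 ^ n * d (n - 2)"
    using pieces_small by blast
  define L where "L = ln (103 / 100 :: real)"
  have L: "0 < L" by (simp add: L_def)
  \<comment> \<open>The bound \<open>d_decay\<close> at \<open>n - 2\<close>, as a single
    exponential. Its quadratic exponent, even times a small \<open>s\<close>, outweighs
    \<open>n * ln 8\<close> and the \<open>n * ln n\<close> of the number of pieces.\<close>
  define \<delta> where
    "\<delta> n = exp (ln (2 * B) + real n * ln 8 - (real n - 2) * (real n - 12) / 4 * L)" for n :: nat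
  show ?thesis
  proof (rule hausdorff_dim_zeroI, rule hausdorff_measure_zeroI)
    fix n :: nat assume n: "21 \<le> n"
    have "d (n - 2) \<le> 2 * (103 / 100) powr (- (real (n - 2) * (real (n - 2) - 10) / 4))"
      by (rule d_decay)
    also have "\<dots> = 2 * exp (- ((real n - 2) * (real n - 12) / 4 * L))"
      using n by (simp add: powr_def L_def of_nat_diff)
    finally have "B * 8 ^ n * d (n - 2) \<le> B * 8 ^ n * (2 * exp (- ((real n - 2) * (real n - 12) / 4 * L)))"
      using B by (intro mult_left_mono) auto
    also have "\<dots> = \<delta> n"
    proof -
      have "\<delta> n = exp (ln (2 * B)) * exp (real n * ln 8) * exp (- ((real n - 2) * (real n - 12) / 4 * L))"
        by (simp add: \<delta>_def flip: exp_add)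
      then show ?thesis using B by (simp add: exp_of_nat_mult)
    qed
    finally have le: "B * 8 ^ n * d (n - 2) \<le> \<delta> n" .
    show "finite (pieces n) \<and> closure (range (\<lambda>k. (quad c ^^ k) 0)) \<subseteq> \<Union> (pieces n) \<and>
        (\<forall>P\<in>pieces n. bounded P \<and> diameter P \<le> \<delta> n)"
    proof (intro conjI ballI)
      show "finite (pieces n)" by (rule pieces_finite)
      show "closure (range (\<lambda>k. (quad c ^^ k) 0)) \<subseteq> \<Union> (pieces n)" using n by (intro pieces_cover) simp
      fix P assume "P \<in> pieces n"
      from small[OF n this] le show "bounded P" "diameter P \<le> \<delta> n" by linarith+
    qed
  next
    show "\<delta> \<longlonglongrightarrow> 0" unfolding \<delta>_def using L by real_asymp
  next
    fix s :: real assume s: "0 < s"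
    show "(\<lambda>n. real (card (pieces n)) * \<delta> n powr s) \<longlonglongrightarrow> 0"
    proof (rule Lim_null_comparison)
      show "(\<lambda>n. 2 * exp (real n * ln (real n + real C + 1)) *
          exp (s * (ln (2 * B) + real n * ln 8 - (real n - 2) * (real n - 12) / 4 * L))) \<longlonglongrightarrow> 0"
        using s L by real_asymp
      have "norm (real (card (pieces n)) * \<delta> n powr s) \<le> 2 * exp (real n * ln (real n + real C + 1)) *
          exp (s * (ln (2 * B) + real n * ln 8 - (real n - 2) * (real n - 12) / 4 * L))" if "1 \<le> n" for n
      proof -
        have "q n \<le> (n + C + 1) ^ n" by (rule q_upper) (use a that in auto)
        then have "real (card (pieces n)) \<le> real (2 * (n + C + 1) ^ n)"
          using pieces_card[of n] by (simp only: of_nat_le_iff)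
        also have "\<dots> = 2 * exp (real n * ln (real n + real C + 1))"
          by (simp add: exp_of_nat_mult add_nonneg_pos add_ac)
        finally show ?thesis
          by (simp add: \<delta>_def powr_def abs_mult mult_right_mono)
      qed
      then show "\<forall>\<^sub>F n in sequentially. norm (real (card (pieces n)) * \<delta> n powr s) \<le>
          2 * exp (real n * ln (real n + real C + 1)) *
          exp (s * (ln (2 * B) + real n * ln 8 - (real n - 2) * (real n - 12) / 4 * L))"
        by (intro eventually_sequentiallyI[of 1]) simp
    qed
  qed simp
qed

text \<open>The Gauss map sends (3/5, 2/3) into (1/2, 2/3) and that into (1/2, 1), so three
  successive values exceed 1/2.\<close>

lemma unit_partial_quotients:
  assumes a: "is_cf_expansion \<theta> a" and \<theta>: "3 / 5 < \<theta>" "\<theta> < 2 / 3"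
  shows "a 1 = 1" "a 2 = 1" "a 3 = 1"
proof -
  have pos: "\<And>i. 1 \<le> i \<Longrightarrow> 1 \<le> a i"
    and lim: "(\<lambda>n. real_of_rat (cf_list (map a [1..<Suc n]))) \<longlonglongrightarrow> \<theta>"
    using a by (auto simp: is_cf_expansion_def)
  show "a 1 = 1" by (rule cf_first_one[OF _ lim]) (use pos \<theta> in auto)
  let ?\<theta>1 = "1 / \<theta> - 1"
  have lim1: "(\<lambda>n. real_of_rat (cf_list (map (\<lambda>i. a (Suc i)) [1..<Suc n]))) \<longlonglongrightarrow> ?\<theta>1"
    by (rule cf_first_one[OF _ lim]) (use pos \<theta> in auto)
  have \<theta>1: "1 / 2 < ?\<theta>1" "?\<theta>1 < 2 / 3" using \<theta> by (simp_all add: field_simps)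
  have "a (Suc 1) = 1" by (rule cf_first_one[OF _ lim1]) (use pos \<theta>1 in auto)
  then show "a 2 = 1" by (simp add: numeral_2_eq_2)
  let ?\<theta>2 = "1 / ?\<theta>1 - 1"
  have lim2: "(\<lambda>n. real_of_rat (cf_list (map (\<lambda>i. a (Suc (Suc i))) [1..<Suc n]))) \<longlonglongrightarrow> ?\<theta>2"
    by (rule cf_first_one[OF _ lim1]) (use pos \<theta>1 in auto)
  have "3 / 2 < 1 / ?\<theta>1" using \<theta>1 by (simp only: less_divide_eq) auto
  then have "1 / 2 < ?\<theta>2" by simp
  then have "a (Suc (Suc 1)) = 1" by (intro cf_first_one[OF _ lim2]) (use pos in auto)
  then show "a 3 = 1" by (simp add: numeral_3_eq_3)
qed

text \<open>The maximum of \<open>a\<close> up to \<open>n\<close> is first attained at a record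
  \<open>N \<le> n\<close>. The gap before a late record yields \<open>a N < 2^(a N) < N\<close>;
  the finitely many early records are absorbed in the constant.\<close>

lemma linear_partial_quotients:
  assumes pos: "\<And>i. 1 \<le> i \<Longrightarrow> 1 \<le> a i" and unb: "unbounded_type a" and \<tau>: "0 < \<tau>"
    and gap: "\<And>k. K \<le> k \<Longrightarrow> real (record_index a (Suc k)) - real (record_index a k)
      > 2 powr ((5 + \<tau>) * real (a (record_index a (Suc k))))"
  shows "\<exists>C. \<forall>n\<ge>1. a n \<le> n + C"
proof (intro exI allI impI)
  fix n :: nat assume n: "1 \<le> n"
  define M where "M = Max (a ` {1..n})"
  define N where "N = (LEAST i. 1 \<le> i \<and> a i = M)"
  have "M \<in> a ` {1..n}" unfolding M_def using n by (intro Max_in) auto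
  then obtain i where i: "1 \<le> i" "i \<le> n" "a i = M" by auto
  have N: "1 \<le> N" "a N = M" using LeastI[of "\<lambda>i. 1 \<le> i \<and> a i = M" i] i by (auto simp: N_def)
  have Nn: "N \<le> n" using Least_le[of "\<lambda>i. 1 \<le> i \<and> a i = M" i] i by (simp add: N_def)
  have "a j < a N" if "j \<in> {1..<N}" for j
  proof -
    have "a j \<le> M" unfolding M_def using that Nn by (intro Max_ge) auto
    moreover have "a j \<noteq> M" using not_less_Least[of j "\<lambda>i. 1 \<le> i \<and> a i = M"] that by (auto simp: N_def)
    ultimately show ?thesis using N by simp
  qed
  then have "N \<in> record_set a" using N by (simp add: record_set_def)
  \<comment> \<open>Infinitude lets \<open>enumerate\<close> reach every record.\<close>
  moreover have inf: "infinite (record_set a)"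
  proof
    assume fin: "finite (record_set a)"
    define m where "m = Max (a ` insert 1 (record_set a))"
    have "\<not> bdd_above (a ` {1..})" using unb by (simp add: unbounded_type_def)
    then obtain i where "1 \<le> i \<and> m < a i"
      by (auto simp: bdd_above_def not_le)
    define r where "r = (LEAST i. 1 \<le> i \<and> m < a i)"
    have r: "1 \<le> r" "m < a r"
      using LeastI[of "\<lambda>i. 1 \<le> i \<and> m < a i", OF \<open>1 \<le> i \<and> m < a i\<close>] by (auto simp: r_def)
    have "a j < a r" if "j \<in> {1..<r}" for j
      using not_less_Least[of j "\<lambda>i. 1 \<le> i \<and> m < a i"] that r by (auto simp: r_def)
    then have "r \<in> record_set a" using r by (simp add: record_set_def)
    then have "a r \<le> m" unfolding m_def using fin by (intro Max_ge) auto
    then show False using r by simp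
  qed
  ultimately obtain k where k: "record_index a k = N"
    unfolding record_index_def using enumerate_Ex by blast
  have "a n \<le> a N" using N n unfolding M_def by (auto intro!: Max_ge)
  also have "a N \<le> n + (\<Sum>j\<le>K. a (record_index a j))"
  proof (cases "k \<le> K")
    case True
    then have "a (record_index a k) \<le> (\<Sum>j\<le>K. a (record_index a j))"
      by (intro member_le_sum) auto
    then show ?thesis using k by simp
  next
    case False
    then obtain k' where k': "k = Suc k'" "K \<le> k'" by (cases k) auto
    have "real (a N) < 2 ^ a N" by (rule of_nat_less_two_power)
    also have "\<dots> = 2 powr real (a N)" by (simp add: powr_realpow)
    also have "\<dots> \<le> 2 powr ((5 + \<tau>) * real (a N))"
    proof -
      have "1 * real (a N) \<le> (5 + \<tau>) * real (a N)" using \<tau> by (intro mult_right_mono) auto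
      then show ?thesis by (intro powr_mono) simp_all
    qed
    also have "\<dots> < real N" using gap[OF k'(2)] k k'(1) by simp
    finally show ?thesis using Nn by simp
  qed
  finally show "a n \<le> n + (\<Sum>j\<le>K. a (record_index a j))" .
qed

lemma rotation_recurrence_quad:
  assumes a: "\<And>i. 1 \<le> i \<Longrightarrow> 1 \<le> a i" "a 1 = 1" "a 2 = 1" "a 3 = 1"
    and bounded: "bounded (range (\<lambda>k. (quad c ^^ k) 0))"
    and rec: "theta_recurrent (quad_unimodal c) a"
  shows "rotation_recurrence c (qbeta c) a (cf_q a)
    (\<lambda>n i. has_cf_rec (quad_unimodal c) a n ((quad_unimodal c ^^ i) 0))"
proof -
  let ?g = "quad_unimodal c" and ?q = "cf_q a"
  let ?x = "\<lambda>i. (?g ^^ i) 0"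
  note \<beta> = bounded_orbit[OF bounded]
  have q: "?q n = conv_den a n" for n using cf_q_eq_conv_den[of a n] a(1) by simp
  have q_pos: "0 < ?q n" for n unfolding q by (rule conv_den_pos) (rule a(1))
  have q_Suc: "?q n \<le> ?q (Suc n)" for n
  proof (cases n)
    case (Suc m)
    have "?q n \<le> a (Suc n) * ?q n" using a(1)[of "Suc n"] by simp
    moreover have "?q (Suc n) = a (Suc n) * ?q n + ?q m" using Suc by (simp add: q)
    ultimately show ?thesis by linarith
  qed (use a(2) in \<open>simp add: q\<close>)
  have q_mono: "m \<le> n \<Longrightarrow> ?q m \<le> ?q n" for m n
    using lift_Suc_mono_le[of ?q, OF q_Suc] by simp
  have x: "?x i = (quad c ^^ i) 0 / qbeta c" for i
    using quad_unimodal_iter[OF \<beta>(2), of i 0] by simp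
  have y: "abs_iter c i 0 = qbeta c * \<bar>?x i\<bar>" for i
    using \<beta>(2) by (simp add: x abs_iter_def)
  have less: "abs_iter c i 0 < abs_iter c j 0 \<longleftrightarrow> \<bar>?x i\<bar> < \<bar>?x j\<bar>" for i j
    using \<beta>(2) by (simp add: y)
  have x1: "\<bar>?x i\<bar> \<le> 1" for i
    using \<beta>(2,3) by (simp add: x)
  have shift: "(?g ^^ k) (?x i) = ?x (i + k)" for i k
    by (simp add: funpow_add add.commute[of i])
  have closest: "closest_rec ?g (?x i) k \<longleftrightarrow> 1 \<le> k \<and> (\<forall>j. 0 < j \<and> j < k \<longrightarrow> abs_iter c (i + k) 0 < abs_iter c (i + j) 0)" for i k
    unfolding closest_rec_def shift quad_unimodal_less_iff[OF \<beta>(2)] less ..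
  have Suc_rec: "(\<forall>k\<in>{1..?q n}. abs_iter c i 0 < abs_iter c (i + k) 0) \<and>
      {k \<in> {1..?q n}. closest_rec ?g (?x i) k} = ?q ` {1..n} \<and>
      (\<forall>m<a n. has_cf_rec ?g a (n - 1) (?x (i + m * ?q (n - 1))))"
    if "has_cf_rec ?g a n (?x i)" "1 \<le> n" for n i
  proof -
    obtain l where l: "n = Suc l" using \<open>1 \<le> n\<close> by (cases n) auto
    show ?thesis
      using that(1) unfolding l has_cf_rec.simps shift quad_unimodal_Ival[OF \<beta>(2) x1] less
      by (simp del: has_cf_rec.simps)
  qed
  have is_closest: "closest_rec ?g (?x i) (?q m)" if "has_cf_rec ?g a n (?x i)" "1 \<le> m" "m \<le> n" for n m i
  proof -
    have "1 \<le> n" using that by simp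
    from Suc_rec[OF that(1) this] have "{k \<in> {1..?q n}. closest_rec ?g (?x i) k} = ?q ` {1..n}" by blast
    moreover have "?q m \<in> ?q ` {1..n}" using that by simp
    ultimately show ?thesis by blast
  qed
  show ?thesis
  proof
    show "quad c (qbeta c) = qbeta c" "0 < qbeta c" by (rule \<beta>)+
    show "abs_iter c k 0 \<le> qbeta c" for k using \<beta>(3) by (simp add: abs_iter_def)
    show "1 \<le> n \<Longrightarrow> 1 \<le> a n" for n by (rule a(1))
    show "a 1 = 1" "a 2 = 1" "a 3 = 1" by (rule a)+
    show "?q 0 = 1" "?q 1 = 1" using a(2) by (simp_all add: q)
    show "?q (n + 2) = a (n + 2) * ?q (n + 1) + ?q n" for n by (simp add: q)
    show "has_cf_rec ?g a n (?x 0)" if "1 \<le> n" for n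
      using rec that by (simp add: theta_recurrent_def)
    show "abs_iter c i 0 < abs_iter c (i + k) 0"
      if "has_cf_rec ?g a n (?x i)" "1 \<le> k" "k \<le> ?q n" "1 \<le> n" for n i k
      using Suc_rec[OF that(1,4)] that(2,3) by simp
    show "abs_iter c (i + ?q m) 0 < abs_iter c (i + k) 0"
      if "has_cf_rec ?g a n (?x i)" "1 \<le> m" "m \<le> n" "0 < k" "k < ?q m" for n i m k
      using is_closest[OF that(1-3)] that(4,5) unfolding closest by blast
    show "abs_iter c (i + ?q m) 0 \<le> abs_iter c (i + k) 0"
      if R: "has_cf_rec ?g a n (?x i)" and m: "1 \<le> m" "m < n" and k: "?q m < k" "k < ?q (m + 1)" for n i m k
    proof -
      have n1: "1 \<le> n" using m by simp
      \<comment> \<open>If \<open>k\<close> is not a time of closest recurrence, an earlier time is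
        at least as close; the descent ends at some \<open>q m'\<close> with
        \<open>m' \<le> m\<close>.\<close>
      have "1 \<le> k \<Longrightarrow> k < ?q (m + 1) \<Longrightarrow> abs_iter c (i + ?q m) 0 \<le> abs_iter c (i + k) 0" for k
      proof (induction k rule: less_induct)
        case (less k)
        show ?case
        proof (cases "closest_rec ?g (?x i) k")
          case True
          have "k \<le> ?q n" using less.prems q_mono[of "m + 1" n] m by simp
          then have "k \<in> ?q ` {1..n}" using Suc_rec[OF R n1] True less.prems by auto
          then obtain m' where m': "k = ?q m'" "1 \<le> m'" by auto
          have "m' \<le> m" using q_mono[of "m + 1" m'] m' less.prems by (cases "m' \<le> m") auto
          show ?thesis
          proof (cases "?q m' = ?q m")
            case False
            then have "?q m' < ?q m" using q_mono[OF \<open>m' \<le> m\<close>] by simp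
            then show ?thesis
              using is_closest[OF R, of m] m q_pos[of m'] unfolding closest m'(1)
              by (auto intro: less_imp_le)
          qed (simp add: m'(1))
        next
          case False
          then obtain j where j: "0 < j" "j < k" "abs_iter c (i + j) 0 \<le> abs_iter c (i + k) 0"
            using less.prems(1) unfolding closest by (auto simp: not_less)
          have "abs_iter c (i + ?q m) 0 \<le> abs_iter c (i + j) 0"
            using less.IH[of j] j less.prems by simp
          then show ?thesis using j(3) by simp
        qed
      qed
      then show ?thesis using k by simp
    qed
    show "has_cf_rec ?g a n (?x (i + m * ?q n))" if "has_cf_rec ?g a (Suc n) (?x i)" "m < a (Suc n)" for n i m
      using Suc_rec[OF that(1)] that(2) by simp
  qed
qed

theorem theorem1p3:
  fixes \<theta> c :: real and a :: "nat \<Rightarrow> nat"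
  assumes "\<theta> \<notin> \<rat>" and "3/5 < \<theta>" and "\<theta> < 2/3"
    and "is_cf_expansion \<theta> a" and "unbounded_type a"
    and "\<exists>\<tau>>0. \<exists>K. \<forall>k\<ge>K.
           real (record_index a (Suc k)) - real (record_index a k)
             > 2 powr ((5 + \<tau>) * real (a (record_index a (Suc k))))"
    and "bounded (range (\<lambda>k. (quad c ^^ k) 0))"
    and "theta_recurrent (quad_unimodal c) a"
  shows "hausdorff_dim (closure (range (\<lambda>k. (quad c ^^ k) 0))) = 0"
proof -
  have pos: "1 \<le> a i" if "1 \<le> i" for i
    using assms(4) that by (simp add: is_cf_expansion_def)
  obtain \<tau> K where \<tau>: "0 < \<tau>" "\<And>k. K \<le> k \<Longrightarrow> real (record_index a (Suc k)) - real (record_index a k)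
      > 2 powr ((5 + \<tau>) * real (a (record_index a (Suc k))))"
    using assms(6) by blast
  obtain C where C: "\<And>n. 1 \<le> n \<Longrightarrow> a n \<le> n + C"
    using linear_partial_quotients[OF pos assms(5) \<tau>] by blast
  have "rotation_recurrence c (qbeta c) a (cf_q a)
      (\<lambda>n i. has_cf_rec (quad_unimodal c) a n ((quad_unimodal c ^^ i) 0))"
    using unit_partial_quotients[OF assms(4,2,3)] pos assms(7,8) by (intro rotation_recurrence_quad)
  then show ?thesis by (rule dimension_zero) (rule C)
qed

end
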